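(* Let $p_1,p_2\in S^2$ with $p_1=-p_2$, let $\alpha_1,\alpha_2$ be real numbers with $\min\{\alpha_1,\alpha_2\}=\alpha_1>0$, let $K\in C^\infty(S^2)$ with $K>0$ on $S^2$ be axially symmetric with respect to the direction identified by $p_1$ and $p_2$, and let $$h(x)=K(x)\,e^{-4\pi\alpha_1G(x,p_1)-4\pi\alpha_2G(x,p_2)}.$$ Then for every $\rho\in(0,8\pi(1+\alpha_1))$ the Liouville equation $$-\Delta_{g_0}u=\rho\left(\frac{he^u}{\int_{S^2}he^u\,dv_{g_0}}-\frac1{4\pi}\right)\quad\text{on }S^2$$ has an axially symmetric solution (with respect to the same direction).
   Context: $(S^2,g_0)$ is the standard unit sphere in $\mathbb{R}^3$, of area $4\pi$, with area measure $dv_{g_0}$ and Laplace–Beltrami operator $\Delta_{g_0}$. $G$ is its Green's function: $-\Delta_{g_0}G(x,\cdot)=\delta_x-\frac1{4\pi}$ on $S^2$ and $\int_{S^2}G(x,y)\,dv_{g_0}(y)=0$. A function $f$ on $S^2$ is axially symmetric with respect to the direction identified by $p_1,p_2=-p_1$ if $f(x)$ depends only on the Euclidean inner product $x\cdot p_1$ (almost everywhere, for Sobolev functions). Solutions are functions $u\in H^1(S^2)$ solving the equation weakly. *)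

theory Defs
  imports "HOL-Analysis.Analysis"
begin

abbreviation S2 :: "(real^3) set" where
  "S2 \<equiv> sphere 0 1"

text \<open>Functions and vector fields on the sphere are represented by total functions on the ambient
  space. Every notion below depends only on their values on \<open>S2\<close>.\<close>

subsection \<open>Smooth functions\<close>

primrec Ck_on :: "nat \<Rightarrow> 'a::real_normed_vector set \<Rightarrow> ('a \<Rightarrow> 'b::real_normed_vector) \<Rightarrow> bool" where
  "Ck_on 0 U F \<longleftrightarrow> continuous_on U F"
| "Ck_on (Suc k) U F \<longleftrightarrow>
     (\<forall>x\<in>U. F differentiable (at x)) \<and> (\<forall>v. Ck_on k U (\<lambda>x. frechet_derivative F (at x) v))"

text \<open>\<open>C\<^sup>\<infinity>\<close> on the embedded submanifold \<open>S2\<close>: restriction of a smooth map on a neighbourhood.\<close>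

definition smooth_S2 :: "(real^3 \<Rightarrow> 'b::real_normed_vector) \<Rightarrow> bool" where
  "smooth_S2 f \<longleftrightarrow> (\<exists>U F. open U \<and> S2 \<subseteq> U \<and> (\<forall>k. Ck_on k U F) \<and> (\<forall>x\<in>S2. F x = f x))"

subsection \<open>Area measure\<close>

text \<open>The surface measure from the polar decomposition of Lebesgue measure: the area of \<open>A\<close> is
  three times the volume of the cone \<open>{t *\<^sub>R x | 0 < t \<le> 1, x \<in> A}\<close>.\<close>

definition area_S2 :: "(real^3) measure" where
  "area_S2 = scale_measure 3
     (distr (restrict_space lborel (cball 0 1 - {0})) (restrict_space borel S2)
        (\<lambda>x. x /\<^sub>R norm x))"

subsection \<open>Gradient, divergence, Laplace--Beltrami operator\<close>

text \<open>A derivative at \<open>x\<close> within \<open>S2\<close> is determined on the tangent space \<open>x\<^sup>\<bottom>\<close> only. It becomes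
  unique once its value on the normal vector \<open>x\<close> is prescribed, here to be zero.\<close>

lemma has_derivative_S2_unique:
  fixes f :: "real^3 \<Rightarrow> 'b::real_normed_vector"
  assumes x: "x \<in> S2" and D: "(f has_derivative D) (at x within S2)"
    and D': "(f has_derivative D') (at x within S2)" and eq: "D x = D' x"
  shows "D = D'"
proof -
  have lin: "linear D" "linear D'"
    using D D' has_derivative_linear by blast+
  have xx: "x \<bullet> x = 1" using x by (simp add: dot_square_norm)
  have unit: "D t = D' t" if t: "t \<bullet> x = 0" "norm t = 1" for t
  proof -
    define c where "c = (\<lambda>s::real. cos s *\<^sub>R x + sin s *\<^sub>R t)"
    have tt: "t \<bullet> t = 1" using t by (simp add: dot_square_norm)
    have cS: "c s \<in> S2" for s
    proof -
      have "(norm (c s))\<^sup>2 = (cos s)\<^sup>2 + (sin s)\<^sup>2"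
        unfolding power2_norm_eq_inner c_def using xx tt t
        by (simp add: inner_add_left inner_add_right inner_commute power2_eq_square)
      then have "(norm (c s))\<^sup>2 = 1" by simp
      then show ?thesis by (simp add: power2_eq_1_iff) (smt (verit) norm_ge_zero)
    qed
    have c0: "c 0 = x" by (simp add: c_def)
    have cd: "(c has_derivative (\<lambda>s. s *\<^sub>R t)) (at 0)"
      unfolding c_def by (auto intro!: derivative_eq_intros)
    have img: "c ` UNIV \<subseteq> S2" using cS by auto
    have "((\<lambda>s. f (c s)) has_derivative (\<lambda>s. E (s *\<^sub>R t))) (at 0)"
      if "(f has_derivative E) (at x within S2)" for E
    proof -
      have "(f has_derivative E) (at (c 0) within c ` UNIV)"
        using has_derivative_subset[OF that img] c0 by simp
      from has_derivative_in_compose[OF cd this] show ?thesis by simp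
    qed
    then have "(\<lambda>s. D (s *\<^sub>R t)) = (\<lambda>s. D' (s *\<^sub>R t))"
      using D D' has_derivative_unique by blast
    then have "D (1 *\<^sub>R t) = D' (1 *\<^sub>R t)" by meson
    then show ?thesis by simp
  qed
  have tang: "D t = D' t" if "t \<bullet> x = 0" for t
  proof (cases "t = 0")
    case True
    then show ?thesis using lin by (simp add: linear_0)
  next
    case False
    then have "D (t /\<^sub>R norm t) = D' (t /\<^sub>R norm t)" using that by (intro unit) auto
    then have "D t /\<^sub>R norm t = D' t /\<^sub>R norm t" using lin by (simp only: linear_scale)
    with False show ?thesis by simp
  qed
  show ?thesis
  proof
    fix v
    have v: "v = (v - (v \<bullet> x) *\<^sub>R x) + (v \<bullet> x) *\<^sub>R x" by simp
    have "D (v - (v \<bullet> x) *\<^sub>R x) = D' (v - (v \<bullet> x) *\<^sub>R x)"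
      by (rule tang) (simp add: inner_diff_left xx)
    then show "D v = D' v"
      by (subst (1 2) v, simp only: linear_add[OF lin(1)] linear_add[OF lin(2)]
          linear_scale[OF lin(1)] linear_scale[OF lin(2)] eq)
  qed
qed

definition grad_S2 :: "(real^3 \<Rightarrow> real) \<Rightarrow> real^3 \<Rightarrow> real^3" where
  "grad_S2 f x = (THE v. v \<bullet> x = 0 \<and> (f has_derivative (\<lambda>w. v \<bullet> w)) (at x within S2))"

text \<open>The covariant derivative of a tangent field \<open>X\<close> is the tangential part of its ambient
  derivative \<open>D\<close>. Since \<open>D x = 0\<close>, the trace over the tangent space is the full trace of \<open>D\<close>.\<close>

definition div_S2 :: "(real^3 \<Rightarrow> real^3) \<Rightarrow> real^3 \<Rightarrow> real" where
  "div_S2 X x =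
     (let D = (THE D. (X has_derivative D) (at x within S2) \<and> D x = 0)
      in \<Sum>b\<in>Basis. D b \<bullet> b)"

definition laplace_S2 :: "(real^3 \<Rightarrow> real) \<Rightarrow> real^3 \<Rightarrow> real" where
  "laplace_S2 f = div_S2 (grad_S2 f)"

subsection \<open>Green's function\<close>

text \<open>The equation is understood in the sense of distributions in the second variable. Continuity
  away from the pole selects the usual representative of each \<open>G x\<close>, so that the values
  \<open>G x p\<close> with \<open>p\<close> fixed and \<open>x \<noteq> p\<close> are determined.\<close>

definition is_green_S2 :: "(real^3 \<Rightarrow> real^3 \<Rightarrow> real) \<Rightarrow> bool" where
  "is_green_S2 G \<longleftrightarrow> (\<forall>x\<in>S2.
     continuous_on (S2 - {x}) (G x) \<and>
     integrable area_S2 (G x) \<and>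
     (\<forall>\<phi>. smooth_S2 \<phi> \<longrightarrow>
        (\<integral>y. G x y * (- laplace_S2 \<phi> y) \<partial>area_S2) = \<phi> x - 1 / (4 * pi) * (\<integral>y. \<phi> y \<partial>area_S2)) \<and>
     (\<integral>y. G x y \<partial>area_S2) = 0)"

subsection \<open>The Sobolev space \<open>H\<^sup>1\<close> and weak solutions\<close>

definition has_weak_grad_S2 :: "(real^3 \<Rightarrow> real) \<Rightarrow> (real^3 \<Rightarrow> real^3) \<Rightarrow> bool" where
  "has_weak_grad_S2 u V \<longleftrightarrow>
     V \<in> borel_measurable area_S2 \<and>
     (AE x in area_S2. V x \<bullet> x = 0) \<and>
     integrable area_S2 (\<lambda>x. (norm (V x))\<^sup>2) \<and>
     (\<forall>X. smooth_S2 X \<and> (\<forall>x\<in>S2. X x \<bullet> x = 0) \<longrightarrow>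
        (\<integral>x. u x * div_S2 X x \<partial>area_S2) = - (\<integral>x. V x \<bullet> X x \<partial>area_S2))"

definition H1_S2 :: "(real^3 \<Rightarrow> real) set" where
  "H1_S2 = {u. u \<in> borel_measurable area_S2 \<and> integrable area_S2 (\<lambda>x. (u x)\<^sup>2) \<and>
               (\<exists>V. has_weak_grad_S2 u V)}"

definition liouville_weak_solution :: "(real^3 \<Rightarrow> real) \<Rightarrow> real \<Rightarrow> (real^3 \<Rightarrow> real) \<Rightarrow> bool" where
  "liouville_weak_solution h \<rho> u \<longleftrightarrow>
     u \<in> H1_S2 \<and>
     integrable area_S2 (\<lambda>x. h x * exp (u x)) \<and>
     (\<exists>V. has_weak_grad_S2 u V \<and>
        (\<forall>\<phi>. smooth_S2 \<phi> \<longrightarrow>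
           (\<integral>x. V x \<bullet> grad_S2 \<phi> x \<partial>area_S2) =
           \<rho> * (\<integral>x. (h x * exp (u x) / (\<integral>y. h y * exp (u y) \<partial>area_S2) - 1 / (4 * pi)) * \<phi> x \<partial>area_S2)))"

subsection \<open>Axial symmetry\<close>

definition axially_symmetric :: "real^3 \<Rightarrow> (real^3 \<Rightarrow> real) \<Rightarrow> bool" where
  "axially_symmetric p f \<longleftrightarrow> (\<exists>g. \<forall>x\<in>S2. f x = g (x \<bullet> p))"

definition axially_symmetric_AE :: "real^3 \<Rightarrow> (real^3 \<Rightarrow> real) \<Rightarrow> bool" where
  "axially_symmetric_AE p f \<longleftrightarrow> (\<exists>g. AE x in area_S2. f x = g (x \<bullet> p))"

end

(* In the height coordinate z = x . p1 the Green's function is explicit, G(x, p) = c - log((1 - x . p) / 2) / (4 pi),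
   so h = C k(z) (1 - z)^\<alpha>1 (1 + z)^\<alpha>2, and with a = \<rho> / (4 pi) and N the z-dependent factor of h an axially symmetric
   solution is a function U on [-1, 1] with
     (1 - z^2) U'(z) = a (1 + z) - m(z),   m(z) = integral of N e^U over [-1, z],   m(1) = 2 a.
   It is found by shooting from z = -1 with initial value ln l. Put E = (1 - z^2) m'. Then E' = m' (B - m)
   with B(-1) = 2 (1 + \<alpha>2) > a and B(1) = 2 a - 2 (1 + \<alpha>1) < a. The first inequality forces m to exceed 2 a for large l,
   the second keeps m below 2 a for small l. Both are open conditions on l, so by connectedness some l satisfies neither.
   For this l the same differential inequality gives 2 a - m = O((1 - z)^d) with d > 0, hence U extends continuously to z = 1.

   On the sphere, the divergence theorem follows from the rotation invariance of the area: with e_i the standard basis,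
   div X is the sum over i of the derivatives of (x \<times> X)_i along the rotation fields e_i \<times> x. All weak identities for zonal
   functions, whose derivatives may be singular at the poles, are obtained from this by polynomial approximation in z,
   since every polynomial is a constant plus ((1 - z^2) R)' for a polynomial R. *)
theory Submission
  imports Defs
begin

section \<open>Calculus on intervals\<close>

text \<open>Why the end values of B decide the matter: for a solution E vanishes at both ends, so
  integrating E' = m' (B - m) shows that the mean of B with respect to m' dz is exactly a. All the
  mass near -1, where B exceeds a, or all of it near 1, where B is below a, are therefore the two
  ways in which shooting fails. The bound on \<rho> is precisely B(1) < a, and \<alpha>1 \<le>
  \<alpha>2 carries it over to B(-1) > a. The obstacles are the poles. At -1 the initial value
  problem is singular and is replaced by a Volterra equation, whose inner primitive cancels the zero
  of 1 - z^2. At 1 the continuity of U rests on the same quantity \<open>\<Psi>\<close> that keeps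
  the two open sets of parameters apart. On the sphere, r = U' is merely continuous up to the poles,
  so polynomials must approximate r and ((1 - z^2) r)' simultaneously and without loss there. For
  Green's function the difficulty is that its equation acts on the second variable, whereas h
  involves G(x, p) as a function of x; a bump concentrating at p converts one into the
  other.\<close>

lemma continuous_on_difference_quotient:
  fixes q :: "real \<Rightarrow> real"
  assumes "continuous_on S q" and "c \<in> S" and D: "(q has_real_derivative D) (at c within S)"
  shows "continuous_on S (\<lambda>s. if s = c then D else (q s - q c) / (s - c))"
proof (unfold continuous_on_eq_continuous_within, intro ballI)
  fix x assume x: "x \<in> S"
  let ?f = "\<lambda>s. if s = c then D else (q s - q c) / (s - c)"
  show "continuous (at x within S) ?f"
  proof (cases "x = c")
    case True
    have "((\<lambda>s. (q s - q c) / (s - c)) \<longlongrightarrow> D) (at c within S)"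
      using D by (simp add: has_field_derivative_iff)
    then have "(?f \<longlongrightarrow> D) (at c within S)"
      by (rule Lim_transform_eventually) (auto simp: eventually_at_filter)
    with True show ?thesis by (simp add: continuous_within)
  next
    case False
    have "continuous (at x within S) q"
      using assms(1) x by (simp add: continuous_on_eq_continuous_within)
    then have "continuous (at x within S) (\<lambda>s. (q s - q c) / (s - c))"
      using False by (auto intro!: continuous_intros)
    then show ?thesis
      by (rule continuous_transform_within[where \<delta>="dist x c"]) (use False x in \<open>auto simp: dist_commute\<close>)
  qed
qed

lemma exp_minus_mult_cancel: "exp (- x) * (c * exp x) = (c :: real)"
  by (simp add: exp_minus)

lemma abs_integral_le:
  fixes g h :: "real \<Rightarrow> real"
  assumes "continuous_on {a..b} g" "continuous_on {a..b} h" "\<And>x. x \<in> {a..b} \<Longrightarrow> \<bar>g x\<bar> \<le> h x"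
  shows "\<bar>integral {a..b} g\<bar> \<le> integral {a..b} h"
  using integral_norm_bound_integral[of g "{a..b}" h] assms
  by (auto intro: integrable_continuous_real)

lemma integral_mono_cont:
  fixes g h :: "real \<Rightarrow> real"
  assumes "continuous_on {a..b} g" "continuous_on {a..b} h" "\<And>x. x \<in> {a..b} \<Longrightarrow> g x \<le> h x"
  shows "integral {a..b} g \<le> integral {a..b} h"
  using assms by (intro integral_le integrable_continuous_real)

lemma continuous_on_Icc_bounded:
  fixes f :: "real \<Rightarrow> real"
  assumes "continuous_on {a..b} f"
  obtains C where "\<And>x. x \<in> {a..b} \<Longrightarrow> \<bar>f x\<bar> \<le> C" "C > 0"
proof -
  have "bounded (f ` {a..b})"
    by (rule compact_imp_bounded[OF compact_continuous_image[OF assms compact_Icc]])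
  then obtain C where "C > 0" "\<forall>y\<in>f ` {a..b}. norm y \<le> C" unfolding bounded_pos by blast
  then show ?thesis using that[of C] by auto
qed

lemma one_minus_square_pos: "(z::real) \<in> {-1<..<1} \<Longrightarrow> 1 - z\<^sup>2 > 0"
  using abs_square_less_1[of z] by (simp add: abs_less_iff)

lemma one_minus_square_factor: "1 - (z::real)\<^sup>2 = (1 - z) * (1 + z)"
  by (simp add: power2_eq_square algebra_simps)

lemma at_within_Icc_interior: "(z::real) \<in> {x<..<y} \<Longrightarrow> at z within {x..y} = at z"
  by (rule at_within_interior) simp

lemma continuous_on_extend_left:
  fixes f :: "real \<Rightarrow> real"
  assumes f: "continuous_on {a..<b} f" and L: "(f \<longlongrightarrow> L) (at_left b)" and "a < b"
  shows "continuous_on {a..b} (\<lambda>z. if z < b then f z else L)" (is "continuous_on _ ?g")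
proof (unfold continuous_on_eq_continuous_within, intro ballI)
  fix z assume z: "z \<in> {a..b}"
  show "continuous (at z within {a..b}) ?g"
  proof (cases "z = b")
    case True
    have "(?g \<longlongrightarrow> L) (at_left b)"
      by (rule Lim_transform_eventually[OF L]) (auto simp: eventually_at_filter)
    then show ?thesis using True \<open>a < b\<close> by (simp add: continuous_within at_within_Icc_at_left)
  next
    case False
    then have z': "z \<in> {a..<b}" using z by auto
    have "continuous (at z within {a..<b}) f" using f z' by (auto simp: continuous_on_eq_continuous_within)
    then have "continuous (at z within {a..<b}) ?g"
      by (rule continuous_transform_within[where \<delta>="b - z"]) (use z' in \<open>auto simp: dist_real_def\<close>)
    moreover have "at z within {a..<b} = at z within {a..b}"
      by (rule at_within_nhd[where S="{..<b}"]) (use z' in auto)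
    ultimately show ?thesis by simp
  qed
qed

lemma tendsto_at_left_mono_bounded:
  fixes f :: "real \<Rightarrow> real"
  assumes "a < b" and mono: "\<And>x y. a \<le> x \<Longrightarrow> x \<le> y \<Longrightarrow> y < b \<Longrightarrow> f x \<le> f y"
    and bd: "\<And>x. a \<le> x \<Longrightarrow> x < b \<Longrightarrow> f x \<le> C"
  shows "\<exists>L. (f \<longlongrightarrow> L) (at_left b)"
proof -
  define L where "L = Sup (f ` {a..<b})"
  have bdd: "bdd_above (f ` {a..<b})" using bd by (auto intro!: bdd_aboveI[where M=C])
  have ne: "f ` {a..<b} \<noteq> {}" using \<open>a < b\<close> by auto
  have "(f \<longlongrightarrow> L) (at_left b)"
  proof (rule increasing_tendsto)
    show "eventually (\<lambda>x. f x \<le> L) (at_left b)"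
      unfolding eventually_at_left[OF \<open>a < b\<close>]
      by (intro exI[of _ a]) (auto simp: L_def \<open>a < b\<close> intro!: cSup_upper bdd)
    fix x assume "x < L"
    then obtain y where y: "y \<in> {a..<b}" "x < f y"
      using less_cSup_iff[OF ne bdd] unfolding L_def by auto
    then show "eventually (\<lambda>z. x < f z) (at_left b)"
      unfolding eventually_at_left[OF \<open>a < b\<close>]
      by (intro exI[of _ y]) (use y mono[of y] in \<open>auto intro: less_le_trans\<close>)
  qed
  then show ?thesis ..
qed

text \<open>Only continuity is asked at the endpoints, because the derivative formulas below hold in
  the open interval and are singular at the poles.\<close>

lemma nondecreasing_if_deriv_nonneg:
  fixes f :: "real \<Rightarrow> real"
  assumes "x \<le> y" and "continuous_on {x..y} f"
    and "\<And>z. x < z \<Longrightarrow> z < y \<Longrightarrow> \<exists>d. (f has_real_derivative d) (at z) \<and> d \<ge> 0"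
  shows "f x \<le> f y"
proof (cases "x = y")
  case False
  then have xy: "x < y" using assms by simp
  obtain d z where z: "x < z" "z < y" "(f has_real_derivative d) (at z)" "f y - f x = (y - x) * d"
    using MVT[OF xy assms(2)] assms(3) by (metis real_differentiable_def)
  then have "d \<ge> 0" using assms(3)[of z] DERIV_unique by blast
  then have "(y - x) * d \<ge> 0" using xy by simp
  then show ?thesis using z by simp
qed auto

lemma powr_minus_mult_cancel:
  fixes x y :: real
  shows "y > 0 \<Longrightarrow> x * y powr (- d) * y powr d = x"
  by (simp add: powr_minus)

section \<open>A singular Volterra equation\<close>

text \<open>The solution operator of ((1 - z^2) v')' = g with v(-1) = 0 that is regular at -1: the
  inner integral is (1 - z^2) v'.\<close>

definition volterra :: "(real \<Rightarrow> real) \<Rightarrow> real \<Rightarrow> real" where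
  "volterra g z = integral {-1..z} (\<lambda>s. integral {-1..s} g / (1 - s\<^sup>2))"

text \<open>Apart from the factor 1 / (1 - s), the integrand is the difference quotient at -1 of the
  primitive of \<open>g\<close>, so it has a limit there. The hypothesis \<open>g (-1) = 0\<close>
  makes this limit agree with the value 0 / 0 = 0 at the endpoint.\<close>

lemma continuous_on_volterra_integrand:
  fixes g :: "real \<Rightarrow> real"
  assumes g: "continuous_on {-1..b} g" and "g (-1) = 0" and b: "-1 \<le> b" "b < 1"
  shows "continuous_on {-1..b} (\<lambda>s. integral {-1..s} g / (1 - s\<^sup>2))"
proof -
  let ?q = "\<lambda>s. integral {-1..s} g"
  have "continuous_on {-1..b} (\<lambda>s. if s = -1 then g (-1) else (?q s - ?q (-1)) / (s - (-1)))"
    by (rule continuous_on_difference_quotient)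
      (use b in \<open>auto intro!: integral_has_real_derivative indefinite_integral_continuous_1
         integrable_continuous_real g\<close>)
  then have "continuous_on {-1..b} (\<lambda>s. (if s = -1 then g (-1) else (?q s - ?q (-1)) / (s - (-1))) / (1 - s))"
    by (rule continuous_on_divide) (use b in \<open>auto intro!: continuous_intros\<close>)
  then show ?thesis
    by (rule continuous_on_eq) (use assms(2) in \<open>auto simp: power2_eq_square field_simps\<close>)
qed

lemma volterra_derivative:
  assumes g: "continuous_on {-1..b} g" and "g (-1) = 0" and b: "-1 \<le> b" "b < 1" and "z \<in> {-1..b}"
  shows "(volterra g has_real_derivative integral {-1..z} g / (1 - z\<^sup>2)) (at z within {-1..b})"
  unfolding volterra_def
  by (rule integral_has_real_derivative[OF continuous_on_volterra_integrand]) (use assms in auto)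

lemma continuous_on_volterra:
  assumes "continuous_on {-1..b} g" and "g (-1) = 0" and b: "-1 \<le> b" "b < 1"
  shows "continuous_on {-1..b} (volterra g)"
  using volterra_derivative[OF assms] by (meson DERIV_continuous continuous_on_eq_continuous_within)

lemma volterra_diff:
  assumes f: "continuous_on {-1..b} f" "f (-1) = 0" and g: "continuous_on {-1..b} g" "g (-1) = 0"
    and b: "-1 \<le> b" "b < 1" and z: "z \<in> {-1..b}"
  shows "volterra (\<lambda>s. f s - g s) z = volterra f z - volterra g z"
proof -
  have sub: "continuous_on {-1..z} f" "continuous_on {-1..z} g"
    using f g z by (auto intro: continuous_on_subset)
  have "volterra (\<lambda>s. f s - g s) z =
    integral {-1..z} (\<lambda>s. integral {-1..s} f / (1 - s\<^sup>2) - integral {-1..s} g / (1 - s\<^sup>2))"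
    unfolding volterra_def
  proof (rule integral_cong)
    fix s assume "s \<in> {-1..z}"
    then have "integral {-1..s} (\<lambda>s. f s - g s) = integral {-1..s} f - integral {-1..s} g"
      by (intro integral_diff integrable_continuous_real continuous_on_subset[OF sub(1)]
          continuous_on_subset[OF sub(2)]) auto
    then show "integral {-1..s} (\<lambda>s. f s - g s) / (1 - s\<^sup>2) =
      integral {-1..s} f / (1 - s\<^sup>2) - integral {-1..s} g / (1 - s\<^sup>2)"
      by (simp add: diff_divide_distrib)
  qed
  also have "\<dots> = volterra f z - volterra g z"
    unfolding volterra_def
    by (rule integral_diff; rule integrable_continuous_real; rule continuous_on_volterra_integrand)
      (use sub f g b z in auto)
  finally show ?thesis .
qed

text \<open>The exponential weight is Bielecki's: the outer integration gains a factor 1 / \<kappa>,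
  which can be made small on any interval ending before 1. The inner integration gains the factor 1
  + s that cancels the zero of 1 - s^2.\<close>

lemma volterra_bound:
  assumes g: "continuous_on {-1..b} g" "g (-1) = 0" and b: "-1 \<le> b" "b < 1" and z: "z \<in> {-1..b}"
    and \<kappa>: "\<kappa> > 0" and bd: "\<And>s. s \<in> {-1..b} \<Longrightarrow> \<bar>g s\<bar> \<le> A * exp (\<kappa> * (s + 1))"
  shows "\<bar>volterra g z\<bar> \<le> A / (\<kappa> * (1 - b)) * exp (\<kappa> * (z + 1))"
proof -
  have A: "A \<ge> 0" using bd[of "-1"] b by auto
  have prim: "\<bar>integral {-1..s} g\<bar> \<le> A * (1 + s) * exp (\<kappa> * (s + 1))" if s: "s \<in> {-1..b}" for s
  proof -
    have "\<bar>integral {-1..s} g\<bar> \<le> integral {-1..s} (\<lambda>x. A * exp (\<kappa> * (s + 1)))"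
    proof (rule abs_integral_le)
      fix x assume x: "x \<in> {-1..s}"
      have "\<bar>g x\<bar> \<le> A * exp (\<kappa> * (x + 1))" using bd x s by auto
      also have "\<dots> \<le> A * exp (\<kappa> * (s + 1))"
        using x \<kappa> A by (intro mult_left_mono) auto
      finally show "\<bar>g x\<bar> \<le> A * exp (\<kappa> * (s + 1))" .
    qed (use s in \<open>auto intro: continuous_on_subset[OF g(1)]\<close>)
    also have "\<dots> = A * (1 + s) * exp (\<kappa> * (s + 1))" using s by simp
    finally show ?thesis .
  qed
  have E: "((\<lambda>s. A / (1 - b) * exp (\<kappa> * (s + 1))) has_integral
      (A / (1 - b) / \<kappa> * exp (\<kappa> * (z + 1)) - A / (1 - b) / \<kappa> * exp (\<kappa> * (-1 + 1)))) {-1..z}"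
  proof (rule fundamental_theorem_of_calculus)
    show "-1 \<le> z" using z by simp
    fix x assume "x \<in> {-1..z}"
    have "((\<lambda>s. A / (1 - b) / \<kappa> * exp (\<kappa> * (s + 1))) has_real_derivative
        A / (1 - b) / \<kappa> * (exp (\<kappa> * (x + 1)) * \<kappa>)) (at x within {-1..z})"
      by (rule DERIV_cmult) (auto intro!: derivative_eq_intros)
    also have "A / (1 - b) / \<kappa> * (exp (\<kappa> * (x + 1)) * \<kappa>) = A / (1 - b) * exp (\<kappa> * (x + 1))"
      using \<kappa> by simp
    finally show "((\<lambda>s. A / (1 - b) / \<kappa> * exp (\<kappa> * (s + 1))) has_vector_derivative
        A / (1 - b) * exp (\<kappa> * (x + 1))) (at x within {-1..z})"
      by (simp add: has_real_derivative_iff_has_vector_derivative)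
  qed
  have "\<bar>volterra g z\<bar> \<le> integral {-1..z} (\<lambda>s. A / (1 - b) * exp (\<kappa> * (s + 1)))"
    unfolding volterra_def
  proof (rule abs_integral_le)
    show "continuous_on {-1..z} (\<lambda>s. integral {-1..s} g / (1 - s\<^sup>2))"
      by (rule continuous_on_volterra_integrand) (use g b z in \<open>auto intro: continuous_on_subset\<close>)
    fix s assume s: "s \<in> {-1..z}"
    show "\<bar>integral {-1..s} g / (1 - s\<^sup>2)\<bar> \<le> A / (1 - b) * exp (\<kappa> * (s + 1))"
    proof (cases "s = -1")
      case True then show ?thesis using A b by simp
    next
      case False
      then have pos: "1 + s > 0" "1 - s > 0" "1 - s \<ge> 1 - b" using s z b by auto
      have "\<bar>integral {-1..s} g / (1 - s\<^sup>2)\<bar> = \<bar>integral {-1..s} g\<bar> / ((1 + s) * (1 - s))"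
        using pos by (simp add: one_minus_square_factor abs_mult mult.commute)
      also have "\<dots> \<le> (A * (1 + s) * exp (\<kappa> * (s + 1))) / ((1 + s) * (1 - s))"
        using prim[of s] s z pos by (intro divide_right_mono) auto
      also have "\<dots> = (1 + s) * (A * exp (\<kappa> * (s + 1))) / ((1 + s) * (1 - s))" by (simp only: mult_ac)
      also have "\<dots> = A * exp (\<kappa> * (s + 1)) / (1 - s)" using pos by simp
      also have "\<dots> \<le> A * exp (\<kappa> * (s + 1)) / (1 - b)"
        using pos A b by (intro divide_left_mono) auto
      finally show ?thesis by simp
    qed
  qed (use b in \<open>auto intro!: continuous_intros\<close>)
  also have "\<dots> = A / (1 - b) / \<kappa> * exp (\<kappa> * (z + 1)) - A / (1 - b) / \<kappa> * exp (\<kappa> * (-1 + 1))"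
    using E by (rule integral_unique)
  also have "\<dots> \<le> A / (1 - b) / \<kappa> * exp (\<kappa> * (z + 1))" using A b \<kappa> by simp
  finally show ?thesis by (simp add: mult.commute)
qed

section \<open>Existence, uniqueness and parameter dependence for the Volterra equation\<close>

lemma abs_exp_min_diff_le:
  fixes x y :: real
  shows "\<bar>exp (min x 0) - exp (min y 0)\<bar> \<le> \<bar>x - y\<bar>"
proof -
  have *: "exp u - exp v \<le> u - v" if "v \<le> u" "u \<le> 0" for u v :: real
  proof -
    have "1 + (v - u) \<le> exp (v - u)" by (rule exp_ge_add_one_self)
    then have "1 - exp (v - u) \<le> u - v" by linarith
    then have "exp u * (1 - exp (v - u)) \<le> exp u * (u - v)" by (intro mult_left_mono) auto
    also have "\<dots> \<le> 1 * (u - v)" using that by (intro mult_right_mono) auto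
    finally show ?thesis by (simp add: right_diff_distrib exp_diff)
  qed
  show ?thesis
    using *[of "min y 0" "min x 0"] *[of "min x 0" "min y 0"]
    by (cases "x \<le> y") (auto simp: min_def abs_if split: if_splits)
qed

text \<open>The truncation \<open>min (w s) 0\<close> makes the nonlinearity bounded and
  1-Lipschitz, so that the contraction principle applies on the whole interval at once. It becomes
  vacuous when the solution is known to be nonpositive.\<close>

lemma volterra_solution_exists:
  fixes Q :: "real \<Rightarrow> real"
  assumes Q: "continuous_on {-1..b} Q" "Q (-1) = 0" and b: "-1 \<le> b" "b < 1"
  shows "\<exists>w. continuous_on {-1..b} w \<and>
    (\<forall>z\<in>{-1..b}. w z = - volterra (\<lambda>s. Q s * exp (min (w s) 0)) z)"
proof -
  obtain C where C: "\<And>s. s \<in> {-1..b} \<Longrightarrow> \<bar>Q s\<bar> \<le> C" "C > 0"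
    using continuous_on_Icc_bounded[OF Q(1)] by blast
  \<comment> \<open>This makes the contraction factor C / (\<kappa> (1 - b)) equal to 1/2.\<close>
  define \<kappa> where "\<kappa> = 2 * C / (1 - b)"
  have \<kappa>: "\<kappa> > 0" using C b by (simp add: \<kappa>_def)
  \<comment> \<open>The fixed point is sought among bounded continuous functions on the whole line;
    clamping the argument makes the operator map into that space.\<close>
  define p where "p = (\<lambda>x. max (-1) (min b x))"
  have p: "p x \<in> {-1..b}" and pid: "x \<in> {-1..b} \<Longrightarrow> p x = x" for x using b by (auto simp: p_def)
  have pc: "continuous_on UNIV p" unfolding p_def by (intro continuous_intros)
  \<comment> \<open>The unknown \<open>g\<close> is the solution times exp (- \<kappa> (s + 1)), so
    that the plain sup distance of \<open>g\<close> is the weighted distance of the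
    solutions.\<close>
  define W where "W = (\<lambda>(g :: real \<Rightarrow>\<^sub>C real) s. exp (\<kappa> * (s + 1)) * g s)"
  define S where "S = (\<lambda>g s. Q s * exp (min (W g s) 0))"
  define T0 where "T0 = (\<lambda>g x. - (exp (- (\<kappa> * (p x + 1))) * volterra (S g) (p x)))"
  have Sc: "continuous_on {-1..b} (S g)" and S1: "S g (-1) = 0" for g
    using Q unfolding S_def W_def by (auto intro!: continuous_intros)
  have vc: "continuous_on UNIV (\<lambda>x. volterra (S g) (p x))" for g
    by (rule continuous_on_compose2[OF continuous_on_volterra[OF Sc S1 b] pc]) (use p in auto)
  have pcT: "continuous_on UNIV (T0 g)" for g
    unfolding T0_def using vc pc by (auto intro!: continuous_intros)
  have bcT: "T0 g \<in> bcontfun" for g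
  proof (rule bcontfun_normI[OF pcT, where b="C / (\<kappa> * (1 - b))"])
    fix x
    have "\<bar>S g s\<bar> \<le> C * exp (\<kappa> * (s + 1))" if s: "s \<in> {-1..b}" for s
    proof -
      have "\<bar>S g s\<bar> \<le> C * 1" unfolding S_def abs_mult using C(1)[OF s] C(2) by (intro mult_mono) auto
      also have "\<dots> \<le> C * exp (\<kappa> * (s + 1))" using s \<kappa> C by (intro mult_left_mono) auto
      finally show ?thesis .
    qed
    from volterra_bound[OF Sc S1 b p \<kappa> this]
    have "\<bar>volterra (S g) (p x)\<bar> \<le> C / (\<kappa> * (1 - b)) * exp (\<kappa> * (p x + 1))" .
    then have "exp (- (\<kappa> * (p x + 1))) * \<bar>volterra (S g) (p x)\<bar> \<le>
       exp (- (\<kappa> * (p x + 1))) * (C / (\<kappa> * (1 - b)) * exp (\<kappa> * (p x + 1)))" by (intro mult_left_mono) auto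
    also have "\<dots> = C / (\<kappa> * (1 - b))" by (rule exp_minus_mult_cancel)
    finally show "norm (T0 g x) \<le> C / (\<kappa> * (1 - b))" by (simp add: T0_def abs_mult)
  qed
  define T where "T = (\<lambda>g. Bcontfun (T0 g))"
  have T: "apply_bcontfun (T g) = T0 g" for g unfolding T_def using bcT by (rule Bcontfun_inverse)
  have lip: "dist (T g) (T h) \<le> 1/2 * dist g h" for g h
  proof (rule dist_bound)
    fix x
    define A where "A = C * dist g h"
    have bd: "\<bar>S g s - S h s\<bar> \<le> A * exp (\<kappa> * (s + 1))" if s: "s \<in> {-1..b}" for s
    proof -
      have "\<bar>S g s - S h s\<bar> = \<bar>Q s\<bar> * \<bar>exp (min (W g s) 0) - exp (min (W h s) 0)\<bar>"
        by (simp add: S_def abs_mult flip: right_diff_distrib)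
      also have "\<dots> \<le> C * \<bar>W g s - W h s\<bar>"
        using C(1)[OF s] C(2) abs_exp_min_diff_le by (intro mult_mono) auto
      also have "\<bar>W g s - W h s\<bar> = exp (\<kappa> * (s + 1)) * dist (g s) (h s)"
        by (simp add: W_def dist_real_def abs_mult flip: right_diff_distrib)
      also have "C * \<dots> \<le> C * (exp (\<kappa> * (s + 1)) * dist g h)"
        using C(2) dist_bounded[of g s h] by (intro mult_left_mono) auto
      finally show ?thesis by (simp add: A_def mult_ac)
    qed
    have "\<bar>volterra (\<lambda>s. S g s - S h s) (p x)\<bar> \<le> A / (\<kappa> * (1 - b)) * exp (\<kappa> * (p x + 1))"
      by (rule volterra_bound[OF _ _ b p \<kappa> bd]) (use S1 Sc in \<open>auto intro!: continuous_intros\<close>)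
    moreover have "A / (\<kappa> * (1 - b)) = 1/2 * dist g h"
      unfolding A_def \<kappa>_def using C b by (simp add: field_simps)
    ultimately have le: "\<bar>volterra (S g) (p x) - volterra (S h) (p x)\<bar> \<le> 1/2 * dist g h * exp (\<kappa> * (p x + 1))"
      using volterra_diff[OF Sc S1 Sc S1 b p, of g h x] by simp
    have "dist (T0 g x) (T0 h x) =
        exp (- (\<kappa> * (p x + 1))) * \<bar>volterra (S g) (p x) - volterra (S h) (p x)\<bar>"
    proof -
      have "T0 g x - T0 h x = - (exp (- (\<kappa> * (p x + 1))) * (volterra (S g) (p x) - volterra (S h) (p x)))"
        by (simp add: T0_def right_diff_distrib)
      then show ?thesis by (simp only: dist_real_def abs_minus_cancel abs_mult abs_exp_cancel)
    qed
    also have "\<dots> \<le> exp (- (\<kappa> * (p x + 1))) * (1/2 * dist g h * exp (\<kappa> * (p x + 1)))"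
      using le by (intro mult_left_mono) auto
    also have "\<dots> = 1/2 * dist g h" by (rule exp_minus_mult_cancel)
    finally show "dist (T g x) (T h x) \<le> 1/2 * dist g h" by (simp add: T)
  qed
  obtain g where g: "T g = g" using banach_fix_type[of "1/2" T] lip by auto
  have "W g z = - volterra (\<lambda>s. Q s * exp (min (W g s) 0)) z" if z: "z \<in> {-1..b}" for z
  proof -
    have "g z = T0 g z" using g T[of g] by simp
    then show ?thesis
      by (simp add: W_def S_def[symmetric] T0_def pid[OF z] exp_minus)
        (simp add: S_def W_def[abs_def])
  qed
  moreover have "continuous_on {-1..b} (W g)" unfolding W_def by (auto intro!: continuous_intros)
  ultimately show ?thesis by blast
qed


text \<open>A Gronwall argument in the weighted norm: if A is the maximum of the weighted difference
  of two solutions, the integral equations give A \<le> A / 2 + |l - l'| / (2 L), which bounds A.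
  The case l = l' is uniqueness.\<close>

lemma volterra_solution_lipschitz:
  assumes Q: "continuous_on {-1..b} Q" "Q (-1) = 0" and b: "-1 \<le> b" "b < 1" and L: "L > 0"
  shows "\<exists>C. \<forall>l\<in>{0..L}. \<forall>l'\<in>{0..L}. \<forall>w v. continuous_on {-1..b} w \<longrightarrow> continuous_on {-1..b} v \<longrightarrow>
    (\<forall>z\<in>{-1..b}. w z = - volterra (\<lambda>s. l * Q s * exp (min (w s) 0)) z) \<longrightarrow>
    (\<forall>z\<in>{-1..b}. v z = - volterra (\<lambda>s. l' * Q s * exp (min (v s) 0)) z) \<longrightarrow>
    (\<forall>z\<in>{-1..b}. \<bar>w z - v z\<bar> \<le> C * \<bar>l - l'\<bar>)"
proof -
  obtain C where C: "\<And>s. s \<in> {-1..b} \<Longrightarrow> \<bar>Q s\<bar> \<le> C" "C > 0"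
    using continuous_on_Icc_bounded[OF Q(1)] by blast
  define \<kappa> where "\<kappa> = 2 * L * C / (1 - b)"
  have \<kappa>: "\<kappa> > 0" using C b L by (simp add: \<kappa>_def)
  have "\<bar>w z - v z\<bar> \<le> exp (\<kappa> * (b + 1)) / L * \<bar>l - l'\<bar>"
    if l: "l \<in> {0..L}" "l' \<in> {0..L}" and wc: "continuous_on {-1..b} w" and vc: "continuous_on {-1..b} v"
      and w: "\<forall>z\<in>{-1..b}. w z = - volterra (\<lambda>s. l * Q s * exp (min (w s) 0)) z"
      and v: "\<forall>z\<in>{-1..b}. v z = - volterra (\<lambda>s. l' * Q s * exp (min (v s) 0)) z"
      and z: "z \<in> {-1..b}" for l l' w v z
  proof -
    let ?d = "\<lambda>s. exp (- (\<kappa> * (s + 1))) * \<bar>w s - v s\<bar>"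
    have "continuous_on {-1..b} ?d" using wc vc by (auto intro!: continuous_intros)
    moreover have "{-1..b} \<noteq> {}" using b by auto
    ultimately obtain t where t: "t \<in> {-1..b}" "\<And>s. s \<in> {-1..b} \<Longrightarrow> ?d s \<le> ?d t"
      using continuous_attains_sup[of "{-1..b}" ?d] by auto
    define A where "A = ?d t"
    have A0: "A \<ge> 0" by (simp add: A_def)
    have dA: "\<bar>w s - v s\<bar> \<le> A * exp (\<kappa> * (s + 1))" if "s \<in> {-1..b}" for s
    proof -
      have "?d s * exp (\<kappa> * (s + 1)) \<le> A * exp (\<kappa> * (s + 1))"
        using t(2)[OF that] by (intro mult_right_mono) (auto simp: A_def)
      then show ?thesis using exp_minus_mult_cancel[of "\<kappa> * (s + 1)" "\<bar>w s - v s\<bar>"] by (simp only: mult_ac)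
    qed
    define S where "S = (\<lambda>s. l * Q s * exp (min (w s) 0))"
    define S' where "S' = (\<lambda>s. l' * Q s * exp (min (v s) 0))"
    have S: "continuous_on {-1..b} S" "S (-1) = 0" "continuous_on {-1..b} S'" "S' (-1) = 0"
      using Q wc vc unfolding S_def S'_def by (auto intro!: continuous_intros)
    define D where "D = L * C * A + \<bar>l - l'\<bar> * C"
    have bd: "\<bar>S s - S' s\<bar> \<le> D * exp (\<kappa> * (s + 1))" if s: "s \<in> {-1..b}" for s
    proof -
      have "S s - S' s = l * Q s * (exp (min (w s) 0) - exp (min (v s) 0)) + (l - l') * Q s * exp (min (v s) 0)"
        by (simp add: S_def S'_def algebra_simps)
      then have "\<bar>S s - S' s\<bar> \<le> \<bar>l * Q s * (exp (min (w s) 0) - exp (min (v s) 0))\<bar> + \<bar>(l - l') * Q s * exp (min (v s) 0)\<bar>"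
        by (simp only: abs_triangle_ineq)
      also have "\<bar>l * Q s * (exp (min (w s) 0) - exp (min (v s) 0))\<bar> \<le> L * C * (A * exp (\<kappa> * (s + 1)))"
        unfolding abs_mult
        using C(1)[OF s] C(2) l L abs_exp_min_diff_le[of "w s" "v s"] dA[OF s]
        by (intro mult_mono) auto
      also have "\<bar>(l - l') * Q s * exp (min (v s) 0)\<bar> \<le> \<bar>l - l'\<bar> * C * exp (\<kappa> * (s + 1))"
      proof -
        have "0 \<le> \<kappa> * (s + 1)" using \<kappa> s by auto
        then show ?thesis
          unfolding abs_mult using C(1)[OF s] C(2) by (intro mult_mono) auto
      qed
      finally show ?thesis by (simp add: D_def algebra_simps)
    qed
    have "\<bar>w t - v t\<bar> = \<bar>volterra (\<lambda>s. S s - S' s) t\<bar>"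
      using w v t(1) volterra_diff[OF S b t(1)] by (simp add: S_def S'_def)
    also have "\<dots> \<le> D / (\<kappa> * (1 - b)) * exp (\<kappa> * (t + 1))"
      by (rule volterra_bound[OF _ _ b t(1) \<kappa> bd]) (use S in \<open>auto intro!: continuous_intros\<close>)
    also have "\<kappa> * (1 - b) = 2 * L * C" using b by (simp add: \<kappa>_def)
    finally have "A \<le> exp (- (\<kappa> * (t + 1))) * (D / (2 * L * C) * exp (\<kappa> * (t + 1)))"
      unfolding A_def by (intro mult_left_mono) auto
    then have "A \<le> D / (2 * L * C)" by (simp only: exp_minus_mult_cancel)
    also have "D / (2 * L * C) = A / 2 + \<bar>l - l'\<bar> / (2 * L)"
      using C L by (simp add: D_def field_simps)
    finally have AL: "A \<le> \<bar>l - l'\<bar> / L" by (simp add: field_simps)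
    have "\<bar>w z - v z\<bar> \<le> A * exp (\<kappa> * (z + 1))" by (rule dA[OF z])
    also have "\<dots> \<le> \<bar>l - l'\<bar> / L * exp (\<kappa> * (b + 1))"
      using AL A0 \<kappa> z L by (intro mult_mono) auto
    finally show ?thesis by (simp add: field_simps)
  qed
  then show ?thesis by blast
qed

lemma volterra_nonneg:
  assumes g: "continuous_on {-1..b} g" "g (-1) = 0" and b: "-1 \<le> b" "b < 1" and z: "z \<in> {-1..b}"
    and pos: "\<And>s. s \<in> {-1..b} \<Longrightarrow> g s \<ge> 0"
  shows "volterra g z \<ge> 0"
  unfolding volterra_def
proof (rule integral_nonneg)
  show "(\<lambda>s. integral {-1..s} g / (1 - s\<^sup>2)) integrable_on {-1..z}"
    by (rule integrable_continuous_real, rule continuous_on_subset[OF continuous_on_volterra_integrand[OF g b]])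
      (use z in auto)
  fix s assume s: "s \<in> {-1..z}"
  have "integral {-1..s} g \<ge> 0"
    by (rule integral_nonneg) (use pos s z in \<open>auto intro!: integrable_continuous_real continuous_on_subset[OF g(1)]\<close>)
  moreover have "1 - s\<^sup>2 \<ge> 0" using s z b abs_le_square_iff[of s 1] by auto
  ultimately show "0 \<le> integral {-1..s} g / (1 - s\<^sup>2)" by simp
qed

lemma volterra_cong:
  assumes "\<And>s. s \<in> {-1..z} \<Longrightarrow> f s = g s"
  shows "volterra f z = volterra g z"
  unfolding volterra_def
proof (rule integral_cong)
  fix s assume "s \<in> {-1..z}"
  then have "integral {-1..s} f = integral {-1..s} g" by (intro integral_cong assms) auto
  then show "integral {-1..s} f / (1 - s\<^sup>2) = integral {-1..s} g / (1 - s\<^sup>2)" by simp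
qed

text \<open>By uniqueness, the solutions on the intervals [-1, b] agree on common domains and glue
  to one on [-1, 1). Nonnegativity of \<open>Q\<close> makes them nonpositive, which removes the
  truncation.\<close>

lemma volterra_family:
  fixes Q :: "real \<Rightarrow> real"
  assumes Q: "continuous_on {-1..<1} Q" "Q (-1) = 0" and pos: "\<And>s. s \<in> {-1..<1} \<Longrightarrow> Q s \<ge> 0"
  shows "\<exists>w. (\<forall>l\<ge>0. continuous_on {-1..<1} (w l) \<and>
      (\<forall>z\<in>{-1..<1}. w l z \<le> 0 \<and> w l z = - volterra (\<lambda>s. l * Q s * exp (w l s)) z)) \<and>
    (\<forall>b\<in>{-1..<1}. \<forall>L>0. \<exists>C. \<forall>l\<in>{0..L}. \<forall>l'\<in>{0..L}. \<forall>z\<in>{-1..b}. \<bar>w l z - w l' z\<bar> \<le> C * \<bar>l - l'\<bar>)"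
proof -
  have Qb: "continuous_on {-1..b} Q" if "b < 1" for b
    by (rule continuous_on_subset[OF Q(1)]) (use that in auto)
  define P where "P = (\<lambda>l b w. continuous_on {-1..b} w \<and>
    (\<forall>z\<in>{-1..b}. w z = - volterra (\<lambda>s. l * Q s * exp (min (w s) 0)) z))"
  have ex: "\<exists>w. P l b w" if "b \<in> {-1..<1}" for l b
  proof -
    have "continuous_on {-1..b} (\<lambda>s. l * Q s)" using Qb[of b] that by (auto intro!: continuous_intros)
    then show ?thesis
      unfolding P_def by (rule volterra_solution_exists) (use that Q(2) in auto)
  qed
  define v where "v = (\<lambda>l b. SOME w. P l b w)"
  have v: "P l b (v l b)" if "b \<in> {-1..<1}" for l b
    unfolding v_def using ex[OF that] by (rule someI_ex)
  have volterra_lip: "\<exists>C. \<forall>l l' w v z. l \<in> {0..L} \<longrightarrow> l' \<in> {0..L} \<longrightarrow> P l b w \<longrightarrow> P l' b v \<longrightarrow> z \<in> {-1..b} \<longrightarrow>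
      \<bar>w z - v z\<bar> \<le> C * \<bar>l - l'\<bar>" if "-1 \<le> b" "b < 1" "L > 0" for b L
    using volterra_solution_lipschitz[OF Qb[OF that(2)] Q(2) that] unfolding P_def by blast
  have Psub: "P l b w" if "P l b' w" "b \<le> b'" for l b b' w
    using that unfolding P_def by (auto intro: continuous_on_subset)
  have uniq: "w z = u z" if "P l b w" "P l b u" "z \<in> {-1..b}" "b < 1" "l \<ge> 0" for l b w u z
  proof -
    have "-1 \<le> b" "0 < l + 1" using that by auto
    from volterra_lip[OF this(1) \<open>b < 1\<close> this(2)] obtain C where
      C: "\<forall>k k' w v z. k \<in> {0..l + 1} \<longrightarrow> k' \<in> {0..l + 1} \<longrightarrow> P k b w \<longrightarrow> P k' b v \<longrightarrow> z \<in> {-1..b} \<longrightarrow>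
        \<bar>w z - v z\<bar> \<le> C * \<bar>k - k'\<bar>" ..
    have "l \<in> {0..l + 1}" using that by simp
    with C that(1-3) have "\<bar>w z - u z\<bar> \<le> C * \<bar>l - l\<bar>" by blast
    then show ?thesis by simp
  qed
  \<comment> \<open>The midpoint of z and 1 lies strictly between them, so z belongs to the domain
    of the selected solution.\<close>
  define w where "w = (\<lambda>l z. v l ((1 + z) / 2) z)"
  have wv: "w l z = v l b z" if "z \<in> {-1..b}" "b < 1" "l \<ge> 0" for l z b
  proof -
    have *: "(1 + z) / 2 \<in> {-1..<1}" "b \<in> {-1..<1}" using that by auto
    define c where "c = min b ((1 + z) / 2)"
    have "P l c (v l b)" "P l c (v l ((1 + z) / 2))"
      using Psub[OF v[OF *(2)], of c l] Psub[OF v[OF *(1)], of c l] by (simp_all add: c_def del: le_divide_eq_numeral1 min_le_iff_disj)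
    moreover have "z \<in> {-1..c}" "c < 1" using that by (auto simp: c_def)
    ultimately show ?thesis unfolding w_def using uniq that(3) by blast
  qed
  have Pw: "P l b (w l)" if "b \<in> {-1..<1}" "l \<ge> 0" for l b
  proof -
    have eq: "w l z = v l b z" if "z \<in> {-1..b}" for z using wv[of z b l] that \<open>b \<in> {-1..<1}\<close> \<open>l \<ge> 0\<close> by auto
    have "continuous_on {-1..b} (w l)"
      by (rule continuous_on_eq[where f="v l b"]) (use v[OF that(1), of l] eq in \<open>auto simp: P_def\<close>)
    moreover have "w l z = - volterra (\<lambda>s. l * Q s * exp (min (w l s) 0)) z" if z: "z \<in> {-1..b}" for z
    proof -
      have "volterra (\<lambda>s. l * Q s * exp (min (w l s) 0)) z = volterra (\<lambda>s. l * Q s * exp (min (v l b s) 0)) z"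
        by (rule volterra_cong) (use eq z in auto)
      then show ?thesis using v[OF \<open>b \<in> {-1..<1}\<close>, of l] eq[OF z] z unfolding P_def by auto
    qed
    ultimately show ?thesis unfolding P_def by blast
  qed
  have neg: "w l z \<le> 0" if "z \<in> {-1..<1}" "l \<ge> 0" for l z
  proof -
    have "continuous_on {-1..z} (w l)" "w l z = - volterra (\<lambda>s. l * Q s * exp (min (w l s) 0)) z"
      using Pw[OF that] that unfolding P_def by auto
    moreover have "volterra (\<lambda>s. l * Q s * exp (min (w l s) 0)) z \<ge> 0"
      by (rule volterra_nonneg[where b=z])
        (use Qb[of z] Q(2) that pos calculation(1) in \<open>auto intro!: continuous_intros\<close>)
    ultimately show ?thesis by simp
  qed
  have eqw: "w l z = - volterra (\<lambda>s. l * Q s * exp (w l s)) z" if "z \<in> {-1..<1}" "l \<ge> 0" for l z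
  proof -
    have "volterra (\<lambda>s. l * Q s * exp (min (w l s) 0)) z = volterra (\<lambda>s. l * Q s * exp (w l s)) z"
      by (rule volterra_cong) (use neg that in \<open>auto simp: min_def\<close>)
    then show ?thesis using Pw[OF that] that unfolding P_def by auto
  qed
  have cont: "continuous_on {-1..<1} (w l)" if l: "l \<ge> 0" for l
  proof (unfold continuous_on_eq_continuous_within, intro ballI)
    fix z :: real assume z: "z \<in> {-1..<1}"
    let ?b = "(1 + z) / 2"
    have "continuous_on {-1..?b} (w l)" using Pw[of ?b l] z l unfolding P_def by auto
    then have "continuous (at z within {-1..?b}) (w l)"
      using z by (auto simp: continuous_on_eq_continuous_within)
    moreover have "at z within {-1..?b} = at z within {-1..<1}"
      by (rule at_within_nhd[where S="{z - 1 <..< ?b}"]) (use z in auto)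
    ultimately show "continuous (at z within {-1..<1}) (w l)" by simp
  qed
  have "\<exists>C. \<forall>l\<in>{0..L}. \<forall>l'\<in>{0..L}. \<forall>z\<in>{-1..b}. \<bar>w l z - w l' z\<bar> \<le> C * \<bar>l - l'\<bar>"
    if "b \<in> {-1..<1}" "L > 0" for b L
  proof -
    have "-1 \<le> b" "b < 1" using that by auto
    from volterra_lip[OF this that(2)] obtain C where
      C: "\<forall>k k' w v z. k \<in> {0..L} \<longrightarrow> k' \<in> {0..L} \<longrightarrow> P k b w \<longrightarrow> P k' b v \<longrightarrow> z \<in> {-1..b} \<longrightarrow>
        \<bar>w z - v z\<bar> \<le> C * \<bar>k - k'\<bar>" ..
    have "P l b (w l)" if "l \<in> {0..L}" for l using Pw[OF \<open>b \<in> {-1..<1}\<close>, of l] that by simp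
    with C show ?thesis by blast
  qed
  with cont neg eqw show ?thesis by blast
qed

section \<open>Shooting\<close>

text \<open>\<open>k\<close> is the profile of K in the height coordinate and \<open>kd\<close>
  stands for (1 - z^2) k', the derivative of K along the gradient of the height. It is this product
  that the smoothness of K on the sphere controls directly up to the poles, where the gradient of
  the height vanishes.\<close>

locale shooting =
  fixes k kd :: "real \<Rightarrow> real" and \<alpha>1 \<alpha>2 a :: real
  assumes k_cont: "continuous_on {-1..1} k" and kd_cont: "continuous_on {-1..1} kd"
    and k_pos: "\<And>z. z \<in> {-1..1} \<Longrightarrow> k z > 0"
    and k_deriv: "\<And>z. z \<in> {-1<..<1} \<Longrightarrow> (k has_real_derivative kd z / (1 - z\<^sup>2)) (at z)"
    and kd_ends: "kd (-1) = 0" "kd 1 = 0"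
    and \<alpha>: "\<alpha>1 > 0" "\<alpha>1 \<le> \<alpha>2" and a: "a > 0" "a < 2 * (1 + \<alpha>1)"
begin

section \<open>Coefficients of the shooting problem\<close>

definition N :: "real \<Rightarrow> real" where
  "N z = k z * (1 - z) powr \<alpha>1 * (1 + z) powr \<alpha>2"

text \<open>The shooting solution is \<open>U z = ln l - a * ln ((1 - z) / 2) + w l z\<close> with \<open>w l \<le> 0\<close>, so that
  \<open>N z * exp (U z) = l * Q z * exp (w l z)\<close>.\<close>

definition Q :: "real \<Rightarrow> real" where
  "Q z = N z * (2 / (1 - z)) powr a"

text \<open>\<open>B z + 2 * z\<close> is \<open>1 - z\<^sup>2\<close> times the logarithmic derivative of \<open>Q\<close>.\<close>

definition B :: "real \<Rightarrow> real" where
  "B z = a * (1 + z) + \<alpha>2 * (1 - z) - \<alpha>1 * (1 + z) - 2 * z + kd z / k z"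

lemma N_cont: "continuous_on {-1..1} N"
  unfolding N_def using k_cont \<alpha> by (auto intro!: continuous_intros continuous_on_powr')

lemma N_pos: "z \<in> {-1<..<1} \<Longrightarrow> N z > 0"
  using k_pos[of z] by (simp add: N_def)

lemma N_ends: "N (-1) = 0" "N 1 = 0"
  using \<alpha> by (simp_all add: N_def)

lemma Q_cont: "continuous_on {-1..<1} Q"
  unfolding Q_def
  by (auto intro!: continuous_intros continuous_on_powr' continuous_on_subset[OF N_cont] simp: less_imp_le)

lemma Q_pos: "z \<in> {-1<..<1} \<Longrightarrow> Q z > 0"
  using N_pos by (simp add: Q_def)

lemma Q_ends: "Q (-1) = 0"
  by (simp add: Q_def N_ends)

lemma Q_nonneg: "z \<in> {-1..<1} \<Longrightarrow> Q z \<ge> 0"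
  using Q_pos[of z] Q_ends by (cases "z = -1") (auto simp: less_imp_le)

lemma B_cont: "continuous_on {-1..1} B"
  unfolding B_def using k_pos by (auto intro!: continuous_intros k_cont kd_cont simp: less_imp_neq[symmetric])

lemma B_ends: "B (-1) = 2 * (1 + \<alpha>2)" "B 1 = 2 * a - 2 * (1 + \<alpha>1)"
  by (simp_all add: B_def kd_ends algebra_simps)

lemma Q_deriv:
  assumes z: "z \<in> {-1<..<1}"
  shows "(Q has_real_derivative Q z * (B z + 2 * z) / (1 - z\<^sup>2)) (at z)"
proof -
  have pos: "1 - z > 0" "1 + z > 0" "k z > 0" using z k_pos[of z] by auto
  define L where "L = (\<lambda>z. ln (k z) + \<alpha>1 * ln (1 - z) + \<alpha>2 * ln (1 + z) + a * (ln 2 - ln (1 - z)))"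
  have QL: "Q x = exp (L x)" if "x \<in> {-1<..<1}" for x
    using that k_pos[of x]
    by (simp add: Q_def N_def L_def exp_add powr_def ln_div mult_ac)
  have "(L has_real_derivative
      (kd z / (1 - z\<^sup>2)) / k z - \<alpha>1 / (1 - z) + \<alpha>2 / (1 + z) + a / (1 - z)) (at z)"
    unfolding L_def using pos k_deriv[OF z] by (auto intro!: derivative_eq_intros)
  moreover have "(kd z / (1 - z\<^sup>2)) / k z - \<alpha>1 / (1 - z) + \<alpha>2 / (1 + z) + a / (1 - z) =
      (B z + 2 * z) / (1 - z\<^sup>2)"
  proof -
    have "A / (x * y) / c - \<alpha>1 / x + \<alpha>2 / y + a / x = (a * y + \<alpha>2 * x - \<alpha>1 * y + A / c) / (x * y)"
      if "x > 0" "y > 0" "c > 0" for x y c A :: real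
      using that by (simp add: add_divide_distrib diff_divide_distrib)
    from this[OF pos] show ?thesis unfolding B_def one_minus_square_factor by simp
  qed
  ultimately have "(L has_real_derivative (B z + 2 * z) / (1 - z\<^sup>2)) (at z)" by simp
  from DERIV_fun_exp[OF this]
  have "((\<lambda>x. exp (L x)) has_real_derivative Q z * (B z + 2 * z) / (1 - z\<^sup>2)) (at z)"
    using QL[OF z] by simp
  then show ?thesis
    by (rule has_field_derivative_transform_within_open[where S="{-1<..<1}"])
      (use z QL in auto)
qed

section \<open>The shooting family and its mass function\<close>

definition w :: "real \<Rightarrow> real \<Rightarrow> real" where
  "w = (SOME w. (\<forall>l\<ge>0. continuous_on {-1..<1} (w l) \<and>
      (\<forall>z\<in>{-1..<1}. w l z \<le> 0 \<and> w l z = - volterra (\<lambda>s. l * Q s * exp (w l s)) z)) \<and>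
    (\<forall>b\<in>{-1..<1}. \<forall>L>0. \<exists>C. \<forall>l\<in>{0..L}. \<forall>l'\<in>{0..L}. \<forall>z\<in>{-1..b}. \<bar>w l z - w l' z\<bar> \<le> C * \<bar>l - l'\<bar>))"

lemma
  shows w_cont: "l \<ge> 0 \<Longrightarrow> continuous_on {-1..<1} (w l)"
    and w_neg: "l \<ge> 0 \<Longrightarrow> z \<in> {-1..<1} \<Longrightarrow> w l z \<le> 0"
    and w_eq: "l \<ge> 0 \<Longrightarrow> z \<in> {-1..<1} \<Longrightarrow> w l z = - volterra (\<lambda>s. l * Q s * exp (w l s)) z"
    and w_lip: "b \<in> {-1..<1} \<Longrightarrow> L > 0 \<Longrightarrow>
      \<exists>C. \<forall>l\<in>{0..L}. \<forall>l'\<in>{0..L}. \<forall>z\<in>{-1..b}. \<bar>w l z - w l' z\<bar> \<le> C * \<bar>l - l'\<bar>"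
  using someI_ex[OF volterra_family[OF Q_cont Q_ends Q_nonneg]] unfolding w_def[symmetric] by blast+

definition m' :: "real \<Rightarrow> real \<Rightarrow> real" where
  "m' l z = l * Q z * exp (w l z)"

definition m :: "real \<Rightarrow> real \<Rightarrow> real" where
  "m l z = integral {-1..z} (m' l)"

lemma m'_cont: "l \<ge> 0 \<Longrightarrow> continuous_on {-1..<1} (m' l)"
  unfolding m'_def by (intro continuous_intros Q_cont w_cont)

lemma m'_cont_Icc: "l \<ge> 0 \<Longrightarrow> b < 1 \<Longrightarrow> continuous_on {-1..b} (m' l)"
  by (rule continuous_on_subset[OF m'_cont]) auto

lemma m'_pos: "l > 0 \<Longrightarrow> z \<in> {-1<..<1} \<Longrightarrow> m' l z > 0"
  using Q_pos by (simp add: m'_def)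

lemma m'_nonneg: "l \<ge> 0 \<Longrightarrow> z \<in> {-1..<1} \<Longrightarrow> m' l z \<ge> 0"
  using Q_nonneg by (simp add: m'_def)

lemma m'_ends: "m' l (-1) = 0"
  by (simp add: m'_def Q_ends)

lemma m_deriv:
  assumes "l \<ge> 0" "z \<in> {-1<..<1}"
  shows "(m l has_real_derivative m' l z) (at z)"
proof -
  have "(m l has_real_derivative m' l z) (at z within {-1..(1 + z) / 2})"
    unfolding m_def using assms by (intro integral_has_real_derivative m'_cont_Icc) auto
  moreover have "at z within {-1..(1 + z) / 2} = at z"
    by (rule at_within_Icc_interior) (use assms in auto)
  ultimately show ?thesis by simp
qed

lemma w_deriv:
  assumes "l \<ge> 0" "z \<in> {-1<..<1}"
  shows "(w l has_real_derivative - m l z / (1 - z\<^sup>2)) (at z)"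
proof -
  have "(volterra (m' l) has_real_derivative m l z / (1 - z\<^sup>2)) (at z within {-1..(1 + z) / 2})"
    unfolding m_def by (rule volterra_derivative) (use assms m'_ends m'_cont_Icc in auto)
  moreover have "at z within {-1..(1 + z) / 2} = at z"
    by (rule at_within_Icc_interior) (use assms in auto)
  ultimately have "(volterra (m' l) has_real_derivative m l z / (1 - z\<^sup>2)) (at z)" by simp
  from DERIV_minus[OF this]
  have "((\<lambda>z. - volterra (m' l) z) has_real_derivative - m l z / (1 - z\<^sup>2)) (at z)" by simp
  then show ?thesis
    by (rule has_field_derivative_transform_within_open[where S="{-1<..<1}"])
      (use assms w_eq in \<open>auto simp: m'_def[abs_def]\<close>)
qed

lemma m_cont_Icc:
  assumes "l \<ge> 0" "b < 1"
  shows "continuous_on {-1..b} (m l)"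
  unfolding m_def
  by (intro indefinite_integral_continuous_1 integrable_continuous_real m'_cont_Icc assms)

lemma m_start: "m l (-1) = 0" by (simp add: m_def)

lemma w_start: "l \<ge> 0 \<Longrightarrow> w l (-1) = 0"
  using w_eq[of l "-1"] by (simp add: volterra_def)

lemma m_less:
  assumes "l > 0" "-1 \<le> x" "x < y" "y < 1"
  shows "m l x < m l y"
proof (rule DERIV_pos_imp_increasing_open[OF \<open>x < y\<close>])
  show "\<exists>d. (m l has_real_derivative d) (at z) \<and> d > 0" if "x < z" "z < y" for z
    using m_deriv[of l z] m'_pos[of l z] assms that by auto
  show "continuous_on {x..y} (m l)"
    by (rule continuous_on_subset[OF m_cont_Icc[of l y]]) (use assms in auto)
qed

lemma m_nonneg: "l > 0 \<Longrightarrow> z \<in> {-1..<1} \<Longrightarrow> m l z \<ge> 0"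
  using m_less[of l "-1" z] m_start[of l] by (cases "z = -1") auto

section \<open>Pohozaev-type quantities\<close>

definition E :: "real \<Rightarrow> real \<Rightarrow> real" where
  "E l z = (1 - z\<^sup>2) * m' l z"

lemma E_nonneg: "l \<ge> 0 \<Longrightarrow> z \<in> {-1..<1} \<Longrightarrow> E l z \<ge> 0"
  unfolding E_def using m'_nonneg[of l z] abs_square_le_1[of z] by auto

lemma E_start: "E l (-1) = 0" by (simp add: E_def)

lemma m'_deriv:
  assumes "l \<ge> 0" and z: "z \<in> {-1<..<1}"
  shows "(m' l has_real_derivative m' l z * (B z + 2 * z - m l z) / (1 - z\<^sup>2)) (at z)"
proof -
  have "((\<lambda>z. l * Q z * exp (w l z)) has_real_derivative
      l * (Q z * (B z + 2 * z) / (1 - z\<^sup>2)) * exp (w l z) + exp (w l z) * (- m l z / (1 - z\<^sup>2)) * (l * Q z)) (at z)"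
    by (rule DERIV_mult DERIV_cmult Q_deriv[OF z] DERIV_fun_exp w_deriv[OF assms])+
  moreover have "l * (Q z * (B z + 2 * z) / (1 - z\<^sup>2)) * exp (w l z) + exp (w l z) * (- m l z / (1 - z\<^sup>2)) * (l * Q z)
      = m' l z * (B z + 2 * z - m l z) / (1 - z\<^sup>2)"
  proof -
    have "l * (q * X / D) * e + e * (- M / D) * (l * q) = l * q * e * (X - M) / D"
      if "D > 0" for q X D e M :: real
      using that by (simp add: field_simps)
    from this[OF one_minus_square_pos[OF z]] show ?thesis by (simp add: m'_def)
  qed
  ultimately show ?thesis unfolding m'_def[abs_def] by simp
qed

text \<open>The factor 1 - z^2 in \<open>E\<close> removes both the singular denominator and the
  term 2 z of \<open>m'_deriv\<close>.\<close>

lemma E_deriv: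
  assumes "l \<ge> 0" and z: "z \<in> {-1<..<1}"
  shows "(E l has_real_derivative m' l z * (B z - m l z)) (at z)"
proof -
  have "((\<lambda>z. (1 - z\<^sup>2) * m' l z) has_real_derivative
      (- 2 * z) * m' l z + (m' l z * (B z + 2 * z - m l z) / (1 - z\<^sup>2)) * (1 - z\<^sup>2)) (at z)"
    by (rule DERIV_mult[OF _ m'_deriv[OF assms]]) (auto intro!: derivative_eq_intros)
  moreover have "(- 2 * z) * m' l z + (m' l z * (B z + 2 * z - m l z) / (1 - z\<^sup>2)) * (1 - z\<^sup>2)
     = m' l z * (B z - m l z)"
  proof -
    have "- 2 * z * x + (x * (b + 2 * z - y) / D) * D = x * (b - y)" if "D > 0" for x b y D :: real
    proof -
      have "(x * (b + 2 * z - y) / D) * D = x * (b + 2 * z - y)" using that by simp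
      then show ?thesis by (simp only:) (simp add: algebra_simps)
    qed
    from this[OF one_minus_square_pos[OF z]] show ?thesis .
  qed
  ultimately show ?thesis unfolding E_def[abs_def] by simp
qed

text \<open>A Pohozaev-type quantity: it is monotone wherever \<open>B\<close> lies on one side of \<open>c\<close>.\<close>

definition \<Psi> :: "real \<Rightarrow> real \<Rightarrow> real \<Rightarrow> real" where
  "\<Psi> c l z = E l z - c * m l z + (m l z)\<^sup>2 / 2"

lemma \<Psi>_deriv:
  assumes "l \<ge> 0" and z: "z \<in> {-1<..<1}"
  shows "(\<Psi> c l has_real_derivative m' l z * (B z - c)) (at z)"
proof -
  have "((\<lambda>z. E l z - c * m l z + (1 / 2) * (m l z)\<^sup>2) has_real_derivative
      m' l z * (B z - m l z) - c * m' l z + (1 / 2) * (2 * m l z * m' l z)) (at z)"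
    using E_deriv[OF assms] m_deriv[OF assms]
    by (intro DERIV_add DERIV_diff DERIV_cmult) (auto intro!: derivative_eq_intros)
  then show ?thesis by (simp add: \<Psi>_def[abs_def] algebra_simps)
qed

lemma \<Psi>_cont_Icc:
  assumes "l \<ge> 0" "b < 1"
  shows "continuous_on {-1..b} (\<Psi> c l)"
  unfolding \<Psi>_def E_def by (intro continuous_intros m_cont_Icc m'_cont_Icc assms) auto

section \<open>Dependence on the shooting parameter\<close>

text \<open>The difference of the densities splits into the change of the factor l and the change of
  \<open>w\<close>. The latter is controlled by \<open>w_lip\<close> uniformly on [-1, z], so
  \<open>m\<close> inherits a Lipschitz estimate.\<close>

lemma continuous_in_l:
  assumes z: "z \<in> {-1..<1}"
  shows "continuous_on {0<..} (\<lambda>l. w l z)" "continuous_on {0<..} (\<lambda>l. m l z)"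
proof -
  obtain D where D: "\<And>x. x \<in> {-1..z} \<Longrightarrow> \<bar>Q x\<bar> \<le> D" "D > 0"
    using continuous_on_Icc_bounded[OF continuous_on_subset[OF Q_cont]] z
    by (metis atLeastLessThan_iff atLeastAtMost_iff order.strict_trans1 subsetI)
  have main: "isCont (\<lambda>l. w l z) l0 \<and> isCont (\<lambda>l. m l z) l0" if l0: "l0 > 0" for l0
  proof -
    define L where "L = l0 + 1"
    have "L > 0" using l0 by (simp add: L_def)
    from w_lip[OF z this] obtain C where
      C: "\<And>l l' x. l \<in> {0..L} \<Longrightarrow> l' \<in> {0..L} \<Longrightarrow> x \<in> {-1..z} \<Longrightarrow> \<bar>w l x - w l' x\<bar> \<le> C * \<bar>l - l'\<bar>"
      by blast
    define C' where "C' = D * (1 + L * C) * (z + 1)"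
    have mb: "\<bar>m l z - m l0 z\<bar> \<le> C' * \<bar>l - l0\<bar>" if l: "l \<in> {0..L}" for l
    proof -
      have l0': "l0 \<in> {0..L}" using l0 by (simp add: L_def)
      have "m l z - m l0 z = integral {-1..z} (\<lambda>x. m' l x - m' l0 x)"
        unfolding m_def using l l0 z
        by (intro integral_diff[symmetric] integrable_continuous_real m'_cont_Icc) auto
      also have "\<bar>\<dots>\<bar> \<le> integral {-1..z} (\<lambda>x. D * (1 + L * C) * \<bar>l - l0\<bar>)"
      proof (rule abs_integral_le)
        show "continuous_on {-1..z} (\<lambda>x. m' l x - m' l0 x)"
          using l l0 z by (intro continuous_intros m'_cont_Icc) auto
        fix x assume x: "x \<in> {-1..z}"
        have wn: "w l x \<le> 0" "w l0 x \<le> 0" using w_neg l l0 x z by auto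
        have d: "\<bar>exp (w l x) - exp (w l0 x)\<bar> \<le> C * \<bar>l - l0\<bar>"
          using abs_exp_min_diff_le[of "w l x" "w l0 x"] C[OF l l0' x] wn by (simp add: min_def)
        have "m' l x - m' l0 x = (l - l0) * Q x * exp (w l0 x) + l * Q x * (exp (w l x) - exp (w l0 x))"
          by (simp add: m'_def algebra_simps)
        also have "\<bar>\<dots>\<bar> \<le> \<bar>(l - l0) * Q x * exp (w l0 x)\<bar> + \<bar>l * Q x * (exp (w l x) - exp (w l0 x))\<bar>"
          by (rule abs_triangle_ineq)
        also have "\<bar>(l - l0) * Q x * exp (w l0 x)\<bar> \<le> \<bar>l - l0\<bar> * D * 1"
          unfolding abs_mult using D(1)[OF x] D(2) wn by (intro mult_mono) auto
        also have "\<bar>l * Q x * (exp (w l x) - exp (w l0 x))\<bar> \<le> L * D * (C * \<bar>l - l0\<bar>)"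
          unfolding abs_mult using D(1)[OF x] D(2) d l \<open>L > 0\<close> by (intro mult_mono) auto
        finally show "\<bar>m' l x - m' l0 x\<bar> \<le> D * (1 + L * C) * \<bar>l - l0\<bar>"
          by (simp add: algebra_simps)
      qed auto
      also have "\<dots> = C' * \<bar>l - l0\<bar>" using z by (simp add: C'_def)
      finally show ?thesis .
    qed
    have lim: "isCont f l0" if f: "\<And>l. l \<in> {0..L} \<Longrightarrow> \<bar>f l - f l0\<bar> \<le> K * \<bar>l - l0\<bar>" for f K
    proof -
      have "((\<lambda>l. f l - f l0) \<longlongrightarrow> 0) (at l0)"
      proof (rule Lim_null_comparison)
        have "eventually (\<lambda>l. l \<in> {0<..<L}) (at l0)"
          by (rule eventually_at_in_open') (use l0 in \<open>auto simp: L_def\<close>)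
        then show "eventually (\<lambda>l. norm (f l - f l0) \<le> K * \<bar>l - l0\<bar>) (at l0)"
          by eventually_elim (use f in auto)
        have "((\<lambda>l. K * \<bar>l - l0\<bar>) \<longlongrightarrow> K * \<bar>l0 - l0\<bar>) (at l0)" by (intro tendsto_intros)
        then show "((\<lambda>l. K * \<bar>l - l0\<bar>) \<longlongrightarrow> 0) (at l0)" by simp
      qed
      then show ?thesis by (simp add: isCont_def LIM_zero_iff)
    qed
    have "l0 \<in> {0..L}" "z \<in> {-1..z}" using l0 z by (auto simp: L_def)
    then show ?thesis using lim[OF mb] lim[of "\<lambda>l. w l z" C] C by blast
  qed
  show "continuous_on {0<..} (\<lambda>l. w l z)" "continuous_on {0<..} (\<lambda>l. m l z)"
    using main by (auto intro!: continuous_at_imp_continuous_on)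
qed

lemma \<Psi>_continuous_in_l: "z \<in> {-1..<1} \<Longrightarrow> continuous_on {0<..} (\<lambda>l. \<Psi> c l z)"
  unfolding \<Psi>_def E_def m'_def by (intro continuous_intros continuous_in_l) auto


section \<open>Overshooting, undershooting and the critical parameter\<close>

text \<open>If the mass were at most 2 a for all l, monotonicity of \<open>\<Psi>\<close> near -1
  would give (1 + z) m' \<ge> \<delta> m, hence m \<le> const (1 + z)^\<delta> and a lower bound for
  \<open>w\<close> near -1, all with constants independent of l. Then \<open>m l zl\<close> would be
  at least a positive constant times l, which is unbounded.\<close>

lemma mass_exceeds: "\<exists>l>0. \<exists>z\<in>{-1<..<1}. m l z > 2 * a"
proof (rule ccontr)
  assume "\<not> ?thesis"
  then have le: "m l z \<le> 2 * a" if "l > 0" "z \<in> {-1<..<1}" for l z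
    using that by (meson not_less)
  \<comment> \<open>A level strictly between a and B(-1); near -1 the function \<open>B\<close>
    stays above it.\<close>
  define b1 where "b1 = (B (-1) + a) / 2"
  have b1: "b1 > a" "b1 < B (-1)" using a \<alpha> by (auto simp: b1_def B_ends)
  have "(B \<longlongrightarrow> B (-1)) (at (-1) within {-1..1})"
    using B_cont by (auto simp: continuous_on_def)
  then have "(B \<longlongrightarrow> B (-1)) (at_right (-1))" by (simp add: at_within_Icc_at_right)
  then have "eventually (\<lambda>z. B z > b1) (at_right (-1))" using b1 by (simp add: order_tendsto_iff)
  then obtain z1 where z1: "z1 > -1" "\<And>z. -1 < z \<Longrightarrow> z < z1 \<Longrightarrow> B z > b1"
    using eventually_at_right[of "-1" 1 "\<lambda>z. B z > b1"] by auto
  define zl where "zl = min z1 0"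
  have zl: "-1 < zl" "zl < 1" "\<And>z. -1 < z \<Longrightarrow> z < zl \<Longrightarrow> B z \<ge> b1"
    using z1 by (auto simp: zl_def less_imp_le)
  \<comment> \<open>The gap b1 - a bounds b1 - m / 2 from below because m \<le> 2 a; the other half
    of it is lost in the estimate 1 - z \<le> 2.\<close>
  define \<delta> where "\<delta> = (b1 - a) / 2"
  have \<delta>: "\<delta> > 0" using b1 by (simp add: \<delta>_def)
  \<comment> \<open>Chosen so that the derivative of K (1 + z)^\<delta> dominates m / (1 - z^2), the
    rate at which \<open>w\<close> decreases.\<close>
  define K where "K = 2 * a * (1 + zl) powr (- \<delta>) / (\<delta> * (1 - zl))"
  have K0: "K > 0" using a zl \<delta> by (simp add: K_def)
  define J where "J = integral {-1..zl} Q"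
  have Qc: "continuous_on {-1..zl} Q" by (rule continuous_on_subset[OF Q_cont]) (use zl in auto)
  have main: "m l zl \<ge> l * exp (- K * (1 + zl) powr \<delta>) * J" if l: "l > 0" for l
  proof -
    have E_ge: "E l z \<ge> 2 * \<delta> * m l z" if z: "-1 \<le> z" "z \<le> zl" for z
    proof -
      \<comment> \<open>\<open>\<Psi> b1 l\<close> starts at 0 and does not decrease while B \<ge>
        b1.\<close>
      have "\<Psi> b1 l (-1) \<le> \<Psi> b1 l z"
      proof (rule nondecreasing_if_deriv_nonneg[OF z(1)])
        show "continuous_on {-1..z} (\<Psi> b1 l)" using l z zl by (intro \<Psi>_cont_Icc) auto
        fix x assume x: "-1 < x" "x < z"
        have "m' l x * (B x - b1) \<ge> 0" using m'_pos[OF l, of x] zl x z by (auto intro!: mult_nonneg_nonneg)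
        then show "\<exists>d. (\<Psi> b1 l has_real_derivative d) (at x) \<and> d \<ge> 0"
          using \<Psi>_deriv[of l x b1] l x z zl by auto
      qed
      then have "E l z \<ge> m l z * (b1 - m l z / 2)"
        by (simp add: E_start m_start \<Psi>_def power2_eq_square algebra_simps)
      moreover have "m l z * (b1 - m l z / 2) \<ge> m l z * (2 * \<delta>)"
      proof (rule mult_left_mono)
        have "m l z \<le> 2 * a" using le[OF l, of z] m_start[of l] z zl a by (cases "z = -1") auto
        then show "2 * \<delta> \<le> b1 - m l z / 2" by (simp add: \<delta>_def)
        show "0 \<le> m l z" using m_nonneg[OF l, of z] z zl by auto
      qed
      ultimately show ?thesis by (simp add: mult_ac)
    qed
    have m'_ge: "(1 + z) * m' l z \<ge> \<delta> * m l z" if z: "-1 < z" "z \<le> zl" for z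
    proof -
      have "2 * \<delta> * m l z \<le> (1 - z) * ((1 + z) * m' l z)"
        using E_ge[of z] z unfolding E_def one_minus_square_factor by (simp add: mult.assoc)
      also have "\<dots> \<le> 2 * ((1 + z) * m' l z)"
        using m'_pos[OF l, of z] z zl by (intro mult_right_mono) auto
      finally show ?thesis by simp
    qed
    have m_le: "m l z \<le> 2 * a * (1 + zl) powr (- \<delta>) * (1 + z) powr \<delta>" if z: "-1 < z" "z \<le> zl" for z
    proof -
      have "m l z * (1 + z) powr (- \<delta>) \<le> m l zl * (1 + zl) powr (- \<delta>)"
      proof (rule nondecreasing_if_deriv_nonneg[OF z(2)])
        show "continuous_on {z..zl} (\<lambda>z. m l z * (1 + z) powr - \<delta>)"
          using z zl l by (intro continuous_intros continuous_on_subset[OF m_cont_Icc[of l zl]]) auto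
        fix x assume x: "z < x" "x < zl"
        have "((\<lambda>z. m l z * (1 + z) powr - \<delta>) has_real_derivative
            m' l x * (1 + x) powr - \<delta> + (- \<delta> * (1 + x) powr (- \<delta> - 1)) * m l x) (at x)"
          using x z zl l by (intro DERIV_mult m_deriv) (auto intro!: derivative_eq_intros simp: powr_diff)
        moreover have "m' l x * (1 + x) powr - \<delta> + (- \<delta> * (1 + x) powr (- \<delta> - 1)) * m l x
           = ((1 + x) * m' l x - \<delta> * m l x) * (1 + x) powr (- \<delta> - 1)"
          using x z by (simp add: powr_diff field_simps)
        moreover have "\<dots> \<ge> 0" using m'_ge[of x] x z by auto
        ultimately show "\<exists>d. ((\<lambda>z. m l z * (1 + z) powr - \<delta>) has_real_derivative d) (at x) \<and> d \<ge> 0"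
          by metis
      qed
      also have "\<dots> \<le> 2 * a * (1 + zl) powr (- \<delta>)" using le[OF l, of zl] zl by (intro mult_right_mono) auto
      finally have "m l z * (1 + z) powr (- \<delta>) * (1 + z) powr \<delta> \<le> 2 * a * (1 + zl) powr (- \<delta>) * (1 + z) powr \<delta>"
        by (rule mult_right_mono) auto
      moreover have "m l z * (1 + z) powr (- \<delta>) * (1 + z) powr \<delta> = m l z"
        by (rule powr_minus_mult_cancel) (use z in simp)
      ultimately show ?thesis by (simp only:)
    qed
    have w_ge: "w l z \<ge> - K * (1 + zl) powr \<delta>" if z: "-1 \<le> z" "z \<le> zl" for z
    proof -
      have "w l (-1) + K * (1 + (-1)) powr \<delta> \<le> w l z + K * (1 + z) powr \<delta>"
      proof (rule nondecreasing_if_deriv_nonneg[OF z(1)])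
        show "continuous_on {-1..z} (\<lambda>z. w l z + K * (1 + z) powr \<delta>)"
          using z zl l \<delta> by (auto intro!: continuous_intros continuous_on_powr' continuous_on_subset[OF w_cont])
        fix x assume x: "-1 < x" "x < z"
        have "((\<lambda>z. w l z + K * (1 + z) powr \<delta>) has_real_derivative
            - m l x / (1 - x\<^sup>2) + K * (\<delta> * (1 + x) powr (\<delta> - 1))) (at x)"
          using x z zl l by (intro DERIV_add DERIV_cmult w_deriv) (auto intro!: derivative_eq_intros simp: powr_diff)
        moreover have "m l x / (1 - x\<^sup>2) \<le> K * (\<delta> * (1 + x) powr (\<delta> - 1))"
        proof -
          have "m l x / (1 - x\<^sup>2) \<le> (2 * a * (1 + zl) powr (- \<delta>) * (1 + x) powr \<delta>) / ((1 - zl) * (1 + x))"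
            unfolding one_minus_square_factor
            using m_le[of x] x z zl m_nonneg[OF l, of x] a by (intro frac_le mult_right_mono) auto
          also have "\<dots> = K * (\<delta> * (1 + x) powr (\<delta> - 1))"
          proof -
            have "A * P / (d * y) = A / (e * d) * (e * (P / y))" if "d > 0" "y > 0" "e > 0" for A P d y e :: real
              using that by (simp add: field_simps)
            from this[of "1 - zl" "1 + x" \<delta>] show ?thesis using x zl \<delta> by (simp add: K_def powr_diff)
          qed
          finally show ?thesis .
        qed
        ultimately show "\<exists>d. ((\<lambda>z. w l z + K * (1 + z) powr \<delta>) has_real_derivative d) (at x) \<and> d \<ge> 0"
          by fastforce
      qed
      then have "0 \<le> w l z + K * (1 + z) powr \<delta>" using w_start l by simp
      moreover have "K * (1 + z) powr \<delta> \<le> K * (1 + zl) powr \<delta>"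
        using K0 z \<delta> by (intro mult_left_mono powr_mono2) auto
      ultimately show ?thesis by simp
    qed
    have "l * exp (- K * (1 + zl) powr \<delta>) * J = integral {-1..zl} (\<lambda>x. l * exp (- K * (1 + zl) powr \<delta>) * Q x)"
      by (simp add: J_def)
    also have "\<dots> \<le> m l zl"
      unfolding m_def
    proof (rule integral_mono_cont)
      show "continuous_on {-1..zl} (m' l)" using l zl by (intro m'_cont_Icc) auto
      fix x assume x: "x \<in> {-1..zl}"
      then have "exp (- K * (1 + zl) powr \<delta>) \<le> exp (w l x)" using w_ge[of x] by simp
      then have "l * Q x * exp (- K * (1 + zl) powr \<delta>) \<le> l * Q x * exp (w l x)"
        using l Q_nonneg[of x] x zl by (intro mult_left_mono) auto
      then show "l * exp (- K * (1 + zl) powr \<delta>) * Q x \<le> m' l x"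
        by (simp add: m'_def mult_ac)
    qed (intro continuous_intros Qc)
    finally show ?thesis .
  qed
  have J: "J > 0"
  proof -
    have "0 < m 1 zl" using m_less[of 1 "-1" zl] zl by (simp add: m_start)
    also have "m 1 zl \<le> J"
      unfolding m_def J_def
    proof (rule integral_mono_cont)
      fix x assume x: "x \<in> {-1..zl}"
      have "Q x * exp (w 1 x) \<le> Q x * 1"
        using w_neg[of 1 x] Q_nonneg[of x] x zl by (intro mult_left_mono) auto
      then show "m' 1 x \<le> Q x" by (simp add: m'_def)
    qed (use Qc zl m'_cont_Icc in auto)
    finally show ?thesis .
  qed
  define P where "P = exp (- K * (1 + zl) powr \<delta>) * J"
  have P: "P > 0" using J by (simp add: P_def)
  have "(2 * a + 1) / P > 0" using P a by simp
  from main[OF this] have "2 * a + 1 \<le> m ((2 * a + 1) / P) zl"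
    using P J by (simp add: P_def mult.assoc)
  moreover have "m ((2 * a + 1) / P) zl \<le> 2 * a" using zl P a by (intro le) auto
  ultimately show False by simp
qed

text \<open>At a fixed z both \<open>E\<close> and \<open>m\<close> are at most a constant times l,
  so \<open>\<Psi>\<close> tends to 0 with l, whereas 2 a (a - c) is positive.\<close>

lemma small_mass:
  assumes "z \<in> {-1..<1}" "c < a"
  shows "\<exists>l>0. m l z < 2 * a \<and> \<Psi> c l z < 2 * a * (a - c)"
proof -
  define J where "J = integral {-1..z} Q"
  have Qc: "continuous_on {-1..z} Q" by (rule continuous_on_subset[OF Q_cont]) (use assms in auto)
  have J: "J \<ge> 0" unfolding J_def
    by (rule integral_nonneg[OF integrable_continuous_real[OF Qc]]) (use assms Q_nonneg in auto)
  have m_le: "m l z \<le> l * J" if "l > 0" for l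
  proof -
    have "m l z \<le> integral {-1..z} (\<lambda>x. l * Q x)"
      unfolding m_def
    proof (rule integral_mono_cont)
      fix x assume x: "x \<in> {-1..z}"
      have "l * Q x * exp (w l x) \<le> l * Q x * 1"
        using w_neg[of l x] Q_nonneg[of x] x assms that by (intro mult_left_mono) auto
      then show "m' l x \<le> l * Q x" by (simp add: m'_def)
    qed (use Qc assms that m'_cont_Icc in \<open>auto intro!: continuous_intros\<close>)
    then show ?thesis by (simp add: J_def)
  qed
  define q where "q = (1 - z\<^sup>2) * Q z"
  have sq: "1 - z\<^sup>2 \<ge> 0" using assms abs_square_le_1[of z] by auto
  have q: "q \<ge> 0" unfolding q_def using Q_nonneg assms sq by simp
  have E_le: "E l z \<le> l * q" if "l > 0" for l
  proof -
    have "l * ((1 - z\<^sup>2) * Q z) * exp (w l z) \<le> l * ((1 - z\<^sup>2) * Q z) * 1"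
      using w_neg[of l z] q that assms by (intro mult_left_mono) (auto simp: q_def)
    then show ?thesis by (simp add: E_def q_def m'_def mult_ac)
  qed
  \<comment> \<open>\<open>T\<close> collects the coefficients of l in the bounds for
    \<open>m\<close> and \<open>\<Psi>\<close>; the quadratic term fits in because l \<le>
    1.\<close>
  define T where "T = q + \<bar>c\<bar> * J + J\<^sup>2 / 2 + J + 1"
  have T: "T > 0" "J \<le> T" using q J by (auto simp: T_def add_nonneg_pos)
  define e where "e = min (2 * a) (2 * a * (a - c))"
  have e: "e > 0" using a assms by (simp add: e_def)
  define l where "l = min 1 (e / (2 * T))"
  have l: "l > 0" "l \<le> 1" using e T by (auto simp: l_def)
  have "l * T \<le> e / (2 * T) * T" using T by (intro mult_right_mono) (auto simp: l_def)
  also have "\<dots> < e" using T e by simp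
  finally have lT: "l * T < e" .
  have m0: "0 \<le> m l z" using m_nonneg[OF l(1)] assms by auto
  have "m l z \<le> l * T" using m_le[OF l(1)] l T by (meson mult_left_mono order_trans less_imp_le)
  then have "m l z < 2 * a" using lT by (simp add: e_def)
  moreover have "\<Psi> c l z < 2 * a * (a - c)"
  proof -
    have "- c * m l z \<le> \<bar>c\<bar> * (l * J)"
    proof -
      have "- c * m l z \<le> \<bar>c\<bar> * m l z" using m0 by (intro mult_right_mono) auto
      also have "\<dots> \<le> \<bar>c\<bar> * (l * J)" using m_le[OF l(1)] by (intro mult_left_mono) auto
      finally show ?thesis .
    qed
    moreover have "(m l z)\<^sup>2 \<le> l * J\<^sup>2"
    proof -
      have "(m l z)\<^sup>2 \<le> (l * J)\<^sup>2" using m_le[OF l(1)] m0 by (intro power_mono) auto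
      also have "\<dots> = l * (l * J\<^sup>2)" by (simp add: power2_eq_square mult_ac)
      also have "\<dots> \<le> l * (1 * J\<^sup>2)" using l by (intro mult_left_mono mult_right_mono) auto
      finally show ?thesis by simp
    qed
    ultimately have "\<Psi> c l z \<le> l * q + \<bar>c\<bar> * (l * J) + l * J\<^sup>2 / 2"
      using E_le[OF l(1)] by (simp add: \<Psi>_def)
    also have "\<dots> \<le> l * T" using l J by (simp add: T_def algebra_simps)
    also have "\<dots> < 2 * a * (a - c)" using lT by (simp add: e_def)
    finally show ?thesis .
  qed
  ultimately show ?thesis using l by blast
qed

text \<open>Since E \<ge> 0, the number 2 a (a - c) is a lower bound for \<open>\<Psi>\<close>
  wherever m = 2 a. To the right of \<open>zr\<close> the function \<open>\<Psi>\<close> does not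
  increase, so once it is below this number with m < 2 a, the mass never reaches 2 a. Hence the
  overshooting parameters \<open>U\<close> and the trapped parameters \<open>V\<close> are disjoint;
  both are open and nonempty, so they cannot cover the connected half-line.\<close>

lemma critical_parameter:
  assumes zr: "zr \<in> {-1<..<1}" and c: "c < a" and B: "\<And>z. zr < z \<Longrightarrow> z < 1 \<Longrightarrow> B z \<le> c"
  shows "\<exists>l>0. (\<forall>z\<in>{-1..<1}. m l z < 2 * a) \<and> (\<forall>z\<in>{zr..<1}. \<Psi> c l z \<ge> 2 * a * (a - c))"
proof -
  define U where "U = (\<Union>z\<in>{-1<..<1}. {0<..} \<inter> (\<lambda>l. m l z) -` {2 * a<..})"
  define V where "V = (\<Union>z\<in>{zr..<1}. ({0<..} \<inter> (\<lambda>l. m l z) -` {..<2 * a}) \<inter>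
    ({0<..} \<inter> (\<lambda>l. \<Psi> c l z) -` {..<2 * a * (a - c)}))"
  have oU: "open U" unfolding U_def
    by (intro open_UN ballI continuous_open_preimage continuous_in_l) auto
  have oV: "open V" unfolding V_def
    by (intro open_UN ballI open_Int continuous_open_preimage continuous_in_l \<Psi>_continuous_in_l) (use zr in auto)
  have "U \<inter> {0<..} \<noteq> {}" using mass_exceeds unfolding U_def by auto
  moreover have "V \<inter> {0<..} \<noteq> {}"
  proof -
    obtain l where "l > 0" "m l zr < 2 * a" "\<Psi> c l zr < 2 * a * (a - c)"
      using small_mass[of zr c] zr c by auto
    then have "l \<in> V \<inter> {0<..}" unfolding V_def using zr by (auto intro!: bexI[of _ zr])
    then show ?thesis by blast
  qed
  moreover have "U \<inter> V \<inter> {0<..} = {}"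
  proof (rule ccontr)
    assume "\<not> ?thesis"
    then obtain l where l: "l > 0" and "l \<in> U" "l \<in> V" by auto
    from \<open>l \<in> U\<close> obtain z1 where z1: "z1 \<in> {-1<..<1}" "m l z1 > 2 * a"
      unfolding U_def by blast
    from \<open>l \<in> V\<close> obtain z0 where
      z0: "z0 \<in> {zr..<1}" "m l z0 < 2 * a" "\<Psi> c l z0 < 2 * a * (a - c)"
      unfolding V_def by blast
    have z01: "z0 \<le> z1"
    proof (rule ccontr)
      assume "\<not> z0 \<le> z1"
      then have "m l z1 < m l z0" using l z0 z1 by (intro m_less) auto
      then show False using z0 z1 by simp
    qed
    have "\<exists>z\<ge>z0. z \<le> z1 \<and> m l z = 2 * a"
      by (rule IVT') (use z0 z1 z01 l zr in \<open>auto intro!: continuous_on_subset[OF m_cont_Icc[of l z1]]\<close>)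
    then obtain z2 where z2: "z0 \<le> z2" "z2 \<le> z1" "m l z2 = 2 * a" by blast
    have "- \<Psi> c l z0 \<le> - \<Psi> c l z2"
    proof (rule nondecreasing_if_deriv_nonneg[OF z2(1)])
      show "continuous_on {z0..z2} (\<lambda>z. - \<Psi> c l z)"
        using l z2 z1 z0 zr by (intro continuous_intros continuous_on_subset[OF \<Psi>_cont_Icc[of l z2]]) auto
      fix x assume x: "z0 < x" "x < z2"
      then have x': "x \<in> {-1<..<1}" "zr < x" using z0 z1 z2 zr by auto
      have "m' l x * (B x - c) \<le> 0"
        using m'_pos[OF l x'(1)] B[of x] x' by (simp add: mult_le_0_iff)
      then show "\<exists>d. ((\<lambda>z. - \<Psi> c l z) has_real_derivative d) (at x) \<and> d \<ge> 0"
        using DERIV_minus[OF \<Psi>_deriv[of l x c]] l x' by (intro exI[of _ "- (m' l x * (B x - c))"]) auto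
    qed
    moreover have "\<Psi> c l z2 \<ge> 2 * a * (a - c)"
      using E_nonneg[of l z2] l z2 z1 z0 zr by (auto simp: \<Psi>_def power2_eq_square algebra_simps)
    ultimately show False using z0 by simp
  qed
  ultimately have "\<not> {0<..} \<subseteq> U \<union> V"
    using connectedD[OF connected_Ioi oU oV] by blast
  then obtain l where l: "l > 0" "l \<notin> U" "l \<notin> V" by auto
  have le: "m l z \<le> 2 * a" if "z \<in> {-1<..<1}" for z
    using l that unfolding U_def by (auto simp: not_less)
  \<comment> \<open>Equality is excluded because \<open>m\<close> is strictly increasing.\<close>
  have lt: "m l z < 2 * a" if z: "z \<in> {-1..<1}" for z
  proof -
    have "m l z < m l ((z + 1) / 2)" using l z by (intro m_less) auto
    also have "\<dots> \<le> 2 * a" using z by (intro le) auto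
    finally show ?thesis .
  qed
  moreover have "\<Psi> c l z \<ge> 2 * a * (a - c)" if "z \<in> {zr..<1}" for z
  proof (rule ccontr)
    assume "\<not> \<Psi> c l z \<ge> 2 * a * (a - c)"
    then have "l \<in> V" unfolding V_def using l lt[of z] that zr by (intro UN_I[of z]) auto
    with l show False by simp
  qed
  ultimately show ?thesis using l by blast
qed


section \<open>Extension of the critical solution to the pole z = 1\<close>

text \<open>For the critical l the lower bound on \<open>\<Psi>\<close> factors as E \<ge> (2 a - m)
  ((a - c) + m / 2). This is a linear differential inequality for n = 2 a - m and forces n to decay
  like a power of 1 - z. The decay shows that the total mass is 2 a and makes the derivative of the
  solution integrable at 1.\<close>

lemma solution_exists:
  "\<exists>U. continuous_on {-1..1} U \<and> integral {-1..1} (\<lambda>s. N s * exp (U s)) = 2 * a \<and>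
    (\<forall>z\<in>{-1<..<1}. (U has_real_derivative integral {-1..z} (\<lambda>s. a - N s * exp (U s)) / (1 - z\<^sup>2)) (at z))"
proof -
  define c where "c = (B 1 + a) / 2"
  have c: "c < a" "B 1 < c" using a by (auto simp: c_def B_ends)
  have "(B \<longlongrightarrow> B 1) (at 1 within {-1..1})"
    using B_cont by (auto simp: continuous_on_def)
  then have "(B \<longlongrightarrow> B 1) (at_left 1)" by (simp add: at_within_Icc_at_left)
  then have "eventually (\<lambda>z. B z < c) (at_left 1)" using c by (simp add: order_tendsto_iff)
  then obtain z1 where z1: "z1 < 1" "\<And>z. z1 < z \<Longrightarrow> z < 1 \<Longrightarrow> B z < c"
    using eventually_at_left[of 0 1 "\<lambda>z. B z < c"] by auto
  \<comment> \<open>Nonnegative, so that 1 - x \<le> 1 - x^2 for x between \<open>zr\<close> and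
    1.\<close>
  define zr where "zr = max z1 0"
  have zr: "0 \<le> zr" "zr < 1" "\<And>z. zr < z \<Longrightarrow> z < 1 \<Longrightarrow> B z \<le> c"
    using z1 by (auto simp: zr_def less_imp_le)
  obtain l where l: "l > 0" and lt: "\<And>z. z \<in> {-1..<1} \<Longrightarrow> m l z < 2 * a"
    and Psi: "\<And>z. z \<in> {zr..<1} \<Longrightarrow> \<Psi> c l z \<ge> 2 * a * (a - c)"
    using critical_parameter[of zr c] zr c by auto
  define n where "n = (\<lambda>z. 2 * a - m l z)"
  have n_pos: "n z > 0" if "z \<in> {-1..<1}" for z using lt[OF that] by (simp add: n_def)
  define \<delta> where "\<delta> = (a - c) / 2"
  have \<delta>: "\<delta> > 0" using c by (simp add: \<delta>_def)
  have m'_ge: "(1 - z) * m' l z \<ge> \<delta> * n z" if z: "z \<in> {zr..<1}" for z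
  proof -
    have z': "z \<in> {-1..<1}" "z \<in> {-1<..<1}" using z zr by auto
    have "E l z \<ge> 2 * a * (a - c) + c * m l z - (m l z)\<^sup>2 / 2" using Psi[OF z] by (simp add: \<Psi>_def)
    also have "2 * a * (a - c) + c * m l z - (m l z)\<^sup>2 / 2 = n z * ((a - c) + m l z / 2)"
      by (simp add: n_def power2_eq_square algebra_simps)
    finally have "E l z \<ge> n z * ((a - c) + m l z / 2)" .
    moreover have "n z * (2 * \<delta>) \<le> n z * ((a - c) + m l z / 2)"
      using n_pos[OF z'(1)] m_nonneg[OF l z'(1)] by (intro mult_left_mono) (auto simp: \<delta>_def)
    ultimately have "n z * (2 * \<delta>) \<le> (1 + z) * ((1 - z) * m' l z)"
      unfolding E_def one_minus_square_factor by (simp add: mult_ac)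
    also have "\<dots> \<le> 2 * ((1 - z) * m' l z)"
      using m'_pos[OF l z'(2)] z' by (intro mult_right_mono) auto
    finally show ?thesis by (simp add: mult.commute)
  qed
  define C where "C = n zr * (1 - zr) powr (- \<delta>)"
  have C: "C \<ge> 0" using n_pos[of zr] zr by (simp add: C_def)
  have n_le: "n z \<le> C * (1 - z) powr \<delta>" if z: "z \<in> {zr..<1}" for z
  proof -
    have "- (n zr * (1 - zr) powr (- \<delta>)) \<le> - (n z * (1 - z) powr (- \<delta>))"
    proof (rule nondecreasing_if_deriv_nonneg[where x=zr and y=z])
      show "continuous_on {zr..z} (\<lambda>z. - (n z * (1 - z) powr - \<delta>))"
        unfolding n_def using z zr l by (intro continuous_intros continuous_on_subset[OF m_cont_Icc[of l z]]) auto
      fix x assume x: "zr < x" "x < z"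
      then have x': "1 - x > 0" using z by auto
      have "(n has_real_derivative - m' l x) (at x)"
        unfolding n_def using DERIV_diff[OF DERIV_const m_deriv[of l x]] x z zr l by simp
      moreover have "((\<lambda>z. (1 - z) powr - \<delta>) has_real_derivative \<delta> * (1 - x) powr (- \<delta> - 1)) (at x)"
        using x' by (auto intro!: derivative_eq_intros simp: powr_diff)
      ultimately have "((\<lambda>z. - (n z * (1 - z) powr - \<delta>)) has_real_derivative
          - (- m' l x * (1 - x) powr - \<delta> + \<delta> * (1 - x) powr (- \<delta> - 1) * n x)) (at x)"
        by (intro DERIV_minus DERIV_mult)
      moreover have "- (- m' l x * (1 - x) powr - \<delta> + \<delta> * (1 - x) powr (- \<delta> - 1) * n x)
         = ((1 - x) * m' l x - \<delta> * n x) * (1 - x) powr (- \<delta> - 1)"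
        using x' by (simp add: powr_diff field_simps)
      moreover have "\<dots> \<ge> 0" using m'_ge[of x] x z by auto
      ultimately show "\<exists>d. ((\<lambda>z. - (n z * (1 - z) powr - \<delta>)) has_real_derivative d) (at x) \<and> d \<ge> 0"
        by metis
    qed (use z in auto)
    then have "n z * (1 - z) powr (- \<delta>) * (1 - z) powr \<delta> \<le> C * (1 - z) powr \<delta>"
      by (intro mult_right_mono) (auto simp: C_def)
    moreover have "n z * (1 - z) powr (- \<delta>) * (1 - z) powr \<delta> = n z"
      by (rule powr_minus_mult_cancel) (use z in simp)
    ultimately show ?thesis by (simp only:)
  qed
  define U0 where "U0 = (\<lambda>z. ln l - a * ln ((1 - z) / 2) + w l z)"
  have NU0: "N z * exp (U0 z) = m' l z" if z: "z \<in> {-1..<1}" for z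
  proof -
    have "exp (U0 z) = l * (2 / (1 - z)) powr a * exp (w l z)"
      using z l by (simp add: U0_def exp_add exp_diff powr_def ln_div exp_minus algebra_simps flip: exp_add)
        (simp add: exp_add exp_diff field_simps)
    then show ?thesis by (simp add: m'_def Q_def)
  qed
  have U0_deriv: "(U0 has_real_derivative (a * (1 + z) - m l z) / (1 - z\<^sup>2)) (at z)" if z: "z \<in> {-1<..<1}" for z
  proof -
    have "((\<lambda>z. ln l - a * ln ((1 - z) / 2)) has_real_derivative a / (1 - z)) (at z)"
      using z by (auto intro!: derivative_eq_intros simp: field_simps)
    then have "(U0 has_real_derivative a / (1 - z) + - m l z / (1 - z\<^sup>2)) (at z)"
      unfolding U0_def using w_deriv[of l z] l z by (intro DERIV_add) auto
    moreover have "a / (1 - z) + - M / (1 - z\<^sup>2) = (a * (1 + z) - M) / (1 - z\<^sup>2)" for M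
      unfolding one_minus_square_factor using z by (simp add: diff_divide_distrib)
    ultimately show ?thesis by simp
  qed
  \<comment> \<open>The added term is continuous at 1 and turns the numerator a (1 + z) - m of the
    derivative into 2 a - m > 0. So \<open>Y\<close> is increasing, and its limit at 1 exists once
    it is bounded.\<close>
  define Y where "Y = (\<lambda>z. U0 z + a * ln (1 + z))"
  have Y_deriv: "(Y has_real_derivative n z / (1 - z\<^sup>2)) (at z)" if z: "z \<in> {-1<..<1}" for z
  proof -
    have "(Y has_real_derivative (a * (1 + z) - m l z) / (1 - z\<^sup>2) + a * (1 / (1 + z))) (at z)"
      unfolding Y_def using z by (intro DERIV_add U0_deriv DERIV_cmult) (auto intro!: derivative_eq_intros)
    moreover have "(a * (1 + z) - M) / (1 - z\<^sup>2) + a * (1 / (1 + z)) = (2 * a - M) / (1 - z\<^sup>2)" for M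
    proof -
      have "a * (1 / (1 + z)) = a * (1 - z) / ((1 - z) * (1 + z))" using z by simp
      then show ?thesis
        unfolding one_minus_square_factor by (simp only: add_divide_distrib[symmetric]) (simp add: algebra_simps)
    qed
    ultimately show ?thesis by (simp add: n_def)
  qed
  have Y_cont: "continuous_on {x..y} Y" if "-1 < x" "y < 1" for x y
  proof (rule continuous_at_imp_continuous_on, rule ballI)
    fix z assume "z \<in> {x..y}"
    then show "isCont Y z" using that by (intro DERIV_isCont[OF Y_deriv]) auto
  qed
  have Y_mono: "Y x \<le> Y y" if xy: "zr \<le> x" "x \<le> y" "y < 1" for x y
  proof (rule nondecreasing_if_deriv_nonneg[OF xy(2)])
    show "continuous_on {x..y} Y" using xy zr by (intro Y_cont) auto
    fix z assume "x < z" "z < y"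
    then have z: "z \<in> {-1<..<1}" using xy zr by auto
    show "\<exists>d. (Y has_real_derivative d) (at z) \<and> d \<ge> 0"
      using Y_deriv[OF z] n_pos[of z] one_minus_square_pos[OF z] z
      by (intro exI[of _ "n z / (1 - z\<^sup>2)"]) auto
  qed
  have Y_le: "Y z \<le> Y zr + C / \<delta> * (1 - zr) powr \<delta>" if z: "zr \<le> z" "z < 1" for z
  proof -
    \<comment> \<open>C / \<delta> (1 - z)^\<delta> has derivative - C (1 - z)^(\<delta> - 1), which
      outweighs n / (1 - z^2); its sum with \<open>Y\<close> is nonincreasing.\<close>
    have "- (Y zr + C / \<delta> * (1 - zr) powr \<delta>) \<le> - (Y z + C / \<delta> * (1 - z) powr \<delta>)"
    proof (rule nondecreasing_if_deriv_nonneg[OF z(1)])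
      show "continuous_on {zr..z} (\<lambda>z. - (Y z + C / \<delta> * (1 - z) powr \<delta>))"
        using z zr by (intro continuous_intros Y_cont) auto
      fix x assume x: "zr < x" "x < z"
      then have x': "x \<in> {-1<..<1}" "1 - x > 0" "x \<in> {zr..<1}" using z zr by auto
      have "((\<lambda>z. (1 - z) powr \<delta>) has_real_derivative - \<delta> * (1 - x) powr (\<delta> - 1)) (at x)"
        using x' by (auto intro!: derivative_eq_intros simp: powr_diff)
      then have D: "((\<lambda>z. - (Y z + C / \<delta> * (1 - z) powr \<delta>)) has_real_derivative
          - (n x / (1 - x\<^sup>2) + C / \<delta> * (- \<delta> * (1 - x) powr (\<delta> - 1)))) (at x)"
        by (intro DERIV_minus DERIV_add DERIV_cmult Y_deriv x')
      have "n x / (1 - x\<^sup>2) \<le> (C * (1 - x) powr \<delta>) / (1 - x)"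
      proof (rule frac_le)
        show "1 - x \<le> 1 - x\<^sup>2" using x x' zr by (simp add: power2_eq_square mult_le_cancel_left1)
      qed (use n_le[OF x'(3)] n_pos[of x] x' C in auto)
      also have "\<dots> = C / \<delta> * (\<delta> * (1 - x) powr (\<delta> - 1))" using \<delta> x' by (simp add: powr_diff)
      finally show "\<exists>d. ((\<lambda>z. - (Y z + C / \<delta> * (1 - z) powr \<delta>)) has_real_derivative d) (at x) \<and> d \<ge> 0"
        using D by fastforce
    qed
    moreover have "C / \<delta> * (1 - z) powr \<delta> \<ge> 0" using C \<delta> by simp
    ultimately show ?thesis by simp
  qed
  obtain L where L: "(Y \<longlongrightarrow> L) (at_left 1)"
    using tendsto_at_left_mono_bounded[where f=Y, OF zr(2) Y_mono Y_le] by blast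
  have "((\<lambda>z. Y z - a * ln (1 + z)) \<longlongrightarrow> L - a * ln (1 + 1)) (at_left 1)"
    by (intro tendsto_intros L) auto
  then have U0_lim: "(U0 \<longlongrightarrow> L - a * ln 2) (at_left 1)" by (simp add: Y_def)
  define U where "U = (\<lambda>z. if z < 1 then U0 z else L - a * ln 2)"
  have U_cont: "continuous_on {-1..1} U"
    unfolding U_def
  proof (rule continuous_on_extend_left)
    show "continuous_on {-1..<1} U0"
      unfolding U0_def using l by (intro continuous_intros w_cont) auto
  qed (use U0_lim in auto)
  have NU_cont: "continuous_on {-1..1} (\<lambda>s. N s * exp (U s))"
    by (intro continuous_intros N_cont U_cont)
  have NU: "integral {-1..z} (\<lambda>s. N s * exp (U s)) = m l z" if z: "z \<in> {-1..<1}" for z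
    unfolding m_def by (rule integral_cong) (use z NU0 in \<open>auto simp: U_def\<close>)
  have total: "integral {-1..1} (\<lambda>s. N s * exp (U s)) = 2 * a"
  proof (rule tendsto_unique)
    have "continuous_on {-1..1} (\<lambda>z. integral {-1..z} (\<lambda>s. N s * exp (U s)))"
      by (intro indefinite_integral_continuous_1 integrable_continuous_real NU_cont)
    then have "((\<lambda>z. integral {-1..z} (\<lambda>s. N s * exp (U s))) \<longlongrightarrow> integral {-1..1} (\<lambda>s. N s * exp (U s))) (at 1 within {-1..1})"
      by (auto simp: continuous_on_def)
    then show "((\<lambda>z. integral {-1..z} (\<lambda>s. N s * exp (U s))) \<longlongrightarrow> integral {-1..1} (\<lambda>s. N s * exp (U s))) (at_left 1)"
      by (simp add: at_within_Icc_at_left)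
    have "(n \<longlongrightarrow> 0) (at_left 1)"
    proof (rule Lim_null_comparison)
      have "((\<lambda>z. C * (1 - z) powr \<delta>) \<longlongrightarrow> C * (1 - 1) powr \<delta>) (at 1 within {-1..1})"
        using \<delta> by (intro tendsto_intros tendsto_powr2) (auto simp: eventually_at_filter)
      then show "((\<lambda>z. C * (1 - z) powr \<delta>) \<longlongrightarrow> 0) (at_left 1)"
        using \<delta> by (simp add: at_within_Icc_at_left)
      show "eventually (\<lambda>z. norm (n z) \<le> C * (1 - z) powr \<delta>) (at_left 1)"
        unfolding eventually_at_left[OF zr(2)]
      proof (intro exI[of _ zr] conjI allI impI)
        fix z assume "zr < z" "z < 1"
        then show "norm (n z) \<le> C * (1 - z) powr \<delta>" using n_le[of z] n_pos[of z] zr by auto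
      qed (rule zr)
    qed
    from tendsto_diff[OF tendsto_const[of "2 * a"] this]
    have "(m l \<longlongrightarrow> 2 * a) (at_left 1)" by (simp add: n_def)
    moreover have "eventually (\<lambda>z. m l z = integral {-1..z} (\<lambda>s. N s * exp (U s))) (at_left 1)"
      unfolding eventually_at_left[OF zr(2)] using NU zr by (intro exI[of _ zr]) auto
    ultimately show "((\<lambda>z. integral {-1..z} (\<lambda>s. N s * exp (U s))) \<longlongrightarrow> 2 * a) (at_left 1)"
      by (rule Lim_transform_eventually)
  qed simp
  have U_deriv: "(U has_real_derivative integral {-1..z} (\<lambda>s. a - N s * exp (U s)) / (1 - z\<^sup>2)) (at z)"
    if z: "z \<in> {-1<..<1}" for z
  proof -
    have "integral {-1..z} (\<lambda>s. a - N s * exp (U s)) = a * (1 + z) - m l z"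
    proof -
      have "(\<lambda>s. N s * exp (U s)) integrable_on {-1..z}"
        by (rule integrable_continuous_real, rule continuous_on_subset[OF NU_cont]) (use z in auto)
      from integral_diff[OF integrable_const_ivl this, of a] show ?thesis
        using NU[of z] z by (simp add: mult.commute)
    qed
    moreover have "(U has_real_derivative (a * (1 + z) - m l z) / (1 - z\<^sup>2)) (at z)"
      by (rule has_field_derivative_transform_within_open[OF U0_deriv[OF z], where S="{-1<..<1}"])
        (use z in \<open>auto simp: U_def\<close>)
    ultimately show ?thesis by simp
  qed
  show ?thesis using U_cont total U_deriv by blast
qed

end

section \<open>The area measure\<close>

lemma space_area_S2 [simp]: "space area_S2 = S2"
  by (simp add: area_S2_def space_scale_measure space_restrict_space)

lemma sets_area_S2: "sets area_S2 = sets (restrict_space borel S2)"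
  by (simp add: area_S2_def)

lemma radial_projection_measurable:
  "(\<lambda>x::real^3. x /\<^sub>R norm x) \<in> measurable (restrict_space lborel (cball 0 1 - {0})) (restrict_space borel S2)"
proof (rule measurable_restrict_space2)
  show "(\<lambda>x::real^3. x /\<^sub>R norm x) \<in> borel_measurable (restrict_space lborel (cball 0 1 - {0}))"
    by (intro measurable_restrict_space1) simp
qed (auto simp: space_restrict_space)

definition radial_cone :: "(real^3) set \<Rightarrow> (real^3) set" where
  "radial_cone A = {x \<in> cball 0 1 - {0}. x /\<^sub>R norm x \<in> A}"

lemma radial_cone_measurable:
  assumes "A \<in> sets area_S2"
  shows "radial_cone A \<in> sets borel"
proof -
  have "(\<lambda>x::real^3. x /\<^sub>R norm x) -` A \<inter> space (restrict_space lborel (cball 0 1 - {0}))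
      \<in> sets (restrict_space lborel (cball 0 1 - {0}))"
    using assms by (intro measurable_sets[OF radial_projection_measurable]) (simp add: sets_area_S2)
  moreover have "(\<lambda>x::real^3. x /\<^sub>R norm x) -` A \<inter> space (restrict_space lborel (cball 0 1 - {0})) = radial_cone A"
    by (auto simp: radial_cone_def space_restrict_space)
  ultimately have "radial_cone A \<in> sets (restrict_space lborel (cball 0 1 - {0}))" by simp
  then show ?thesis by (subst (asm) sets_restrict_space_iff) auto
qed

lemma emeasure_area_S2:
  assumes A: "A \<in> sets area_S2"
  shows "emeasure area_S2 A = 3 * emeasure lborel (radial_cone A)"
proof -
  have "emeasure area_S2 A = 3 * emeasure (restrict_space lborel (cball 0 1 - {0}))
      ((\<lambda>x::real^3. x /\<^sub>R norm x) -` A \<inter> space (restrict_space lborel (cball 0 1 - {0})))"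
    unfolding area_S2_def emeasure_scale_measure using A
    by (subst emeasure_distr[OF radial_projection_measurable]) (auto simp: sets_area_S2)
  also have "(\<lambda>x::real^3. x /\<^sub>R norm x) -` A \<inter> space (restrict_space lborel (cball 0 1 - {0})) = radial_cone A"
    by (auto simp: radial_cone_def space_restrict_space)
  also have "emeasure (restrict_space lborel (cball 0 1 - {0})) (radial_cone A) = emeasure lborel (radial_cone A)"
    by (rule emeasure_restrict_space) (auto simp: radial_cone_def)
  finally show ?thesis .
qed

lemma S2_in_sets: "S2 \<in> sets area_S2"
  using sets.top[of area_S2] by simp

lemma emeasure_area_S2_S2: "emeasure area_S2 S2 = ennreal (4 * pi)"
proof -
  have "radial_cone S2 = cball 0 1 - {0}" by (auto simp: radial_cone_def)
  then have "emeasure area_S2 S2 = 3 * emeasure lborel (cball (0::real^3) 1 - {0})"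
    by (simp add: emeasure_area_S2[OF S2_in_sets])
  also have "emeasure lborel (cball (0::real^3) 1 - {0}) = emeasure lborel (cball (0::real^3) 1)"
    by (rule emeasure_Diff_null_set) auto
  also have "\<dots> = ennreal (4 / 3 * pi)"
    by (simp add: emeasure_cball unit_ball_vol_3)
  also have "3 * ennreal (4 / 3 * pi) = ennreal (4 * pi)"
    by (subst ennreal_numeral[symmetric], subst ennreal_mult[symmetric]) auto
  finally show ?thesis .
qed

lemma finite_measure_area_S2: "finite_measure area_S2"
  by (rule finite_measureI) (simp add: emeasure_area_S2_S2)

lemma measure_area_S2: "measure area_S2 S2 = 4 * pi"
  by (simp add: measure_def emeasure_area_S2_S2)

lemma integral_area_S2_const: "(\<integral>x. c \<partial>area_S2) = 4 * pi * (c::real)"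
  by (simp add: measure_area_S2)

lemma continuous_on_measurable_S2:
  fixes f :: "real^3 \<Rightarrow> 'b::topological_space"
  shows "continuous_on S2 f \<Longrightarrow> f \<in> borel_measurable area_S2"
  using borel_measurable_continuous_on_restrict measurable_cong_sets[OF sets_area_S2 refl] by blast

lemma continuous_on_S2_bounded:
  fixes f :: "real^3 \<Rightarrow> 'b::real_normed_vector"
  assumes "continuous_on S2 f"
  obtains C where "C > 0" "\<And>x. x \<in> S2 \<Longrightarrow> norm (f x) \<le> C"
proof -
  have "bounded (f ` S2)"
    by (rule compact_imp_bounded[OF compact_continuous_image[OF assms compact_sphere]])
  then show ?thesis using that unfolding bounded_pos by blast
qed

lemma bounded_integrable_S2:
  fixes f :: "real^3 \<Rightarrow> 'b::{banach, second_countable_topology}"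
  assumes "f \<in> borel_measurable area_S2" "\<And>x. x \<in> S2 \<Longrightarrow> norm (f x) \<le> C"
  shows "integrable area_S2 f"
  by (rule finite_measure.integrable_const_bound[OF finite_measure_area_S2, where B=C])
    (use assms in auto)

lemma continuous_on_integrable_S2:
  fixes f :: "real^3 \<Rightarrow> 'b::{banach, second_countable_topology}"
  assumes "continuous_on S2 f"
  shows "integrable area_S2 f"
proof -
  obtain C where "C > 0" "\<And>x. x \<in> S2 \<Longrightarrow> norm (f x) \<le> C"
    using continuous_on_S2_bounded[OF assms] by blast
  then show ?thesis using bounded_integrable_S2[OF continuous_on_measurable_S2[OF assms]] by blast
qed

lemma integral_cong_S2:
  "(\<And>x. x \<in> S2 \<Longrightarrow> f x = g x) \<Longrightarrow> (\<integral>x. f x \<partial>area_S2) = (\<integral>x. g x \<partial>area_S2)"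
  by (rule Bochner_Integration.integral_cong) auto

lemma AE_S2_I: "(\<And>x. x \<in> S2 \<Longrightarrow> P x) \<Longrightarrow> AE x in area_S2. P x"
  by (rule AE_I2) auto

lemma abs_integral_S2_le:
  fixes f :: "real^3 \<Rightarrow> real"
  assumes "integrable area_S2 f" "\<And>x. x \<in> S2 \<Longrightarrow> \<bar>f x\<bar> \<le> C"
  shows "\<bar>\<integral>x. f x \<partial>area_S2\<bar> \<le> 4 * pi * C"
proof -
  interpret finite_measure area_S2 by (rule finite_measure_area_S2)
  have "\<bar>\<integral>x. f x \<partial>area_S2\<bar> \<le> (\<integral>x. \<bar>f x\<bar> \<partial>area_S2)" by (rule integral_abs_bound)
  also have "\<dots> \<le> (\<integral>x. C \<partial>area_S2)"
    by (rule integral_mono_AE) (use assms in \<open>auto intro: AE_S2_I\<close>)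
  finally show ?thesis by (simp add: measure_area_S2)
qed

text \<open>The cone over a single point lies on a line, which is Lebesgue negligible.\<close>

lemma AE_S2_neq: "AE x in area_S2. x \<noteq> p"
proof (cases "p \<in> S2")
  case False
  then show ?thesis by (intro AE_S2_I) auto
next
  case True
  have "{p} \<in> sets area_S2"
    unfolding sets_area_S2 using True by (subst sets_restrict_space_iff) auto
  moreover have "emeasure area_S2 {p} = 0"
  proof -
    have "radial_cone {p} \<subseteq> span {p}"
    proof
      fix x assume "x \<in> radial_cone {p}"
      then have "x = norm x *\<^sub>R p" by (auto simp: radial_cone_def)
      then show "x \<in> span {p}" by (metis span_base span_scale singletonI)
    qed
    moreover have "negligible (span {p})"
      by (rule negligible_lowdim) (use dim_le_card'[of "{p}"] in \<open>auto simp: dim_span intro: le_less_trans\<close>)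
    ultimately have "negligible (radial_cone {p})" by (rule negligible_subset[rotated])
    then have "emeasure lebesgue (radial_cone {p}) = 0" unfolding negligible_iff_null_sets by (rule null_setsD1)
    then have "emeasure lborel (radial_cone {p}) = 0"
      using radial_cone_measurable[OF \<open>{p} \<in> sets area_S2\<close>] by simp
    then show ?thesis using \<open>{p} \<in> sets area_S2\<close> by (simp add: emeasure_area_S2)
  qed
  ultimately have "{p} \<in> null_sets area_S2" by (simp add: null_sets_def)
  then show ?thesis by (rule AE_I') auto
qed

section \<open>Invariance of the area under orthogonal maps\<close>

text \<open>The preimage is the image under the inverse, to which the determinant formula for linear
  images applies with determinant of absolute value 1. That formula concerns the real-valued
  measure, whence the finiteness assumption.\<close>

lemma emeasure_lborel_orthogonal_vimage:
  fixes R :: "real^3 \<Rightarrow> real^3"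
  assumes R: "orthogonal_transformation R" and A: "A \<in> sets borel" and fin: "emeasure lborel A \<noteq> \<infinity>"
  shows "emeasure lborel (R -` A) = emeasure lborel A"
proof -
  obtain R' where R': "orthogonal_transformation R'" "\<And>x. R' (R x) = x" "\<And>x. R (R' x) = x"
    using orthogonal_transformation_inv[OF R] orthogonal_transformation_bij[OF R]
    by (metis bij_inv_eq_iff)
  have eq: "R -` A = R' ` A" using R'(2,3) by (auto simp: image_iff) metis
  have "R \<in> borel_measurable borel"
    using R by (intro borel_measurable_continuous_onI linear_continuous_on linear_conv_bounded_linear[THEN iffD1]
      orthogonal_transformation_linear)
  then have B: "R -` A \<in> sets borel" using A measurable_sets_borel by blast
  have Al: "A \<in> lmeasurable" using A fin by (simp add: fmeasurable_def less_top)
  have "\<bar>det (matrix R')\<bar> = 1" using R'(1) by simp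
  then have "measure lebesgue (R' ` A) = measure lebesgue A"
    using measure_linear_image[OF orthogonal_transformation_linear[OF R'(1)] Al] by simp
  moreover have "R' ` A \<in> lmeasurable"
    using measurable_linear_image[OF orthogonal_transformation_linear[OF R'(1)] Al] .
  ultimately have "emeasure lebesgue (R' ` A) = emeasure lebesgue A"
    using Al by (simp add: emeasure_eq_measure2 fmeasurableD2)
  then show ?thesis using A B eq by simp
qed

text \<open>An orthogonal map commutes with the radial projection, so the cone over a preimage is
  the preimage of the cone, and the invariance of Lebesgue measure passes to the area.\<close>

lemma integral_S2_orthogonal:
  fixes R :: "real^3 \<Rightarrow> real^3" and f :: "real^3 \<Rightarrow> real"
  assumes R: "orthogonal_transformation R" and f: "f \<in> borel_measurable area_S2"
  shows "(\<integral>x. f (R x) \<partial>area_S2) = (\<integral>x. f x \<partial>area_S2)"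
proof -
  have nR: "norm (R x) = norm x" for x using R by (simp add: orthogonal_transformation_norm)
  have Rc: "continuous_on UNIV R"
    using R by (intro linear_continuous_on linear_conv_bounded_linear[THEN iffD1] orthogonal_transformation_linear)
  have Rm: "R \<in> measurable area_S2 area_S2"
  proof -
    have "R \<in> measurable (restrict_space borel S2) (restrict_space borel S2)"
      by (rule measurable_restrict_space3)
        (use Rc nR in \<open>auto intro: borel_measurable_continuous_onI\<close>)
    then show ?thesis using measurable_cong_sets[OF sets_area_S2 sets_area_S2] by blast
  qed
  have "distr area_S2 area_S2 R = area_S2"
  proof (rule measure_eqI)
    fix A assume "A \<in> sets (distr area_S2 area_S2 R)"
    then have A: "A \<in> sets area_S2" by simp
    have pre: "R -` A \<inter> S2 \<in> sets area_S2" using measurable_sets[OF Rm A] by simp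
    have "A \<subseteq> S2" using sets.sets_into_space[OF A] by simp
    have coneR: "radial_cone (R -` A \<inter> S2) = R -` radial_cone A"
    proof -
      have "R (x /\<^sub>R norm x) = R x /\<^sub>R norm (R x)" for x
        using R nR by (simp add: orthogonal_transformation_scaleR)
      moreover have "R x = 0 \<longleftrightarrow> x = 0" for x using nR[of x] by (metis norm_eq_zero)
      ultimately show ?thesis using nR by (auto simp: radial_cone_def)
    qed
    have "emeasure lborel (radial_cone A) \<le> emeasure lborel (cball (0::real^3) 1)"
      by (rule emeasure_mono) (auto simp: radial_cone_def)
    also have "\<dots> < \<infinity>" by (simp add: emeasure_cball)
    finally have "emeasure lborel (R -` radial_cone A) = emeasure lborel (radial_cone A)"
      by (intro emeasure_lborel_orthogonal_vimage R radial_cone_measurable A) auto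
    then show "emeasure (distr area_S2 area_S2 R) A = emeasure area_S2 A"
      using A pre by (simp add: emeasure_distr[OF Rm] emeasure_area_S2 coneR)
  qed simp
  then have "(\<integral>x. f x \<partial>area_S2) = (\<integral>x. f x \<partial>distr area_S2 area_S2 R)" by simp
  also have "\<dots> = (\<integral>x. f (R x) \<partial>area_S2)" by (rule integral_distr[OF Rm f])
  finally show ?thesis ..
qed

section \<open>The divergence theorem\<close>

text \<open>Differentiability is asked on a neighbourhood, so that ambient derivatives and product
  rules are available. Continuity of the derivative is asked only on the sphere and for each fixed
  direction, where it makes integrands continuous.\<close>

definition C1_near_S2 :: "(real^3 \<Rightarrow> 'b::real_normed_vector) \<Rightarrow> (real^3 \<Rightarrow> real^3 \<Rightarrow> 'b) \<Rightarrow> bool" where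
  "C1_near_S2 f f' \<longleftrightarrow> (\<exists>W. open W \<and> S2 \<subseteq> W \<and> (\<forall>x\<in>W. (f has_derivative f' x) (at x))) \<and>
     (\<forall>v. continuous_on S2 (\<lambda>x. f' x v))"

lemma C1_near_S2_deriv: "C1_near_S2 f f' \<Longrightarrow> x \<in> S2 \<Longrightarrow> (f has_derivative f' x) (at x)"
  unfolding C1_near_S2_def by blast

lemma C1_near_S2_linear: "C1_near_S2 f f' \<Longrightarrow> x \<in> S2 \<Longrightarrow> linear (f' x)"
  using C1_near_S2_deriv has_derivative_linear by blast

lemma C1_near_S2_cont: "C1_near_S2 f f' \<Longrightarrow> continuous_on S2 f"
  by (meson C1_near_S2_deriv continuous_at_imp_continuous_on has_derivative_continuous)

text \<open>Expanding the varying direction in the basis reduces the claim to fixed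
  directions.\<close>

lemma C1_near_S2_cont_deriv:
  assumes "C1_near_S2 f f'" and g: "continuous_on S2 g"
  shows "continuous_on S2 (\<lambda>x. f' x (g x))"
proof -
  have c: "continuous_on S2 (\<lambda>x. \<Sum>b\<in>Basis. (g x \<bullet> b) *\<^sub>R f' x b)"
    using assms unfolding C1_near_S2_def by (intro continuous_intros) auto
  have eq: "(\<Sum>b\<in>Basis. (g x \<bullet> b) *\<^sub>R f' x b) = f' x (g x)" if "x \<in> S2" for x
  proof -
    have "f' x (g x) = f' x (\<Sum>b\<in>Basis. (g x \<bullet> b) *\<^sub>R b)" by (simp add: euclidean_representation)
    also have "\<dots> = (\<Sum>b\<in>Basis. (g x \<bullet> b) *\<^sub>R f' x b)"
      using C1_near_S2_linear[OF assms(1) that] by (simp add: linear_sum linear_scale)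
    finally show ?thesis ..
  qed
  show ?thesis by (rule continuous_on_eq[OF c eq])
qed

section \<open>Rotations and their generating fields\<close>

unbundle cross3_syntax

text \<open>Rodrigues' formula for the rotation by the angle s about the unit axis e; it is the flow
  of the field e \<times> x.\<close>

definition rotation :: "real^3 \<Rightarrow> real \<Rightarrow> real^3 \<Rightarrow> real^3" where
  "rotation e s x = cos s *\<^sub>R x + sin s *\<^sub>R (e \<times> x) + ((1 - cos s) * (e \<bullet> x)) *\<^sub>R e"

lemma cross_add_mult:
  fixes x y z :: "real^3"
  shows "e \<times> (x + y) = e \<times> x + e \<times> y" "e \<times> (c *\<^sub>R x) = c *\<^sub>R (e \<times> x)"
  by (simp_all add: cross_add_right cross_mult_right)

lemma cross_cross_unit: "norm e = 1 \<Longrightarrow> e \<times> (e \<times> x) = (e \<bullet> x) *\<^sub>R e - x"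
  for e x :: "real^3"
  by (simp add: norm_eq_1) (simp add: Lagrange)

lemma orthogonal_transformation_rotation:
  assumes e: "norm e = 1"
  shows "orthogonal_transformation (rotation e s)"
  unfolding orthogonal_transformation
proof (intro conjI allI)
  show "linear (rotation e s)"
    unfolding rotation_def
    by (rule linearI) (simp_all add: cross_add_mult inner_add_right algebra_simps scaleR_add_left)
  fix x
  have ee: "e \<bullet> e = 1" using e by (simp add: norm_eq_1)
  have "(norm (e \<times> x))\<^sup>2 = (norm x)\<^sup>2 - (e \<bullet> x)\<^sup>2" using norm_cross_dot[of e x] e by simp
  then have cc: "(e \<times> x) \<bullet> (e \<times> x) = x \<bullet> x - (e \<bullet> x)\<^sup>2" by (simp add: power2_norm_eq_inner)
  have z: "(e \<times> x) \<bullet> x = 0" "x \<bullet> (e \<times> x) = 0" "e \<bullet> (e \<times> x) = 0" "(e \<times> x) \<bullet> e = 0"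
    by (simp_all add: dot_cross_self)
  have "rotation e s x \<bullet> rotation e s x =
      (cos s)\<^sup>2 * (x \<bullet> x) + (sin s)\<^sup>2 * (x \<bullet> x - (e \<bullet> x)\<^sup>2) + (1 - cos s) * (1 + cos s) * (e \<bullet> x)\<^sup>2"
    unfolding rotation_def inner_add_left inner_add_right inner_scaleR_left inner_scaleR_right
    by (simp add: z cc ee inner_commute[of x e] power2_eq_square algebra_simps)
  also have "\<dots> = x \<bullet> x"
    unfolding sin_squared_eq by (simp add: power2_eq_square algebra_simps)
  finally show "norm (rotation e s x) = norm x" by (simp add: norm_eq_sqrt_inner)
qed

lemma rotation_0: "rotation e 0 x = x"
  by (simp add: rotation_def)

lemma rotation_deriv:
  assumes "norm e = 1"
  shows "((\<lambda>s. rotation e s x) has_vector_derivative e \<times> rotation e s x) (at s)"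
proof -
  have "((\<lambda>s. rotation e s x) has_vector_derivative
      (- sin s) *\<^sub>R x + cos s *\<^sub>R (e \<times> x) + (sin s * (e \<bullet> x)) *\<^sub>R e) (at s)"
    unfolding rotation_def
    by (rule derivative_eq_intros refl | simp)+
  moreover have "e \<times> rotation e s x = (- sin s) *\<^sub>R x + cos s *\<^sub>R (e \<times> x) + (sin s * (e \<bullet> x)) *\<^sub>R e"
    unfolding rotation_def cross_add_mult cross_cross_unit[OF assms] cross_refl
    by (simp add: algebra_simps)
  ultimately show ?thesis by simp
qed

lemma norm_rotation: "norm e = 1 \<Longrightarrow> norm (rotation e s x) = norm x"
  using orthogonal_transformation_rotation orthogonal_transformation_norm by blast

text \<open>Differentiate the rotation invariance of the integral at angle 0. By the mean value
  theorem the difference quotients are values of the rotation derivative at points of the sphere,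
  hence uniformly bounded, and dominated convergence applies.\<close>

lemma integral_rotation_derivative:
  fixes f :: "real^3 \<Rightarrow> real"
  assumes f: "C1_near_S2 f f'" and e: "norm e = 1"
  shows "(\<integral>x. f' x (e \<times> x) \<partial>area_S2) = 0"
proof -
  define g where "g = (\<lambda>x. f' x (e \<times> x))"
  have gc: "continuous_on S2 g"
    unfolding g_def by (intro C1_near_S2_cont_deriv[OF f] continuous_on_cross continuous_intros)
  obtain C where C: "\<And>x. x \<in> S2 \<Longrightarrow> \<bar>g x\<bar> \<le> C"
    using continuous_on_S2_bounded[OF gc] by (metis real_norm_def)
  have deriv: "((\<lambda>s. f (rotation e s x)) has_real_derivative g (rotation e s x)) (at s)" if x: "x \<in> S2" for x s
  proof -
    have "(f has_derivative f' (rotation e s x)) (at (rotation e s x))"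
      by (rule C1_near_S2_deriv[OF f]) (use x norm_rotation[OF e] in auto)
    from vector_derivative_diff_chain_within[OF rotation_deriv[OF e] has_derivative_at_withinI[OF this]]
    show ?thesis by (simp add: o_def g_def has_real_derivative_iff_has_vector_derivative)
  qed
  define h where "h = (\<lambda>n::nat. 1 / real (Suc n))"
  have h: "h n > 0" for n by (simp add: h_def)
  have h0: "h \<longlonglongrightarrow> 0" unfolding h_def using LIMSEQ_inverse_real_of_nat by (simp add: inverse_eq_divide)
  define D where "D = (\<lambda>n x. (f (rotation e (h n) x) - f x) / h n)"
  have fc: "continuous_on S2 f" by (rule C1_near_S2_cont[OF f])
  have rc: "continuous_on S2 (\<lambda>x. f (rotation e s x))" for s
  proof (rule continuous_on_compose2[OF fc])
    show "continuous_on S2 (rotation e s)"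
      unfolding rotation_def by (intro continuous_intros continuous_on_cross)
  qed (use norm_rotation[OF e] in auto)
  have "(\<lambda>n. \<integral>x. D n x \<partial>area_S2) \<longlonglongrightarrow> (\<integral>x. g x \<partial>area_S2)"
  proof (rule integral_dominated_convergence[where w="\<lambda>_. C"])
    show "g \<in> borel_measurable area_S2" by (rule continuous_on_measurable_S2[OF gc])
    show "D n \<in> borel_measurable area_S2" for n
      unfolding D_def using h[of n] by (intro continuous_on_measurable_S2 continuous_intros rc fc) auto
    show "integrable area_S2 (\<lambda>_. C)" using finite_measure_area_S2 by (simp add: finite_measure.integrable_const)
    show "AE x in area_S2. (\<lambda>n. D n x) \<longlonglongrightarrow> g x"
    proof (rule AE_S2_I)
      fix x assume x: "x \<in> S2"
      have "((\<lambda>s. (f (rotation e s x) - f (rotation e 0 x)) / (s - 0)) \<longlongrightarrow> g x) (at 0)"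
        using deriv[OF x, of 0] by (simp add: has_field_derivative_iff rotation_0)
      moreover have "filterlim h (at 0) sequentially"
        using h0 h by (auto simp: filterlim_at less_imp_neq[symmetric])
      ultimately show "(\<lambda>n. D n x) \<longlonglongrightarrow> g x"
        unfolding D_def using filterlim_compose by (fastforce simp: rotation_0)
    qed
    show "AE x in area_S2. norm (D n x) \<le> C" for n
    proof (rule AE_S2_I)
      fix x assume x: "x \<in> S2"
      obtain t where "f (rotation e (h n) x) - f (rotation e 0 x) = (h n - 0) * g (rotation e t x)"
        using MVT2[OF h[of n], of "\<lambda>s. f (rotation e s x)" "\<lambda>s. g (rotation e s x)"] deriv[OF x] by blast
      then have "D n x = g (rotation e t x)" using h[of n] by (simp add: D_def rotation_0)
      moreover have "rotation e t x \<in> S2" using x norm_rotation[OF e] by simp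
      ultimately show "norm (D n x) \<le> C" using C by simp
    qed
  qed
  moreover have "(\<integral>x. D n x \<partial>area_S2) = 0" for n
  proof -
    have "(\<integral>x. D n x \<partial>area_S2) = ((\<integral>x. f (rotation e (h n) x) \<partial>area_S2) - (\<integral>x. f x \<partial>area_S2)) / h n"
      unfolding D_def using continuous_on_integrable_S2[OF rc] continuous_on_integrable_S2[OF fc]
      by simp
    also have "\<dots> = 0"
      by (simp add: integral_S2_orthogonal[OF orthogonal_transformation_rotation[OF e]
            continuous_on_measurable_S2[OF fc]])
    finally show ?thesis .
  qed
  ultimately show ?thesis by (simp add: g_def LIMSEQ_const_iff)
qed

lemma sum_Basis_real3: "(\<Sum>b\<in>Basis. f b) = f (axis 1 1) + f (axis 2 1) + f (axis 3 (1::real))"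
  for f :: "real^3 \<Rightarrow> 'a::comm_monoid_add"
proof -
  have "(Basis :: (real^3) set) = (\<lambda>i. axis i 1) ` UNIV" by (auto simp: Basis_vec_def)
  then have "(\<Sum>b\<in>Basis. f b) = (\<Sum>i\<in>UNIV. f (axis i 1))"
    by (subst \<open>Basis = _\<close>, subst sum.reindex) (auto simp: inj_on_def axis_eq_axis)
  then show ?thesis by (simp add: sum_3)
qed

section \<open>Gradient and divergence in ambient terms\<close>

text \<open>The function (y . y - 1) / 2 vanishes on the sphere and has differential w . x at x.
  Subtracting F' x times this function removes the normal derivative without changing the
  restriction to the sphere.\<close>

lemma tangential_derivative_within_S2:
  fixes F f :: "real^3 \<Rightarrow> 'b::real_normed_vector"
  assumes x: "x \<in> S2" and F: "(F has_derivative F') (at x)" and eq: "\<And>y. y \<in> S2 \<Longrightarrow> f y = F y"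
  shows "(f has_derivative (\<lambda>w. F' (w - (w \<bullet> x) *\<^sub>R x))) (at x within S2)"
proof -
  have lin: "linear F'" using F by (rule has_derivative_linear)
  have "((\<lambda>y. F y - ((y \<bullet> y - 1) / 2) *\<^sub>R F' x) has_derivative
      (\<lambda>w. F' w - ((w \<bullet> x + x \<bullet> w) / 2) *\<^sub>R F' x)) (at x within S2)"
    by (auto intro!: derivative_eq_intros has_derivative_at_withinI[OF F] simp: inner_commute)
  then have "((\<lambda>y. F y - ((y \<bullet> y - 1) / 2) *\<^sub>R F' x) has_derivative
      (\<lambda>w. F' (w - (w \<bullet> x) *\<^sub>R x))) (at x within S2)"
    by (simp add: inner_commute linear_diff[OF lin] linear_scale[OF lin])
  then show ?thesis
    by (rule has_derivative_transform[rotated 2]) (use x eq in \<open>auto simp: dot_square_norm\<close>)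
qed

text \<open>The derivative selected by \<open>div_S2\<close> is F' composed with the projection onto
  the tangent plane; the projection costs the normal entry F' x . x of the trace.\<close>

lemma div_S2_eq:
  assumes x: "x \<in> S2" and F: "(F has_derivative F') (at x)" and eq: "\<And>y. y \<in> S2 \<Longrightarrow> X y = F y"
  shows "div_S2 X x = (\<Sum>b\<in>Basis. F' b \<bullet> b) - F' x \<bullet> x"
proof -
  let ?D = "\<lambda>w. F' (w - (w \<bullet> x) *\<^sub>R x)"
  have lin: "linear F'" using F by (rule has_derivative_linear)
  have xx: "x \<bullet> x = 1" using x by (simp add: dot_square_norm)
  have D: "(X has_derivative ?D) (at x within S2)" by (rule tangential_derivative_within_S2[OF x F eq])
  have Dx: "?D x = 0" using xx linear_0[OF lin] by simp
  have "(THE D. (X has_derivative D) (at x within S2) \<and> D x = 0) = ?D"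
  proof (rule the_equality)
    show "(X has_derivative ?D) (at x within S2) \<and> ?D x = 0" using D Dx by blast
    fix E assume E: "(X has_derivative E) (at x within S2) \<and> E x = 0"
    then have "E x = ?D x" using Dx by simp
    with E D show "E = ?D" by (intro has_derivative_S2_unique[OF x]) blast+
  qed
  then have "div_S2 X x = (\<Sum>b\<in>Basis. F' b \<bullet> b - (b \<bullet> x) * (F' x \<bullet> b))"
    by (simp add: div_S2_def linear_diff[OF lin] linear_scale[OF lin] inner_diff_left)
  also have "\<dots> = (\<Sum>b\<in>Basis. F' b \<bullet> b) - (\<Sum>b\<in>Basis. (F' x \<bullet> b) * (x \<bullet> b))"
    by (simp add: sum_subtractf inner_commute mult.commute)
  also have "(\<Sum>b\<in>Basis. (F' x \<bullet> b) * (x \<bullet> b)) = F' x \<bullet> x"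
    by (rule euclidean_inner[symmetric])
  finally show ?thesis .
qed

lemma grad_S2_eq:
  assumes x: "x \<in> S2" and F: "(F has_derivative (\<lambda>w. v \<bullet> w)) (at x)" and eq: "\<And>y. y \<in> S2 \<Longrightarrow> f y = F y"
  shows "grad_S2 f x = v - (v \<bullet> x) *\<^sub>R x"
proof -
  have xx: "x \<bullet> x = 1" using x by (simp add: dot_square_norm)
  let ?g = "v - (v \<bullet> x) *\<^sub>R x"
  have "(\<lambda>w. v \<bullet> (w - (w \<bullet> x) *\<^sub>R x)) = (\<lambda>w. ?g \<bullet> w)"
    by (simp add: inner_diff_left inner_diff_right inner_commute fun_eq_iff)
  with tangential_derivative_within_S2[OF x F eq]
  have D: "(f has_derivative (\<lambda>w. ?g \<bullet> w)) (at x within S2)" by simp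
  have gx: "?g \<bullet> x = 0" by (simp add: inner_diff_left xx)
  have uniq: "u = ?g" if u: "u \<bullet> x = 0" "(f has_derivative (\<lambda>w. u \<bullet> w)) (at x within S2)" for u
  proof -
    have "u \<bullet> x = ?g \<bullet> x" by (simp only: u(1) gx)
    then have "(\<lambda>w. u \<bullet> w) = (\<lambda>w. ?g \<bullet> w)"
      by (rule has_derivative_S2_unique[OF x u(2) D])
    then have "\<forall>w. u \<bullet> w = ?g \<bullet> w" by (intro allI) (rule fun_cong)
    then show ?thesis by (simp only: vector_eq_rdot)
  qed
  show ?thesis
    unfolding grad_S2_def
  proof (rule the_equality)
    show "?g \<bullet> x = 0 \<and> (f has_derivative (\<lambda>w. ?g \<bullet> w)) (at x within S2)" using gx D by (rule conjI)
  qed (elim conjE, rule uniq)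
qed

text \<open>One has b . (x \<times> L (b \<times> x)) = (b \<times> x) . L (b \<times> x), and the
  vectors b \<times> x form a tight frame of the tangent plane, so these terms add up to the trace
  of L over that plane. The terms with (b \<times> x) \<times> X add up to - 2 (X . x) = 0. The
  proof verifies this in coordinates.\<close>

lemma divergence_as_rotations:
  fixes x :: "real^3" and L :: "real^3 \<Rightarrow> real^3"
  assumes L: "linear L" and x: "x \<in> S2" and X: "X \<bullet> x = 0"
  shows "(\<Sum>b\<in>Basis. b \<bullet> ((b \<times> x) \<times> X + x \<times> L (b \<times> x))) = (\<Sum>b\<in>Basis. L b \<bullet> b) - L x \<bullet> x"
proof -
  have rep: "L v = v$1 *\<^sub>R L (axis 1 1) + v$2 *\<^sub>R L (axis 2 1) + v$3 *\<^sub>R L (axis 3 1)" for v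
  proof -
    have "v = v$1 *\<^sub>R axis 1 1 + v$2 *\<^sub>R axis 2 1 + v$3 *\<^sub>R axis 3 1"
      by (simp add: vec_eq_iff forall_3 axis_def)
    then have "L v = L (v$1 *\<^sub>R axis 1 1 + v$2 *\<^sub>R axis 2 1 + v$3 *\<^sub>R axis 3 1)" by simp
    then show ?thesis by (simp only: linear_add[OF L] linear_scale[OF L])
  qed
  have X': "X$1 * x$1 + X$2 * x$2 + X$3 * x$3 = 0" using X by (simp add: inner_vec_def sum_3)
  have "x \<bullet> x = 1" using x by (simp add: dot_square_norm)
  then have x': "x$1 * x$1 + x$2 * x$2 + x$3 * x$3 = 1" by (simp add: inner_vec_def sum_3)
  show ?thesis
    unfolding sum_Basis_real3 rep[of "_ \<times> _"] rep[of x]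
    apply (simp add: cross3_def inner_vec_def sum_3 axis_def vector_def)
    using X' x' by algebra
qed

lemma integral_div_S2:
  assumes X: "C1_near_S2 X X'" and tan: "\<And>x. x \<in> S2 \<Longrightarrow> X x \<bullet> x = 0"
  shows "(\<integral>x. div_S2 X x \<partial>area_S2) = 0"
proof -
  obtain W where W: "open W" "S2 \<subseteq> W" "\<And>x. x \<in> W \<Longrightarrow> (X has_derivative X' x) (at x)"
    and cont: "\<And>v. continuous_on S2 (\<lambda>x. X' x v)"
    using X unfolding C1_near_S2_def by blast
  define Y' where "Y' = (\<lambda>b x v. b \<bullet> (v \<times> X x + x \<times> X' x v))"
  have Xc: "continuous_on S2 X" by (rule C1_near_S2_cont[OF X])
  have Y: "C1_near_S2 (\<lambda>x. b \<bullet> (x \<times> X x)) (Y' b)" for b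
    unfolding C1_near_S2_def
  proof (intro conjI exI[of _ W] ballI allI)
    fix x assume "x \<in> W"
    have "bounded_bilinear (\<times>)" by (simp add: bilinear_conv_bounded_bilinear[symmetric] bilinear_cross)
    from bounded_bilinear.FDERIV[OF this has_derivative_ident W(3)[OF \<open>x \<in> W\<close>]]
    have "((\<lambda>x. x \<times> X x) has_derivative (\<lambda>v. x \<times> X' x v + v \<times> X x)) (at x)" .
    from has_derivative_inner_right[OF this, of b]
    show "((\<lambda>x. b \<bullet> (x \<times> X x)) has_derivative Y' b x) (at x)"
      unfolding Y'_def by (simp add: add.commute)
  next
    show "continuous_on S2 (\<lambda>x. Y' b x v)" for v
      unfolding Y'_def by (intro continuous_intros continuous_on_cross cont Xc)
  qed (use W in auto)
  have "(\<integral>x. div_S2 X x \<partial>area_S2) = (\<integral>x. (\<Sum>b\<in>Basis. Y' b x (b \<times> x)) \<partial>area_S2)"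
  proof (rule integral_cong_S2)
    fix x assume x: "x \<in> S2"
    have "div_S2 X x = (\<Sum>b\<in>Basis. X' x b \<bullet> b) - X' x x \<bullet> x"
      by (rule div_S2_eq[OF x C1_near_S2_deriv[OF X x]]) auto
    also have "\<dots> = (\<Sum>b\<in>Basis. Y' b x (b \<times> x))"
      unfolding Y'_def using divergence_as_rotations[OF C1_near_S2_linear[OF X x] x tan[OF x]] by simp
    finally show "div_S2 X x = (\<Sum>b\<in>Basis. Y' b x (b \<times> x))" .
  qed
  also have "\<dots> = (\<Sum>b\<in>Basis. \<integral>x. Y' b x (b \<times> x) \<partial>area_S2)"
    by (intro Bochner_Integration.integral_sum continuous_on_integrable_S2 C1_near_S2_cont_deriv[OF Y]
        continuous_on_cross continuous_intros)
  also have "\<dots> = 0"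
    by (rule sum.neutral) (use integral_rotation_derivative[OF Y] in auto)
  finally show ?thesis .
qed

section \<open>Integration by parts\<close>

lemma C1_near_S2_scaleR:
  fixes f :: "real^3 \<Rightarrow> real" and X :: "real^3 \<Rightarrow> real^3"
  assumes f: "C1_near_S2 f f'" and X: "C1_near_S2 X X'"
  shows "C1_near_S2 (\<lambda>x. f x *\<^sub>R X x) (\<lambda>x v. f x *\<^sub>R X' x v + f' x v *\<^sub>R X x)"
proof -
  obtain W where W: "open W" "S2 \<subseteq> W" "\<And>x. x \<in> W \<Longrightarrow> (f has_derivative f' x) (at x)"
    using f unfolding C1_near_S2_def by blast
  obtain W' where W': "open W'" "S2 \<subseteq> W'" "\<And>x. x \<in> W' \<Longrightarrow> (X has_derivative X' x) (at x)"
    using X unfolding C1_near_S2_def by blast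
  have c: "\<And>v. continuous_on S2 (\<lambda>x. f' x v)" "\<And>v. continuous_on S2 (\<lambda>x. X' x v)"
    using f X unfolding C1_near_S2_def by blast+
  show ?thesis
    unfolding C1_near_S2_def
  proof (intro conjI exI[of _ "W \<inter> W'"] ballI allI)
    show "((\<lambda>x. f x *\<^sub>R X x) has_derivative (\<lambda>v. f x *\<^sub>R X' x v + f' x v *\<^sub>R X x)) (at x)" if "x \<in> W \<inter> W'" for x
      using that W(3)[of x] W'(3)[of x] by (intro has_derivative_scaleR) auto
    show "continuous_on S2 (\<lambda>x. f x *\<^sub>R X' x v + f' x v *\<^sub>R X x)" for v
      by (intro continuous_intros c C1_near_S2_cont[OF f] C1_near_S2_cont[OF X])
  qed (use W W' in auto)
qed

lemma div_S2_C1: "C1_near_S2 X X' \<Longrightarrow> x \<in> S2 \<Longrightarrow> div_S2 X x = (\<Sum>b\<in>Basis. X' x b \<bullet> b) - X' x x \<bullet> x"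
  using div_S2_eq[OF _ C1_near_S2_deriv] by blast

lemma continuous_on_div_S2:
  assumes "C1_near_S2 X X'"
  shows "continuous_on S2 (div_S2 X)"
proof (rule continuous_on_eq)
  show "continuous_on S2 (\<lambda>x. (\<Sum>b\<in>Basis. X' x b \<bullet> b) - X' x x \<bullet> x)"
    by (intro continuous_intros C1_near_S2_cont_deriv[OF assms])
  show "(\<Sum>b\<in>Basis. X' x b \<bullet> b) - X' x x \<bullet> x = div_S2 X x" if "x \<in> S2" for x
    using div_S2_C1[OF assms that] by simp
qed

lemma linear_eq_inner_sum:
  fixes L :: "real^3 \<Rightarrow> real"
  assumes "linear L"
  shows "(\<Sum>b\<in>Basis. L b * (v \<bullet> b)) = L v"
proof -
  have "L v = L (\<Sum>b\<in>Basis. (v \<bullet> b) *\<^sub>R b)" by (simp add: euclidean_representation)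
  also have "\<dots> = (\<Sum>b\<in>Basis. L b * (v \<bullet> b))" by (simp add: linear_sum[OF assms] linear_scale[OF assms] mult.commute)
  finally show ?thesis ..
qed

lemma div_S2_scaleR:
  fixes f :: "real^3 \<Rightarrow> real"
  assumes f: "C1_near_S2 f f'" and X: "C1_near_S2 X X'" and x: "x \<in> S2" and tan: "X x \<bullet> x = 0"
  shows "div_S2 (\<lambda>x. f x *\<^sub>R X x) x = f x * div_S2 X x + f' x (X x)"
proof -
  have "(\<Sum>b\<in>Basis. (f x *\<^sub>R X' x b + f' x b *\<^sub>R X x) \<bullet> b) =
      f x * (\<Sum>b\<in>Basis. X' x b \<bullet> b) + (\<Sum>b\<in>Basis. f' x b * (X x \<bullet> b))"
    by (simp add: inner_add_left sum.distrib sum_distrib_left)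
  also have "(\<Sum>b\<in>Basis. f' x b * (X x \<bullet> b)) = f' x (X x)"
    by (rule linear_eq_inner_sum[OF C1_near_S2_linear[OF f x]])
  finally show ?thesis
    unfolding div_S2_C1[OF C1_near_S2_scaleR[OF f X] x] div_S2_C1[OF X x]
    by (simp add: inner_add_left tan right_diff_distrib)
qed

lemma integral_by_parts_S2:
  fixes f :: "real^3 \<Rightarrow> real"
  assumes f: "C1_near_S2 f f'" and X: "C1_near_S2 X X'" and tan: "\<And>x. x \<in> S2 \<Longrightarrow> X x \<bullet> x = 0"
  shows "(\<integral>x. f x * div_S2 X x \<partial>area_S2) = - (\<integral>x. f' x (X x) \<partial>area_S2)"
proof -
  have c: "continuous_on S2 (\<lambda>x. f x * div_S2 X x)" "continuous_on S2 (\<lambda>x. f' x (X x))"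
    by (intro continuous_intros C1_near_S2_cont[OF f] continuous_on_div_S2[OF X]
        C1_near_S2_cont_deriv[OF f] C1_near_S2_cont[OF X])+
  have "0 = (\<integral>x. div_S2 (\<lambda>x. f x *\<^sub>R X x) x \<partial>area_S2)"
    by (rule integral_div_S2[OF C1_near_S2_scaleR[OF f X], symmetric]) (use tan in simp)
  also have "\<dots> = (\<integral>x. f x * div_S2 X x + f' x (X x) \<partial>area_S2)"
    by (rule integral_cong_S2) (use div_S2_scaleR[OF f X] tan in simp)
  also have "\<dots> = (\<integral>x. f x * div_S2 X x \<partial>area_S2) + (\<integral>x. f' x (X x) \<partial>area_S2)"
    by (intro Bochner_Integration.integral_add continuous_on_integrable_S2 c)
  finally show ?thesis by simp
qed

lemma grad_S2_inner:
  assumes F: "C1_near_S2 F F'" and eq: "\<And>y. y \<in> S2 \<Longrightarrow> f y = F y" and x: "x \<in> S2" and t: "t \<bullet> x = 0"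
  shows "grad_S2 f x \<bullet> t = F' x t"
proof -
  have lin: "linear (F' x)" by (rule C1_near_S2_linear[OF F x])
  define v where "v = (\<Sum>b\<in>Basis. F' x b *\<^sub>R b)"
  have v: "F' x = (\<lambda>w. v \<bullet> w)"
  proof
    fix w
    have "v \<bullet> w = (\<Sum>b\<in>Basis. F' x b * (w \<bullet> b))"
      unfolding v_def inner_sum_left by (rule sum.cong) (auto simp: inner_commute)
    then show "F' x w = v \<bullet> w" using linear_eq_inner_sum[OF lin, of w] by simp
  qed
  have "grad_S2 f x = v - (v \<bullet> x) *\<^sub>R x"
    by (rule grad_S2_eq[OF x _ eq]) (use C1_near_S2_deriv[OF F x] v in auto)
  then show ?thesis using t v by (simp add: inner_diff_left inner_commute[of x t])
qed

lemma smooth_S2_C1: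
  assumes "smooth_S2 f"
  obtains F F' where "C1_near_S2 F F'" "\<And>x. x \<in> S2 \<Longrightarrow> f x = F x"
proof -
  obtain U F where U: "open U" "S2 \<subseteq> U" "\<And>k. Ck_on k U F" "\<And>x. x \<in> S2 \<Longrightarrow> F x = f x"
    using assms unfolding smooth_S2_def by blast
  have 1: "Ck_on (Suc 0) U F" by (rule U(3))
  have "C1_near_S2 F (\<lambda>x. frechet_derivative F (at x))"
    unfolding C1_near_S2_def
  proof (intro conjI exI[of _ U] ballI allI)
    show "(F has_derivative frechet_derivative F (at x)) (at x)" if "x \<in> U" for x
      using 1 that frechet_derivative_works[of F "at x"] by simp
    show "continuous_on S2 (\<lambda>x. frechet_derivative F (at x) v)" for v
      by (rule continuous_on_subset[of U]) (use 1 U(2) in auto)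
  qed (use U in auto)
  with that U(4) show ?thesis by metis
qed

lemma div_S2_cong_C1:
  assumes F: "C1_near_S2 F F'" and eq: "\<And>y. y \<in> S2 \<Longrightarrow> X y = F y" and x: "x \<in> S2"
  shows "div_S2 X x = div_S2 F x"
  using div_S2_eq[OF x C1_near_S2_deriv[OF F x] eq] div_S2_C1[OF F x] by simp

section \<open>Zonal functions\<close>

text \<open>The gradient on the sphere of the height x . \<omega>.\<close>

definition meridional :: "real^3 \<Rightarrow> real^3 \<Rightarrow> real^3" where
  "meridional \<omega> x = \<omega> - (x \<bullet> \<omega>) *\<^sub>R x"

lemma inner_S2_bound: "x \<in> S2 \<Longrightarrow> \<omega> \<in> S2 \<Longrightarrow> x \<bullet> \<omega> \<in> {-1..1}"
  using Cauchy_Schwarz_ineq2[of x \<omega>] by (auto simp: abs_le_iff)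

lemma meridional_tangent: "x \<in> S2 \<Longrightarrow> meridional \<omega> x \<bullet> x = 0"
  by (simp add: meridional_def inner_diff_left dot_square_norm inner_commute[of x \<omega>])

lemma meridional_C1:
  "C1_near_S2 (meridional \<omega>) (\<lambda>x v. - ((x \<bullet> \<omega>) *\<^sub>R v + (v \<bullet> \<omega>) *\<^sub>R x))"
  unfolding C1_near_S2_def
proof (intro conjI exI[of _ UNIV] ballI allI)
  fix x
  have "((\<lambda>x. \<omega> - (x \<bullet> \<omega>) *\<^sub>R x) has_derivative (\<lambda>v. 0 - ((x \<bullet> \<omega>) *\<^sub>R v + (v \<bullet> \<omega>) *\<^sub>R x))) (at x)"
    by (intro has_derivative_diff has_derivative_const has_derivative_scaleR has_derivative_ident
        has_derivative_inner_left)
  then show "(meridional \<omega> has_derivative (\<lambda>v. - ((x \<bullet> \<omega>) *\<^sub>R v + (v \<bullet> \<omega>) *\<^sub>R x))) (at x)"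
    by (simp add: meridional_def[abs_def])
qed (auto intro!: continuous_intros)

lemma div_meridional: "x \<in> S2 \<Longrightarrow> div_S2 (meridional \<omega>) x = - 2 * (x \<bullet> \<omega>)"
proof -
  assume x: "x \<in> S2"
  have xx: "x \<bullet> x = 1" using x by (simp add: dot_square_norm)
  have "(\<Sum>b\<in>Basis. - ((x \<bullet> \<omega>) *\<^sub>R b + (b \<bullet> \<omega>) *\<^sub>R x) \<bullet> b) =
      - ((x \<bullet> \<omega>) * (\<Sum>b\<in>(Basis::(real^3) set). b \<bullet> b)) - (\<Sum>b\<in>Basis. (x \<bullet> b) * (\<omega> \<bullet> b))"
  proof -
    have "- ((x \<bullet> \<omega>) *\<^sub>R b + (b \<bullet> \<omega>) *\<^sub>R x) \<bullet> b = - ((x \<bullet> \<omega>) * (b \<bullet> b)) - (x \<bullet> b) * (\<omega> \<bullet> b)" for b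
      by (simp add: inner_add_left inner_diff_left inner_commute[of b \<omega>])
    then show ?thesis by (simp only: sum_subtractf sum_negf sum_distrib_left)
  qed
  also have "(\<Sum>b\<in>(Basis::(real^3) set). b \<bullet> b) = 3" by simp
  also have "(\<Sum>b\<in>Basis. (x \<bullet> b) * (\<omega> \<bullet> b)) = x \<bullet> \<omega>" by (rule euclidean_inner[symmetric])
  finally have "(\<Sum>b\<in>Basis. - ((x \<bullet> \<omega>) *\<^sub>R b + (b \<bullet> \<omega>) *\<^sub>R x) \<bullet> b) = - (x \<bullet> \<omega> * 3) - x \<bullet> \<omega>" .
  moreover have "- ((x \<bullet> \<omega>) *\<^sub>R x + (x \<bullet> \<omega>) *\<^sub>R x) \<bullet> x = - 2 * (x \<bullet> \<omega>)"
    by (simp only: inner_minus_left inner_add_left inner_scaleR_left xx mult_1_right)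
  ultimately show ?thesis
    unfolding div_S2_C1[OF meridional_C1 x] by simp
qed

definition zpoly :: "real poly \<Rightarrow> real^3 \<Rightarrow> real^3 \<Rightarrow> real" where
  "zpoly P \<omega> x = poly P (x \<bullet> \<omega>)"

text \<open>On zonal functions the Laplace--Beltrami operator is the Legendre operator.\<close>

definition legendre :: "real poly \<Rightarrow> real poly" where
  "legendre R = pderiv ([:1, 0, -1:] * R)"

lemma poly_legendre: "poly (legendre R) z = (1 - z\<^sup>2) * poly (pderiv R) z - 2 * z * poly R z"
proof -
  have "legendre R = [:1, 0, -1:] * pderiv R + R * pderiv [:1, 0, -1:]"
    unfolding legendre_def by (rule pderiv_mult)
  then show ?thesis by (simp add: pderiv_pCons power2_eq_square algebra_simps)
qed

lemma zpoly_has_derivative: "(zpoly P \<omega> has_derivative (\<lambda>v. zpoly (pderiv P) \<omega> x * (v \<bullet> \<omega>))) (at x)"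
proof -
  have "((\<lambda>x. x \<bullet> \<omega>) has_derivative (\<lambda>v. v \<bullet> \<omega>)) (at x)" by (intro has_derivative_inner_left has_derivative_ident)
  from has_derivative_compose[OF this, of "poly P" "\<lambda>t. poly (pderiv P) (x \<bullet> \<omega>) * t"]
  show ?thesis
    using poly_DERIV[of P "x \<bullet> \<omega>"] by (simp add: zpoly_def[abs_def] has_field_derivative_def)
qed

lemma zpoly_C1: "C1_near_S2 (zpoly P \<omega>) (\<lambda>x v. zpoly (pderiv P) \<omega> x * (v \<bullet> \<omega>))"
  unfolding C1_near_S2_def
proof (intro conjI exI[of _ UNIV] ballI allI zpoly_has_derivative)
  show "continuous_on S2 (\<lambda>x. zpoly (pderiv P) \<omega> x * (v \<bullet> \<omega>))" for v
    by (intro continuous_intros has_derivative_continuous_on[OF has_derivative_at_withinI[OF zpoly_has_derivative]])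
qed auto

lemma zpoly_smooth: "smooth_S2 (zpoly P \<omega>)"
proof -
  have "Ck_on k UNIV (zpoly P \<omega>)" for k
  proof (induction k arbitrary: P)
    case 0
    show ?case
      using has_derivative_continuous_on[OF has_derivative_at_withinI[OF zpoly_has_derivative]] by simp
  next
    case (Suc k)
    \<comment> \<open>A directional derivative of a zonal polynomial is again a zonal polynomial,
      with the direction entering only through a scalar factor; this closes the induction.\<close>
    have *: "frechet_derivative (zpoly P \<omega>) (at x) v = zpoly (smult (v \<bullet> \<omega>) (pderiv P)) \<omega> x" for x v
      using frechet_derivative_at[OF zpoly_has_derivative[of P \<omega> x], symmetric]
      by (simp add: zpoly_def mult.commute)
    then show ?case
    proof -
      have "zpoly P \<omega> differentiable (at x)" for x
        unfolding differentiable_def using zpoly_has_derivative by blast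
      with * Suc.IH show ?thesis by simp
    qed
  qed
  then show ?thesis unfolding smooth_S2_def by blast
qed

lemma div_zpoly_meridional:
  assumes x: "x \<in> S2" and \<omega>: "\<omega> \<in> S2"
  shows "div_S2 (\<lambda>x. zpoly R \<omega> x *\<^sub>R meridional \<omega> x) x = zpoly (legendre R) \<omega> x"
proof -
  have "\<omega> \<bullet> \<omega> = 1" using \<omega> by (simp add: dot_square_norm)
  then have "meridional \<omega> x \<bullet> \<omega> = 1 - (x \<bullet> \<omega>)\<^sup>2"
    by (simp add: meridional_def inner_diff_left power2_eq_square)
  then show ?thesis
    unfolding div_S2_scaleR[OF zpoly_C1 meridional_C1 x meridional_tangent[OF x]] div_meridional[OF x]
    by (simp add: zpoly_def poly_legendre)
qed

lemma laplace_zpoly: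
  assumes x: "x \<in> S2" and \<omega>: "\<omega> \<in> S2"
  shows "laplace_S2 (zpoly P \<omega>) x = zpoly (legendre (pderiv P)) \<omega> x"
proof -
  have "grad_S2 (zpoly P \<omega>) y = zpoly (pderiv P) \<omega> y *\<^sub>R meridional \<omega> y" if y: "y \<in> S2" for y
  proof -
    have "(zpoly P \<omega> has_derivative (\<lambda>w. (zpoly (pderiv P) \<omega> y *\<^sub>R \<omega>) \<bullet> w)) (at y)"
      using zpoly_has_derivative[of P \<omega> y] by (simp add: inner_commute)
    from grad_S2_eq[OF y this refl] show ?thesis
      by (simp add: meridional_def scaleR_diff_right inner_commute)
  qed
  then have "laplace_S2 (zpoly P \<omega>) x = div_S2 (\<lambda>x. zpoly (pderiv P) \<omega> x *\<^sub>R meridional \<omega> x) x"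
    unfolding laplace_S2_def
    by (intro div_S2_cong_C1[OF C1_near_S2_scaleR[OF zpoly_C1 meridional_C1] _ x]) auto
  then show ?thesis using div_zpoly_meridional[OF x \<omega>] by simp
qed

subsection \<open>Polynomial approximation\<close>

lemma poly_approx:
  fixes f :: "real \<Rightarrow> real"
  assumes "continuous_on {-1..1} f" "e > 0"
  shows "\<exists>p. \<forall>x\<in>{-1..1}. \<bar>poly p x - f x\<bar> \<le> e"
proof -
  obtain g where g: "real_polynomial_function g" "\<And>x. x \<in> {-1..1} \<Longrightarrow> \<bar>f x - g x\<bar> < e"
    using Stone_Weierstrass_real_polynomial_function[of "{-1..1}" f e] assms by auto
  obtain a n where a: "g = (\<lambda>x. \<Sum>i\<le>n. a i * x ^ i)"
    using g(1) unfolding real_polynomial_function_iff_sum by auto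
  have "\<bar>poly (\<Sum>i\<le>n. monom (a i) i) x - f x\<bar> \<le> e" if "x \<in> {-1..1}" for x
    using g(2)[OF that] unfolding a poly_sum poly_monom by (simp only: abs_minus_commute[of "f x"] less_imp_le)
  then show ?thesis by blast
qed

lemma pderiv_sum: "pderiv (sum f A) = (\<Sum>i\<in>A. pderiv (f i))"
  by (induction A rule: infinite_finite_induct) (auto simp: pderiv_add)

lemma legendre_sum: "legendre (sum f A) = (\<Sum>i\<in>A. legendre (f i))"
  by (simp add: legendre_def sum_distrib_left pderiv_sum)

lemma legendre_smult: "legendre (smult c R) = smult c (legendre R)"
  by (simp add: legendre_def pderiv_smult)

text \<open>\<open>legendre\<close> maps z^(k+1) to (k + 1) z^k - (k + 3) z^(k+2), so modulo its
  range the degree drops by two. The induction ends at the constants and at z, the image of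
  -1/2.\<close>

lemma monom_mod_legendre: "\<exists>R c. monom 1 n = [:c:] + legendre R"
proof (induction n rule: less_induct)
  case (less n)
  consider "n = 0" | "n = 1" | k where "n = Suc (Suc k)" by (metis One_nat_def old.nat.exhaust)
  then show ?case
  proof cases
    case 1
    then have "monom 1 n = [:1:] + legendre 0" by (simp add: legendre_def)
    then show ?thesis by blast
  next
    case 2
    have "monom 1 n = [:0:] + legendre [:-1/2:]"
      unfolding 2 by (simp add: legendre_def pderiv_pCons monom_altdef)
    then show ?thesis by blast
  next
    case 3
    have "k < n" using 3 by simp
    from less[OF this] obtain R c where R: "monom 1 k = [:c:] + legendre R" by blast
    have q: "[:1, 0, -1:] * monom 1 (Suc k) = monom 1 (Suc k) - monom (1::real) (Suc (Suc (Suc k)))"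
      by (simp add: monom_Suc)
    have L: "legendre (monom 1 (Suc k)) = monom (real (Suc k)) k - monom (real (k + 3)) n"
      unfolding legendre_def q pderiv_diff pderiv_monom 3 by simp
    define d where "d = real (k + 3)"
    have d: "d > 0" by (simp add: d_def)
    have "monom d n = smult (real (Suc k)) (monom 1 k) - legendre (monom 1 (Suc k))"
      unfolding L d_def smult_monom by simp
    then have "smult (1 / d) (monom d n) = smult (1 / d) (smult (real (Suc k)) ([:c:] + legendre R) - legendre (monom 1 (Suc k)))"
      unfolding R by simp
    moreover have "smult (1 / d) (monom d n) = monom 1 n" using d by (simp add: smult_monom)
    moreover have "smult (1 / d) (smult (real (Suc k)) ([:c:] + legendre R) - legendre (monom 1 (Suc k))) =
        [:1 / d * (real (Suc k) * c):] + legendre (smult (1 / d) (smult (real (Suc k)) R - monom 1 (Suc k)))"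
      by (simp add: legendre_smult smult_add_right smult_diff_right)
        (simp add: legendre_def pderiv_diff pderiv_smult right_diff_distrib smult_diff_right del: mult_pCons_left)
    ultimately show ?thesis by metis
  qed
qed

lemma poly_mod_legendre: "\<exists>R c. Q = [:c:] + legendre R"
proof -
  obtain R c where R: "\<And>n. monom 1 n = [:c n:] + legendre (R n)" using monom_mod_legendre by metis
  have "Q = (\<Sum>i\<le>degree Q. smult (coeff Q i) (monom 1 i))"
    by (simp add: smult_monom poly_as_sum_of_monoms)
  also have "\<dots> = (\<Sum>i\<le>degree Q. [:coeff Q i * c i:]) + legendre (\<Sum>i\<le>degree Q. smult (coeff Q i) (R i))"
    unfolding R by (simp add: smult_add_right sum.distrib legendre_sum legendre_smult)
  also have "(\<Sum>i\<le>degree Q. [:coeff Q i * c i:]) = [:\<Sum>i\<le>degree Q. coeff Q i * c i:]"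
  proof -
    have "(\<Sum>i\<in>A. [:g i:]) = [:\<Sum>i\<in>A. g i:]" for A and g :: "nat \<Rightarrow> real"
      by (induction A rule: infinite_finite_induct) auto
    then show ?thesis .
  qed
  finally show ?thesis by blast
qed

lemma poly_antiderivative: "\<exists>P. pderiv P = R \<and> poly P (-1) = (u::real)"
proof -
  define P0 where "P0 = (\<Sum>i\<le>degree R. monom (coeff R i / real (Suc i)) (Suc i))"
  have "pderiv P0 = (\<Sum>i\<le>degree R. monom (coeff R i) i)"
    by (simp add: P0_def pderiv_sum pderiv_monom)
  then have "pderiv (P0 + [:u - poly P0 (-1):]) = R"
    by (simp add: pderiv_add pderiv_pCons poly_as_sum_of_monoms)
  moreover have "poly (P0 + [:u - poly P0 (-1):]) (-1) = u" by simp
  ultimately show ?thesis by blast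
qed

lemma integral_legendre:
  assumes "z \<in> {-1..1}"
  shows "integral {-1..z} (poly (legendre R)) = (1 - z\<^sup>2) * poly R z"
proof -
  have "(poly (legendre R) has_integral (poly ([:1, 0, -1:] * R) z - poly ([:1, 0, -1:] * R) (-1))) {-1..z}"
    by (rule fundamental_theorem_of_calculus)
      (use assms in \<open>auto simp: legendre_def simp del: mult_pCons_left poly_mult simp flip: has_real_derivative_iff_has_vector_derivative
        intro!: DERIV_subset[OF poly_DERIV]\<close>)
  then show ?thesis by (simp add: integral_unique power2_eq_square algebra_simps del: mult_pCons_left)
qed

text \<open>The primitive of f vanishes at both ends. Integrating from the nearer end gives (1 -
  z^2) |r z| \<le> e (1 - |z|), and the remaining factor 1 + |z| is at least 1. Thus uniform bounds
  pass from f to r without loss at the poles.\<close>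

lemma quotient_bound:
  fixes f r :: "real \<Rightarrow> real"
  assumes f: "continuous_on {-1..1} f" and r: "continuous_on {-1..1} r"
    and eq: "\<And>z. z \<in> {-1..1} \<Longrightarrow> (1 - z\<^sup>2) * r z = integral {-1..z} f"
    and bd: "\<And>z. z \<in> {-1..1} \<Longrightarrow> \<bar>f z\<bar> \<le> e" and z: "z \<in> {-1..1}"
  shows "\<bar>r z\<bar> \<le> e"
proof -
  have inner: "\<bar>r z\<bar> \<le> e" if z: "z \<in> {-1<..<1}" for z
  proof -
    have sub: "continuous_on {-1..z} f" "continuous_on {z..1} f"
      by (rule continuous_on_subset[OF f]; use z in auto)+
    have tot: "integral {-1..z} f + integral {z..1} f = 0"
      using Henstock_Kurzweil_Integration.integral_combine[of "-1" z 1 f] integrable_continuous_real[OF f] eq[of 1] z by simp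
    have e0: "e \<ge> 0" using bd[of 0] by simp
    have "\<bar>integral {-1..z} f\<bar> \<le> integral {-1..z} (\<lambda>_. e)"
      by (rule abs_integral_le) (use sub z bd in auto)
    then have 1: "(1 - z) * (1 + z) * \<bar>r z\<bar> \<le> e * (1 + z)"
      using eq[of z, symmetric] z by (simp add: one_minus_square_factor abs_mult algebra_simps)
    have "\<bar>integral {z..1} f\<bar> \<le> integral {z..1} (\<lambda>_. e)"
      by (rule abs_integral_le) (use sub z bd in auto)
    moreover have "\<bar>integral {z..1} f\<bar> = \<bar>integral {-1..z} f\<bar>" using tot by linarith
    ultimately have 2: "(1 - z) * (1 + z) * \<bar>r z\<bar> \<le> e * (1 - z)"
      using eq[of z, symmetric] z by (simp add: one_minus_square_factor abs_mult algebra_simps)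
    show ?thesis
    proof (cases "z \<le> 0")
      case True
      have "(1 + z) * ((1 - z) * \<bar>r z\<bar>) \<le> (1 + z) * e" using 1 by (simp only: mult_ac)
      then have "(1 - z) * \<bar>r z\<bar> \<le> e" using z by (simp add: mult_le_cancel_left)
      moreover have "1 * \<bar>r z\<bar> \<le> (1 - z) * \<bar>r z\<bar>" using True by (intro mult_right_mono) auto
      ultimately show ?thesis by simp
    next
      case False
      have "(1 - z) * ((1 + z) * \<bar>r z\<bar>) \<le> (1 - z) * e" using 2 by (simp only: mult_ac)
      then have "(1 + z) * \<bar>r z\<bar> \<le> e" using z by (simp add: mult_le_cancel_left)
      moreover have "1 * \<bar>r z\<bar> \<le> (1 + z) * \<bar>r z\<bar>" using False by (intro mult_right_mono) auto
      ultimately show ?thesis by simp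
    qed
  qed
  have "closure {-1<..<1::real} = {-1..1}" by simp
  with z r inner show ?thesis
    using continuous_le_on_closure[of "{-1<..<1}" "\<lambda>z. \<bar>r z\<bar>" z e] by (auto intro: continuous_intros)
qed

text \<open>Approximate f by a polynomial and discard the constant supplied by
  \<open>poly_mod_legendre\<close>. That constant is the mean of the approximation error, since f
  and the range of \<open>legendre\<close> have mean zero, so it is small. Applying
  \<open>quotient_bound\<close> to the errors gives the approximation of r.\<close>

lemma legendre_approx:
  fixes f r :: "real \<Rightarrow> real"
  assumes f: "continuous_on {-1..1} f" and r: "continuous_on {-1..1} r"
    and eq: "\<And>z. z \<in> {-1..1} \<Longrightarrow> (1 - z\<^sup>2) * r z = integral {-1..z} f" and e: "e > 0"
  shows "\<exists>R. \<forall>z\<in>{-1..1}. \<bar>poly R z - r z\<bar> \<le> e \<and> \<bar>poly (legendre R) z - f z\<bar> \<le> e"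
proof -
  have "e / 2 > 0" using e by simp
  from poly_approx[OF f this] obtain Q where Q: "\<And>z. z \<in> {-1..1} \<Longrightarrow> \<bar>poly Q z - f z\<bar> \<le> e / 2"
    by blast
  obtain R c where R: "Q = [:c:] + legendre R" using poly_mod_legendre by blast
  have L: "poly (legendre R) z = poly Q z - c" for z by (simp add: R)
  have ic: "continuous_on {-1..1} (poly p)" for p :: "real poly" by (intro continuous_intros)
  have "integral {-1..1} (\<lambda>z. poly Q z - f z) = 2 * c"
  proof -
    have "integral {-1..1} (\<lambda>z. poly (legendre R) z + c - f z) =
        integral {-1..1} (poly (legendre R)) + 2 * c - integral {-1..1} f"
    proof -
      have i: "poly (legendre R) integrable_on {-1..1}" "f integrable_on {-1..1}" "(\<lambda>_. c) integrable_on {-1..1::real}"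
        by (intro integrable_continuous_real ic f continuous_on_const)+
      show ?thesis
        unfolding Henstock_Kurzweil_Integration.integral_diff[OF integrable_add[OF i(1,3)] i(2)]
          Henstock_Kurzweil_Integration.integral_add[OF i(1,3)] by simp
    qed
    then show ?thesis using integral_legendre[of 1 R] eq[of 1] by (simp add: L)
  qed
  moreover have "\<bar>integral {-1..1} (\<lambda>z. poly Q z - f z)\<bar> \<le> integral {-1..1} (\<lambda>_::real. e / 2)"
    by (rule abs_integral_le) (use Q in \<open>auto intro!: continuous_intros f\<close>)
  ultimately have c: "\<bar>c\<bar> \<le> e / 2" by simp
  have A: "\<bar>poly (legendre R) z - f z\<bar> \<le> e" if "z \<in> {-1..1}" for z
    unfolding L using Q[OF that] c by arith
  have "\<bar>poly R z - r z\<bar> \<le> e" if z: "z \<in> {-1..1}" for z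
  proof (rule quotient_bound[OF _ _ _ A z])
    fix x :: real assume x: "x \<in> {-1..1}"
    have "integral {-1..x} (\<lambda>z. poly (legendre R) z - f z) = integral {-1..x} (poly (legendre R)) - integral {-1..x} f"
      by (intro Henstock_Kurzweil_Integration.integral_diff integrable_continuous_real continuous_on_subset[OF f]
          continuous_on_subset[OF ic]) (use x in auto)
    then show "(1 - x\<^sup>2) * (poly R x - r x) = integral {-1..x} (\<lambda>z. poly (legendre R) z - f z)"
      using integral_legendre[OF x] eq[OF x] by (simp add: right_diff_distrib)
  qed (auto intro!: continuous_intros f r)
  with A show ?thesis by blast
qed

text \<open>At each end the quotient is, up to a regular factor, a difference quotient of the
  primitive of f, which is differentiable there and vanishes. The two expressions are glued at 0,
  where they agree.\<close>

lemma legendre_quotient_exists: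
  fixes f :: "real \<Rightarrow> real"
  assumes f: "continuous_on {-1..1} f" and "integral {-1..1} f = 0"
  shows "\<exists>r. continuous_on {-1..1} r \<and> (\<forall>z\<in>{-1..1}. (1 - z\<^sup>2) * r z = integral {-1..z} f)"
proof -
  define q where "q = (\<lambda>z. integral {-1..z} f)"
  have qc: "continuous_on {-1..1} q"
    unfolding q_def by (intro indefinite_integral_continuous_1 integrable_continuous_real f)
  have qd: "(q has_real_derivative f z) (at z within {-1..1})" if "z \<in> {-1..1}" for z
    unfolding q_def by (rule integral_has_real_derivative[OF f that])
  define q1 where "q1 = (\<lambda>s. if s = -1 then f (-1) else (q s - q (-1)) / (s - (-1)))"
  define q2 where "q2 = (\<lambda>s. if s = 1 then f 1 else (q s - q 1) / (s - 1))"
  have c: "continuous_on {-1..1} q1" "continuous_on {-1..1} q2"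
    unfolding q1_def q2_def by (rule continuous_on_difference_quotient[OF qc]; use qd in simp)+
  have q0: "q (-1) = 0" "q 1 = 0" using assms by (simp_all add: q_def)
  have q1_0: "q1 0 = q 0" and q2_0: "q2 0 = - q 0" by (simp_all add: q1_def q2_def q0)
  define r where "r = (\<lambda>z. if z \<le> 0 then q1 z / (1 - z) else - q2 z / (1 + z))"
  have "continuous_on ({-1..0} \<union> {0..1}) r"
    unfolding r_def
    by (rule continuous_on_cases)
      (auto intro!: continuous_intros continuous_on_subset[OF c(1)] continuous_on_subset[OF c(2)]
        simp: q1_0 q2_0)
  moreover have "{-1..0} \<union> {0..1} = {-1..1::real}" by auto
  ultimately have "continuous_on {-1..1} r" by simp
  moreover have "(1 - z\<^sup>2) * r z = q z" if z: "z \<in> {-1..1}" for z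
  proof -
    show ?thesis
    proof (cases "z = 1 \<or> z = -1")
      case True then show ?thesis using q0 by auto
    next
      case False
      then have "1 - z > 0" "1 + z > 0" "z - 1 \<noteq> 0" using z by auto
      moreover have "q z / (z - 1) = - (q z / (1 - z))" by (metis minus_diff_eq minus_divide_right)
      ultimately show ?thesis using False by (auto simp: one_minus_square_factor r_def q1_def q2_def q0 add.commute)
    qed
  qed
  ultimately show ?thesis unfolding q_def by blast
qed

section \<open>Weak identities for zonal functions\<close>

lemma continuous_on_zonal:
  assumes "continuous_on {-1..1} f" "\<omega> \<in> S2"
  shows "continuous_on S2 (\<lambda>x. f (x \<bullet> \<omega>))"
  by (rule continuous_on_compose2[OF assms(1)])
    (use inner_S2_bound[OF _ assms(2)] in \<open>auto intro!: continuous_intros\<close>)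

lemma continuous_on_zpoly: "continuous_on S2 (zpoly P \<omega>)"
  by (rule C1_near_S2_cont[OF zpoly_C1])

lemma continuous_on_meridional: "continuous_on S2 (meridional \<omega>)"
  by (rule C1_near_S2_cont[OF meridional_C1])

lemma eq_0_if_small:
  fixes A C :: real
  assumes "\<And>e. e > 0 \<Longrightarrow> \<bar>A\<bar> \<le> e * C"
  shows "A = 0"
proof (rule ccontr)
  assume "A \<noteq> 0"
  define e where "e = \<bar>A\<bar> / (2 * (\<bar>C\<bar> + 1))"
  have e: "e > 0" using \<open>A \<noteq> 0\<close> by (simp add: e_def)
  have "\<bar>A\<bar> \<le> e * C" by (rule assms[OF e])
  also have "\<dots> \<le> e * (\<bar>C\<bar> + 1)" using e by (intro mult_left_mono) auto
  also have "\<dots> = \<bar>A\<bar> / 2" by (simp add: e_def field_simps)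
  finally show False using \<open>A \<noteq> 0\<close> by simp
qed

lemma integral_S2_diff_bound:
  fixes f g h :: "real^3 \<Rightarrow> real"
  assumes c: "continuous_on S2 f" "continuous_on S2 g" "continuous_on S2 h"
    and fg: "\<And>x. x \<in> S2 \<Longrightarrow> \<bar>f x - g x\<bar> \<le> e" and h: "\<And>x. x \<in> S2 \<Longrightarrow> \<bar>h x\<bar> \<le> C"
  shows "\<bar>(\<integral>x. f x * h x \<partial>area_S2) - (\<integral>x. g x * h x \<partial>area_S2)\<bar> \<le> 4 * pi * (e * C)"
proof -
  have i: "integrable area_S2 (\<lambda>x. f x * h x)" "integrable area_S2 (\<lambda>x. g x * h x)"
    by (intro continuous_on_integrable_S2 continuous_intros c)+
  have "(\<integral>x. f x * h x \<partial>area_S2) - (\<integral>x. g x * h x \<partial>area_S2) = (\<integral>x. f x * h x - g x * h x \<partial>area_S2)"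
    by (rule Bochner_Integration.integral_diff[OF i, symmetric])
  also have "\<bar>\<dots>\<bar> \<le> 4 * pi * (e * C)"
  proof (rule abs_integral_S2_le)
    fix x assume x: "x \<in> S2"
    have "\<bar>f x * h x - g x * h x\<bar> = \<bar>f x - g x\<bar> * \<bar>h x\<bar>" by (simp add: abs_mult flip: left_diff_distrib)
    also have "\<dots> \<le> e * C" using fg[OF x] h[OF x] by (intro mult_mono) auto
    finally show "\<bar>f x * h x - g x * h x\<bar> \<le> e * C" .
  qed (use i in auto)
  finally show ?thesis .
qed

text \<open>The weak form of the statement that r (x . \<omega>) times the meridional field has
  divergence f (x . \<omega>), although this field need not be differentiable. For polynomials it is
  classical integration by parts, and both sides are stable under the approximation of
  \<open>legendre_approx\<close>.\<close>

lemma zonal_weak_identity: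
  fixes f r :: "real \<Rightarrow> real"
  assumes f: "continuous_on {-1..1} f" and r: "continuous_on {-1..1} r"
    and eq: "\<And>z. z \<in> {-1..1} \<Longrightarrow> (1 - z\<^sup>2) * r z = integral {-1..z} f"
    and \<phi>: "C1_near_S2 \<phi> \<phi>'" and \<omega>: "\<omega> \<in> S2"
  shows "(\<integral>x. r (x \<bullet> \<omega>) * \<phi>' x (meridional \<omega> x) \<partial>area_S2) = - (\<integral>x. f (x \<bullet> \<omega>) * \<phi> x \<partial>area_S2)"
proof -
  have c: "continuous_on S2 \<phi>" "continuous_on S2 (\<lambda>x. \<phi>' x (meridional \<omega> x))"
    by (rule C1_near_S2_cont[OF \<phi>] C1_near_S2_cont_deriv[OF \<phi> continuous_on_meridional])+
  obtain C1 where C1: "\<And>x. x \<in> S2 \<Longrightarrow> \<bar>\<phi> x\<bar> \<le> C1"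
    using continuous_on_S2_bounded[OF c(1)] by (metis real_norm_def)
  obtain C2 where C2: "\<And>x. x \<in> S2 \<Longrightarrow> \<bar>\<phi>' x (meridional \<omega> x)\<bar> \<le> C2"
    using continuous_on_S2_bounded[OF c(2)] by (metis real_norm_def)
  let ?A = "\<integral>x. r (x \<bullet> \<omega>) * \<phi>' x (meridional \<omega> x) \<partial>area_S2"
  let ?B = "\<integral>x. f (x \<bullet> \<omega>) * \<phi> x \<partial>area_S2"
  have "?A + ?B = 0"
  proof (rule eq_0_if_small)
    fix e :: real assume "e > 0"
    from legendre_approx[OF f r eq this] obtain R where
      R: "\<And>z. z \<in> {-1..1} \<Longrightarrow> \<bar>poly R z - r z\<bar> \<le> e" "\<And>z. z \<in> {-1..1} \<Longrightarrow> \<bar>poly (legendre R) z - f z\<bar> \<le> e"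
      by blast
    have "(\<integral>x. zpoly (legendre R) \<omega> x * \<phi> x \<partial>area_S2) =
        (\<integral>x. \<phi> x * div_S2 (\<lambda>x. zpoly R \<omega> x *\<^sub>R meridional \<omega> x) x \<partial>area_S2)"
      by (rule integral_cong_S2) (use div_zpoly_meridional[OF _ \<omega>] in simp)
    also have "\<dots> = - (\<integral>x. \<phi>' x (zpoly R \<omega> x *\<^sub>R meridional \<omega> x) \<partial>area_S2)"
      by (rule integral_by_parts_S2[OF \<phi> C1_near_S2_scaleR[OF zpoly_C1 meridional_C1]])
        (use meridional_tangent in simp)
    also have "(\<integral>x. \<phi>' x (zpoly R \<omega> x *\<^sub>R meridional \<omega> x) \<partial>area_S2) =
        (\<integral>x. zpoly R \<omega> x * \<phi>' x (meridional \<omega> x) \<partial>area_S2)"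
      by (rule integral_cong_S2) (use linear_scale[OF C1_near_S2_linear[OF \<phi>]] in simp)
    finally have id: "(\<integral>x. zpoly (legendre R) \<omega> x * \<phi> x \<partial>area_S2) =
        - (\<integral>x. zpoly R \<omega> x * \<phi>' x (meridional \<omega> x) \<partial>area_S2)" .
    have "\<bar>(\<integral>x. zpoly R \<omega> x * \<phi>' x (meridional \<omega> x) \<partial>area_S2) - ?A\<bar> \<le> 4 * pi * (e * C2)"
      by (rule integral_S2_diff_bound[OF continuous_on_zpoly continuous_on_zonal[OF r \<omega>] c(2) _ C2])
        (use R(1) inner_S2_bound[OF _ \<omega>] in \<open>simp add: zpoly_def\<close>)
    moreover have "\<bar>(\<integral>x. zpoly (legendre R) \<omega> x * \<phi> x \<partial>area_S2) - ?B\<bar> \<le> 4 * pi * (e * C1)"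
      by (rule integral_S2_diff_bound[OF continuous_on_zpoly continuous_on_zonal[OF f \<omega>] c(1) _ C1])
        (use R(2) inner_S2_bound[OF _ \<omega>] in \<open>simp add: zpoly_def\<close>)
    ultimately have "\<bar>?A + ?B\<bar> \<le> 4 * pi * (e * C2) + 4 * pi * (e * C1)" using id by linarith
    then show "\<bar>?A + ?B\<bar> \<le> e * (4 * pi * (C1 + C2))" by (simp add: algebra_simps)
  qed
  then show ?thesis by simp
qed

lemma C1_near_S2_const: "C1_near_S2 (\<lambda>_. c) (\<lambda>_ _. 0)"
  unfolding C1_near_S2_def by (auto intro: exI[of _ UNIV])

text \<open>Archimedes' theorem that the height is uniformly distributed. After subtraction of its
  mean, f is the divergence of a field in the weak sense, and testing with the constant 1 makes the
  integral vanish.\<close>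

lemma integral_zonal:
  assumes f: "continuous_on {-1..1} f" and \<omega>: "\<omega> \<in> S2"
  shows "(\<integral>x. f (x \<bullet> \<omega>) \<partial>area_S2) = 2 * pi * integral {-1..1} f"
proof -
  define c where "c = integral {-1..1} f / 2"
  let ?g = "\<lambda>z. f z - c"
  have g: "continuous_on {-1..1} ?g" by (intro continuous_intros f)
  have "integral {-1..1} ?g = 0"
    unfolding Henstock_Kurzweil_Integration.integral_diff[OF integrable_continuous_real[OF f] integrable_const_ivl]
    by (simp add: c_def)
  from legendre_quotient_exists[OF g this] obtain r where
    r: "continuous_on {-1..1} r" "\<And>z. z \<in> {-1..1} \<Longrightarrow> (1 - z\<^sup>2) * r z = integral {-1..z} ?g" by blast
  from zonal_weak_identity[OF g r C1_near_S2_const[of 1] \<omega>]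
  have "(\<integral>x. f (x \<bullet> \<omega>) - c \<partial>area_S2) = 0" by simp
  moreover have "(\<integral>x. f (x \<bullet> \<omega>) - c \<partial>area_S2) = (\<integral>x. f (x \<bullet> \<omega>) \<partial>area_S2) - (\<integral>x. c \<partial>area_S2)"
    by (intro Bochner_Integration.integral_diff continuous_on_integrable_S2 continuous_on_zonal f \<omega> continuous_on_const)
  ultimately show ?thesis by (simp add: integral_area_S2_const c_def del: lebesgue_integral_const)
qed

lemma antiderivative_approx:
  fixes U r :: "real \<Rightarrow> real"
  assumes U: "continuous_on {-1..1} U" and U': "\<And>z. z \<in> {-1<..<1} \<Longrightarrow> (U has_real_derivative r z) (at z)"
    and R: "\<And>z. z \<in> {-1..1} \<Longrightarrow> \<bar>poly R z - r z\<bar> \<le> e"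
  shows "\<exists>P. pderiv P = R \<and> (\<forall>z\<in>{-1..1}. \<bar>poly P z - U z\<bar> \<le> 2 * e)"
proof -
  obtain P where P: "pderiv P = R" "poly P (-1) = U (-1)" using poly_antiderivative by blast
  have e: "e \<ge> 0" using R[of 0] by simp
  have "\<bar>poly P z - U z\<bar> \<le> 2 * e" if z: "z \<in> {-1..1}" for z
  proof (cases "z = -1")
    case True then show ?thesis using P e by simp
  next
    case False
    then have "-1 < z" using z by simp
    have d: "((\<lambda>z. poly P z - U z) has_real_derivative poly R x - r x) (at x)" if "-1 < x" "x < z" for x
      using U'[of x] poly_DERIV[of P x] P that z by (auto intro!: DERIV_diff)
    have "continuous_on {-1..z} (\<lambda>z. poly P z - U z)"
      by (intro continuous_intros continuous_on_subset[OF U]) (use z in auto)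
    from MVT[OF \<open>-1 < z\<close> this] obtain l x where
      x: "-1 < x" "x < z" "((\<lambda>z. poly P z - U z) has_real_derivative l) (at x)"
        "(poly P z - U z) - (poly P (-1) - U (-1)) = (z - (-1)) * l"
      using d real_differentiable_def by blast
    have "l = poly R x - r x" by (rule DERIV_unique[OF x(3) d[OF x(1,2)]])
    then have "\<bar>poly P z - U z\<bar> = (z + 1) * \<bar>poly R x - r x\<bar>"
      using x(4) P z by (simp add: abs_mult)
    also have "\<dots> \<le> 2 * e" using R[of x] x z by (intro mult_mono) auto
    finally show ?thesis .
  qed
  then show ?thesis using P(1) by blast
qed

lemma zonal_weak_gradient:
  fixes U r :: "real \<Rightarrow> real"
  assumes U: "continuous_on {-1..1} U" and r: "continuous_on {-1..1} r"
    and U': "\<And>z. z \<in> {-1<..<1} \<Longrightarrow> (U has_real_derivative r z) (at z)"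
    and X: "C1_near_S2 X X'" and tan: "\<And>x. x \<in> S2 \<Longrightarrow> X x \<bullet> x = 0" and \<omega>: "\<omega> \<in> S2"
  shows "(\<integral>x. U (x \<bullet> \<omega>) * div_S2 X x \<partial>area_S2) = - (\<integral>x. r (x \<bullet> \<omega>) * (X x \<bullet> \<omega>) \<partial>area_S2)"
proof -
  have c: "continuous_on S2 (div_S2 X)" "continuous_on S2 (\<lambda>x. X x \<bullet> \<omega>)"
    by (intro continuous_intros continuous_on_div_S2[OF X] C1_near_S2_cont[OF X])+
  obtain C1 where C1: "\<And>x. x \<in> S2 \<Longrightarrow> \<bar>div_S2 X x\<bar> \<le> C1"
    using continuous_on_S2_bounded[OF c(1)] by (metis real_norm_def)
  obtain C2 where C2: "\<And>x. x \<in> S2 \<Longrightarrow> \<bar>X x \<bullet> \<omega>\<bar> \<le> C2"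
    using continuous_on_S2_bounded[OF c(2)] by (metis real_norm_def)
  let ?A = "\<integral>x. U (x \<bullet> \<omega>) * div_S2 X x \<partial>area_S2"
  let ?B = "\<integral>x. r (x \<bullet> \<omega>) * (X x \<bullet> \<omega>) \<partial>area_S2"
  have "?A + ?B = 0"
  proof (rule eq_0_if_small)
    fix e :: real assume e: "e > 0"
    from poly_approx[OF r this] obtain R where
      R: "\<And>z. z \<in> {-1..1} \<Longrightarrow> \<bar>poly R z - r z\<bar> \<le> e" by blast
    from antiderivative_approx[OF U U' R] obtain P where
      P: "pderiv P = R" "\<And>z. z \<in> {-1..1} \<Longrightarrow> \<bar>poly P z - U z\<bar> \<le> 2 * e" by blast
    have id: "(\<integral>x. zpoly P \<omega> x * div_S2 X x \<partial>area_S2) = - (\<integral>x. zpoly R \<omega> x * (X x \<bullet> \<omega>) \<partial>area_S2)"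
      using integral_by_parts_S2[OF zpoly_C1 X tan, of P \<omega>] P(1) by simp
    have "\<bar>(\<integral>x. zpoly P \<omega> x * div_S2 X x \<partial>area_S2) - ?A\<bar> \<le> 4 * pi * (2 * e * C1)"
      by (rule integral_S2_diff_bound[OF continuous_on_zpoly continuous_on_zonal[OF U \<omega>] c(1) _ C1])
        (use P(2) inner_S2_bound[OF _ \<omega>] in \<open>simp add: zpoly_def\<close>)
    moreover have "\<bar>(\<integral>x. zpoly R \<omega> x * (X x \<bullet> \<omega>) \<partial>area_S2) - ?B\<bar> \<le> 4 * pi * (e * C2)"
      by (rule integral_S2_diff_bound[OF continuous_on_zpoly continuous_on_zonal[OF r \<omega>] c(2) _ C2])
        (use R inner_S2_bound[OF _ \<omega>] in \<open>simp add: zpoly_def\<close>)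
    ultimately have "\<bar>?A + ?B\<bar> \<le> 4 * pi * (2 * e * C1) + 4 * pi * (e * C2)" using id by linarith
    then show "\<bar>?A + ?B\<bar> \<le> e * (4 * pi * (2 * C1 + C2))" by (simp add: algebra_simps)
  qed
  then show ?thesis by simp
qed

section \<open>Green's function\<close>

lemma integrable_mult_continuous_S2:
  fixes g f :: "real^3 \<Rightarrow> real"
  assumes g: "integrable area_S2 g" and f: "continuous_on S2 f"
  shows "integrable area_S2 (\<lambda>x. g x * f x)"
proof -
  obtain C where C: "C > 0" "\<And>x. x \<in> S2 \<Longrightarrow> norm (f x) \<le> C" using continuous_on_S2_bounded[OF f] by blast
  have fm: "f \<in> borel_measurable area_S2" by (rule continuous_on_measurable_S2[OF f])
  have gm: "g \<in> borel_measurable area_S2" using g by simp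
  show ?thesis
  proof (rule Bochner_Integration.integrable_bound[OF integrable_mult_left[OF g, of C]])
    show "AE x in area_S2. norm (g x * f x) \<le> norm (g x * C)"
      by (rule AE_S2_I) (use C in \<open>auto simp: abs_mult intro!: mult_left_mono\<close>)
  qed (use fm gm in measurable)
qed

text \<open>In the weak sense f (y . \<omega>) is the Laplacian of U (y . \<omega>), so this is
  Green's representation for functions less regular than the test functions in
  \<open>is_green_S2\<close>. Taking the difference of two poles cancels the mean of the test
  function.\<close>

lemma green_zonal:
  fixes f r U :: "real \<Rightarrow> real"
  assumes G: "is_green_S2 G"
    and f: "continuous_on {-1..1} f" and r: "continuous_on {-1..1} r"
    and eq: "\<And>z. z \<in> {-1..1} \<Longrightarrow> (1 - z\<^sup>2) * r z = integral {-1..z} f"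
    and U: "continuous_on {-1..1} U" and U': "\<And>z. z \<in> {-1<..<1} \<Longrightarrow> (U has_real_derivative r z) (at z)"
    and x: "x \<in> S2" "x0 \<in> S2" and \<omega>: "\<omega> \<in> S2"
  shows "(\<integral>y. (G x y - G x0 y) * f (y \<bullet> \<omega>) \<partial>area_S2) = - (U (x \<bullet> \<omega>) - U (x0 \<bullet> \<omega>))"
proof -
  have Gi: "integrable area_S2 (G x)" "integrable area_S2 (G x0)"
    using G x unfolding is_green_S2_def by blast+
  define g where "g = (\<lambda>y. G x y - G x0 y)"
  have gi: "integrable area_S2 g" unfolding g_def by (intro Bochner_Integration.integrable_diff Gi)
  let ?A = "\<integral>y. g y * f (y \<bullet> \<omega>) \<partial>area_S2"
  define M where "M = (\<integral>y. \<bar>g y\<bar> \<partial>area_S2)"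
  have "?A + (U (x \<bullet> \<omega>) - U (x0 \<bullet> \<omega>)) = 0"
  proof (rule eq_0_if_small)
    fix e :: real assume e: "e > 0"
    from legendre_approx[OF f r eq this] obtain R where
      R: "\<And>z. z \<in> {-1..1} \<Longrightarrow> \<bar>poly R z - r z\<bar> \<le> e" "\<And>z. z \<in> {-1..1} \<Longrightarrow> \<bar>poly (legendre R) z - f z\<bar> \<le> e"
      by blast
    from antiderivative_approx[OF U U' R(1)] obtain P where
      P: "pderiv P = R" "\<And>z. z \<in> {-1..1} \<Longrightarrow> \<bar>poly P z - U z\<bar> \<le> 2 * e" by blast
    let ?L = "zpoly (legendre R) \<omega>"
    have test: "(\<integral>y. G x' y * ?L y \<partial>area_S2) = - (zpoly P \<omega> x' - 1 / (4 * pi) * (\<integral>y. zpoly P \<omega> y \<partial>area_S2))"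
      if x': "x' \<in> S2" for x'
    proof -
      have "(\<integral>y. G x' y * (- laplace_S2 (zpoly P \<omega>) y) \<partial>area_S2) =
          zpoly P \<omega> x' - 1 / (4 * pi) * (\<integral>y. zpoly P \<omega> y \<partial>area_S2)"
        using G x' zpoly_smooth unfolding is_green_S2_def by blast
      moreover have "(\<integral>y. G x' y * (- laplace_S2 (zpoly P \<omega>) y) \<partial>area_S2) = (\<integral>y. - (G x' y * ?L y) \<partial>area_S2)"
        by (rule integral_cong_S2) (simp add: laplace_zpoly[OF _ \<omega>] P(1))
      ultimately show ?thesis by simp
    qed
    have i: "integrable area_S2 (\<lambda>y. G x y * ?L y)" "integrable area_S2 (\<lambda>y. G x0 y * ?L y)"
      "integrable area_S2 (\<lambda>y. g y * ?L y)" "integrable area_S2 (\<lambda>y. g y * f (y \<bullet> \<omega>))"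
      by (intro integrable_mult_continuous_S2 Gi gi continuous_on_zpoly continuous_on_zonal f \<omega>)+
    have "(\<integral>y. g y * ?L y \<partial>area_S2) = (\<integral>y. G x y * ?L y \<partial>area_S2) - (\<integral>y. G x0 y * ?L y \<partial>area_S2)"
      unfolding g_def left_diff_distrib by (rule Bochner_Integration.integral_diff[OF i(1,2)])
    then have id: "(\<integral>y. g y * ?L y \<partial>area_S2) = - (zpoly P \<omega> x - zpoly P \<omega> x0)"
      unfolding test[OF x(1)] test[OF x(2)] by simp
    have "(\<integral>y. g y * ?L y \<partial>area_S2) - ?A = (\<integral>y. g y * ?L y - g y * f (y \<bullet> \<omega>) \<partial>area_S2)"
      by (rule Bochner_Integration.integral_diff[OF i(3,4), symmetric])
    also have "\<bar>\<dots>\<bar> \<le> (\<integral>y. e * \<bar>g y\<bar> \<partial>area_S2)"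
    proof -
      have "\<bar>\<integral>y. g y * ?L y - g y * f (y \<bullet> \<omega>) \<partial>area_S2\<bar> \<le> (\<integral>y. \<bar>g y * ?L y - g y * f (y \<bullet> \<omega>)\<bar> \<partial>area_S2)"
        by (rule integral_abs_bound)
      also have "\<dots> \<le> (\<integral>y. e * \<bar>g y\<bar> \<partial>area_S2)"
      proof (rule integral_mono_AE)
        show "AE y in area_S2. \<bar>g y * ?L y - g y * f (y \<bullet> \<omega>)\<bar> \<le> e * \<bar>g y\<bar>"
        proof (rule AE_S2_I)
          fix y assume y: "y \<in> S2"
          have "\<bar>g y * ?L y - g y * f (y \<bullet> \<omega>)\<bar> = \<bar>?L y - f (y \<bullet> \<omega>)\<bar> * \<bar>g y\<bar>"
            by (simp add: abs_mult mult.commute flip: right_diff_distrib)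
          also have "\<dots> \<le> e * \<bar>g y\<bar>"
            using R(2)[OF inner_S2_bound[OF y \<omega>]] by (intro mult_right_mono) (auto simp: zpoly_def)
          finally show "\<bar>g y * ?L y - g y * f (y \<bullet> \<omega>)\<bar> \<le> e * \<bar>g y\<bar>" .
        qed
      qed (use i gi in auto)
      finally show ?thesis .
    qed
    also have "\<dots> = e * M" by (simp add: M_def)
    finally have "\<bar>(\<integral>y. g y * ?L y \<partial>area_S2) - ?A\<bar> \<le> e * M" .
    moreover have "\<bar>zpoly P \<omega> x - U (x \<bullet> \<omega>)\<bar> \<le> 2 * e" "\<bar>zpoly P \<omega> x0 - U (x0 \<bullet> \<omega>)\<bar> \<le> 2 * e"
      using P(2) inner_S2_bound[OF _ \<omega>] x by (auto simp: zpoly_def)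
    ultimately have "\<bar>?A + (U (x \<bullet> \<omega>) - U (x0 \<bullet> \<omega>))\<bar> \<le> e * M + 2 * e + 2 * e"
      unfolding id by linarith
    then show "\<bar>?A + (U (x \<bullet> \<omega>) - U (x0 \<bullet> \<omega>))\<bar> \<le> e * (M + 4)" by (simp add: algebra_simps)
  qed
  then show ?thesis unfolding g_def by simp
qed

lemma dist_S2:
  assumes "x \<in> S2" "y \<in> S2"
  shows "(dist x y)\<^sup>2 = 2 - 2 * (x \<bullet> y)"
proof -
  have "x \<bullet> x = 1" "y \<bullet> y = 1" using assms by (simp_all add: dot_square_norm)
  then show ?thesis
    by (simp add: dist_norm power2_norm_eq_inner inner_diff_left inner_diff_right inner_commute[of y x])
qed

lemma bump_exists:
  fixes d :: real
  assumes d: "0 < d" "d < 2"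
  shows "\<exists>q :: real \<Rightarrow> real. continuous_on {-1..1} q \<and> (\<forall>z\<in>{-1..1}. q z \<ge> 0) \<and> (\<forall>z\<le>1 - d. q z = 0) \<and> integral {-1..1} q = 1"
proof -
  define b where "b = (\<lambda>z. max 0 (z - (1 - d)))"
  have b: "continuous_on {-1..1} b" unfolding b_def by (intro continuous_intros)
  define I where "I = integral {-1..1} b"
  have "I \<ge> 0" unfolding I_def by (rule integral_nonneg[OF integrable_continuous_real[OF b]]) (simp add: b_def)
  moreover have "I \<noteq> 0"
  proof
    assume "I = 0"
    moreover have "(integral {-1..1} b = 0) = (\<forall>x\<in>{-1..1}. b x = 0)"
      by (rule integral_eq_0_iff[OF b]) (auto simp: b_def)
    ultimately have "b 1 = 0" by (simp add: I_def)
    then show False using d by (simp add: b_def)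
  qed
  ultimately have I: "I > 0" by simp
  have "integral {-1..1} (\<lambda>z. b z / I) = 1" using I by (simp add: I_def)
  moreover have "continuous_on {-1..1} (\<lambda>z. b z / I)" using I by (intro continuous_intros b) auto
  ultimately show ?thesis using I by (intro exI[of _ "\<lambda>z. b z / I"]) (auto simp: b_def)
qed

text \<open>A zonal bump concentrating at the pole \<open>\<omega>\<close> reads off the value \<open>G x \<omega>\<close>, because \<open>G x\<close> is
  continuous there. On the other side of the weak equation, the zonal potential of the bump is
  explicit outside its support.\<close>

lemma green_explicit:
  assumes G: "is_green_S2 G" and x: "x \<in> S2" and \<omega>: "\<omega> \<in> S2" and neq: "x \<noteq> \<omega>"
  shows "G x \<omega> = G (- \<omega>) \<omega> - 1 / (4 * pi) * ln ((1 - x \<bullet> \<omega>) / 2)"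
proof -
  have x0: "- \<omega> \<in> S2" using \<omega> by simp
  have \<omega>1: "\<omega> \<bullet> \<omega> = 1" using \<omega> by (simp add: dot_square_norm)
  have neq0: "- \<omega> \<noteq> \<omega>"
  proof
    assume "- \<omega> = \<omega>"
    from arg_cong[OF this, of "\<lambda>v. v \<bullet> \<omega>"] show False using \<omega>1 by simp
  qed
  define z where "z = x \<bullet> \<omega>"
  have z: "z \<in> {-1..<1}"
  proof -
    have "(dist x \<omega>)\<^sup>2 = 2 - 2 * z" unfolding z_def by (rule dist_S2[OF x \<omega>])
    moreover have "(dist x \<omega>)\<^sup>2 > 0" using neq by simp
    ultimately show ?thesis using inner_S2_bound[OF x \<omega>] by (simp add: z_def)
  qed
  \<comment> \<open>The antipode of \<omega> is the reference pole because ln ((1 - t) / 2) vanishes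
    at its height t = -1.\<close>
  define g where "g = (\<lambda>y. G x y - G (- \<omega>) y)"
  have Gi: "integrable area_S2 (G x)" "integrable area_S2 (G (- \<omega>))"
    and G0: "(\<integral>y. G x y \<partial>area_S2) = 0" "(\<integral>y. G (- \<omega>) y \<partial>area_S2) = 0"
    and Gc: "continuous_on (S2 - {x}) (G x)" "continuous_on (S2 - {- \<omega>}) (G (- \<omega>))"
    using G x x0 unfolding is_green_S2_def by blast+
  have gi: "integrable area_S2 g" unfolding g_def by (intro Bochner_Integration.integrable_diff Gi)
  have g0: "(\<integral>y. g y \<partial>area_S2) = 0" unfolding g_def using Gi G0 by simp
  have gc: "continuous_on (S2 - {x, - \<omega>}) g"
    unfolding g_def by (intro continuous_intros continuous_on_subset[OF Gc(1)] continuous_on_subset[OF Gc(2)]) auto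
  have cont: "\<exists>d>0. \<forall>y\<in>S2. dist y \<omega> < d \<longrightarrow> \<bar>g y - g \<omega>\<bar> < e" if e: "e > 0" for e
  proof -
    have "\<omega> \<in> S2 - {x, - \<omega>}" using \<omega> neq neq0 by auto
    then obtain d where d: "d > 0" "\<And>y. y \<in> S2 - {x, - \<omega>} \<Longrightarrow> dist y \<omega> < d \<Longrightarrow> dist (g y) (g \<omega>) < e"
      using gc e unfolding continuous_on_iff by blast
    define d' where "d' = min d (min (dist x \<omega>) (dist (- \<omega>) \<omega>))"
    have "d' > 0" using d neq neq0 by (simp add: d'_def)
    moreover have "\<bar>g y - g \<omega>\<bar> < e" if "y \<in> S2" "dist y \<omega> < d'" for y
      using d(2)[of y] that by (auto simp: d'_def dist_real_def)
    ultimately show ?thesis by blast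
  qed
  let ?l = "ln ((1 - z) / 2)"
  have "2 * pi * g \<omega> + ?l / 2 = 0"
  proof (rule eq_0_if_small)
    fix e :: real assume e: "e > 0"
    obtain d where d: "d > 0" "\<And>y. y \<in> S2 \<Longrightarrow> dist y \<omega> < d \<Longrightarrow> \<bar>g y - g \<omega>\<bar> < e"
      using cont[OF e] by blast
    \<comment> \<open>If 1 - y . \<omega> < \<eta>, then the squared distance of y to \<omega> is
      below 2 \<eta> \<le> d^2, so the bump lives where g is close to its value at \<omega>. The
      bound \<eta> \<le> 1 - z makes the bump vanish at the height of x and below.\<close>
    define \<eta> where "\<eta> = min (d\<^sup>2 / 2) (min (1 - z) 1)"
    have "\<eta> \<le> d\<^sup>2 / 2" unfolding \<eta>_def by (rule min.cobounded1)
    then have \<eta>: "\<eta> > 0" "\<eta> < 2" "\<eta> \<le> 1 - z" "2 * \<eta> \<le> d\<^sup>2"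
      using d z by (auto simp: \<eta>_def min_less_iff_disj)
    obtain q :: "real \<Rightarrow> real" where q: "continuous_on {-1..1} q" "\<And>z. z \<in> {-1..1} \<Longrightarrow> q z \<ge> 0" "\<And>z. z \<le> 1 - \<eta> \<Longrightarrow> q z = 0"
      "integral {-1..1} q = 1"
      using bump_exists[OF \<eta>(1,2)] by blast
    \<comment> \<open>The bump minus its mean; mean zero is the solvability condition for ((1 - z^2)
      r)' = f.\<close>
    define f where "f = (\<lambda>z. q z - 1 / 2)"
    have f: "continuous_on {-1..1} f" unfolding f_def by (intro continuous_intros q)
    have "integral {-1..1} f = 0"
      unfolding f_def Henstock_Kurzweil_Integration.integral_diff[OF integrable_continuous_real[OF q(1)] integrable_const_ivl]
      by (simp add: q(4))
    from legendre_quotient_exists[OF f this] obtain r where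
      r: "continuous_on {-1..1} r" "\<And>z. z \<in> {-1..1} \<Longrightarrow> (1 - z\<^sup>2) * r z = integral {-1..z} f" by blast
    define U where "U = (\<lambda>z. integral {-1..z} r)"
    have Uc: "continuous_on {-1..1} U"
      unfolding U_def by (intro indefinite_integral_continuous_1 integrable_continuous_real r)
    have U': "(U has_real_derivative r t) (at t)" if "t \<in> {-1<..<1}" for t
    proof -
      have "(U has_real_derivative r t) (at t within {-1..1})"
        unfolding U_def by (rule integral_has_real_derivative[OF r(1)]) (use that in auto)
      moreover have "at t within {-1..1} = at t" by (rule at_within_interior) (use that in simp)
      ultimately show ?thesis by simp
    qed
    \<comment> \<open>Below the bump f is the constant - 1/2, so r is independent of the choice of
      the bump there, and its primitive is the logarithm.\<close>
    have r_eq: "r t = - (1 / 2) / (1 - t)" if t: "-1 < t" "t \<le> 1 - \<eta>" for t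
    proof -
      have t1: "1 - t > 0" "1 + t > 0" using t \<eta> by auto
      have "(1 - t) * (1 + t) * r t = integral {-1..t} f"
        using r(2)[of t] t \<eta> by (simp add: power2_eq_square algebra_simps)
      also have "\<dots> = integral {-1..t} (\<lambda>_. - (1 / 2))"
        by (rule integral_cong) (use q(3) t in \<open>simp add: f_def\<close>)
      also have "\<dots> = (1 + t) * (- (1 / 2))" using t by simp
      finally have "(1 + t) * ((1 - t) * r t) = (1 + t) * (- (1 / 2))" by (simp only: mult_ac)
      then have "(1 - t) * r t = - (1 / 2)" using t1 by (simp only: mult_cancel_left) simp
      then show ?thesis using t1 by (simp add: field_simps)
    qed
    have Uz: "U z = ?l / 2"
    proof (cases "z = -1")
      case True then show ?thesis by (simp add: U_def)
    next
      case False
      have "((\<lambda>t. ln ((1 - t) / 2) / 2) has_real_derivative r t) (at t)" if t: "-1 < t" "t < z" for t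
      proof -
        have "((\<lambda>t. ln ((1 - t) / 2) / 2) has_real_derivative - (1 / 2) / (1 - t)) (at t)"
          using t z by (auto intro!: derivative_eq_intros simp: field_simps)
        then show ?thesis using r_eq[of t] t \<eta> by simp
      qed
      then have "(r has_integral ?l / 2 - ln ((1 - (-1)) / 2) / 2) {-1..z}"
        using z by (intro fundamental_theorem_of_calculus_interior)
          (auto intro!: continuous_intros simp flip: has_real_derivative_iff_has_vector_derivative)
      then show ?thesis by (simp add: U_def integral_unique)
    qed
    have "(- \<omega>) \<bullet> \<omega> = -1" using \<omega>1 by simp
    then have "(\<integral>y. g y * f (y \<bullet> \<omega>) \<partial>area_S2) = - (?l / 2)"
      using green_zonal[OF G f r Uc U' x x0 \<omega>] Uz unfolding g_def z_def[symmetric] by (simp add: U_def)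
    moreover have iq: "integrable area_S2 (\<lambda>y. g y * q (y \<bullet> \<omega>))"
      by (intro integrable_mult_continuous_S2 gi continuous_on_zonal q \<omega>)
    moreover have "(\<integral>y. g y * f (y \<bullet> \<omega>) \<partial>area_S2) = (\<integral>y. g y * q (y \<bullet> \<omega>) - g y * (1 / 2) \<partial>area_S2)"
      by (rule integral_cong_S2) (simp add: f_def right_diff_distrib)
    moreover have "(\<integral>y. g y * q (y \<bullet> \<omega>) - g y * (1 / 2) \<partial>area_S2) =
        (\<integral>y. g y * q (y \<bullet> \<omega>) \<partial>area_S2) - (\<integral>y. g y * (1 / 2) \<partial>area_S2)"
      using gi by (intro Bochner_Integration.integral_diff iq) auto
    ultimately have gq: "(\<integral>y. g y * q (y \<bullet> \<omega>) \<partial>area_S2) = - (?l / 2)"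
      using g0 by simp
    have qi: "integrable area_S2 (\<lambda>y. q (y \<bullet> \<omega>))"
      by (intro continuous_on_integrable_S2 continuous_on_zonal q \<omega>)
    have q2pi: "(\<integral>y. q (y \<bullet> \<omega>) \<partial>area_S2) = 2 * pi" using integral_zonal[OF q(1) \<omega>] q(4) by simp
    have "2 * pi * g \<omega> = (\<integral>y. g \<omega> * q (y \<bullet> \<omega>) \<partial>area_S2)" using q2pi by simp
    then have "(\<integral>y. g y * q (y \<bullet> \<omega>) \<partial>area_S2) - 2 * pi * g \<omega> = (\<integral>y. g y * q (y \<bullet> \<omega>) - g \<omega> * q (y \<bullet> \<omega>) \<partial>area_S2)"
      using qi by (subst Bochner_Integration.integral_diff[OF iq]) auto
    also have "\<bar>\<dots>\<bar> \<le> (\<integral>y. \<bar>g y * q (y \<bullet> \<omega>) - g \<omega> * q (y \<bullet> \<omega>)\<bar> \<partial>area_S2)"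
      by (rule integral_abs_bound)
    also have "\<dots> \<le> (\<integral>y. e * q (y \<bullet> \<omega>) \<partial>area_S2)"
    proof (rule integral_mono_AE)
      show "AE y in area_S2. \<bar>g y * q (y \<bullet> \<omega>) - g \<omega> * q (y \<bullet> \<omega>)\<bar> \<le> e * q (y \<bullet> \<omega>)"
      proof (rule AE_S2_I)
        fix y assume y: "y \<in> S2"
        have q0: "q (y \<bullet> \<omega>) \<ge> 0" using q(2) inner_S2_bound[OF y \<omega>] by blast
        show "\<bar>g y * q (y \<bullet> \<omega>) - g \<omega> * q (y \<bullet> \<omega>)\<bar> \<le> e * q (y \<bullet> \<omega>)"
        proof (cases "y \<bullet> \<omega> \<le> 1 - \<eta>")
          case True then show ?thesis using q(3) by simp
        next
          case False
          have "(dist y \<omega>)\<^sup>2 = 2 - 2 * (y \<bullet> \<omega>)" by (rule dist_S2[OF y \<omega>])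
          also have "\<dots> < d\<^sup>2" using False \<eta> by simp
          finally have "dist y \<omega> < d" using d by (simp add: power2_less_imp_less)
          then have "\<bar>g y - g \<omega>\<bar> \<le> e" using d(2)[OF y] by simp
          then have "\<bar>g y - g \<omega>\<bar> * q (y \<bullet> \<omega>) \<le> e * q (y \<bullet> \<omega>)" using q0 by (rule mult_right_mono)
          then show ?thesis using q0 by (simp add: abs_mult flip: left_diff_distrib)
        qed
      qed
    qed (use iq qi in auto)
    also have "\<dots> = e * (2 * pi)" using q2pi by simp
    finally show "\<bar>2 * pi * g \<omega> + ?l / 2\<bar> \<le> e * (2 * pi)" unfolding gq by linarith
  qed
  then have "g \<omega> = - (1 / (4 * pi)) * ?l" by (simp add: field_simps)
  then show ?thesis by (simp add: g_def z_def algebra_simps)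
qed

section \<open>The axially symmetric solution\<close>

lemma orthogonal_unit_exists:
  fixes p :: "real^3"
  shows "\<exists>e. norm e = 1 \<and> e \<bullet> p = 0"
proof -
  obtain y where y: "y \<noteq> 0" "orthogonal p y"
    using orthogonal_to_vector_exists[of p] by auto
  then show ?thesis
    by (intro exI[of _ "y /\<^sub>R norm y"]) (auto simp: orthogonal_def inner_commute)
qed

text \<open>K is read along the meridian \<open>\<gamma>\<close> from -p to p through e. Its
  velocity in z blows up at the poles, but (1 - z^2) times the velocity is \<open>v\<close>, the
  meridional field along \<open>\<gamma>\<close>, which is continuous and vanishes there. So
  \<open>kd\<close>, the derivative of K along \<open>v\<close>, is continuous and zero at both
  ends.\<close>

lemma axially_symmetric_profile:
  assumes p: "p \<in> S2" and K: "smooth_S2 K" and sym: "axially_symmetric p K"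
  shows "\<exists>k kd. continuous_on {-1..1} k \<and> continuous_on {-1..1} kd \<and> (\<forall>x\<in>S2. K x = k (x \<bullet> p)) \<and>
    (\<forall>z\<in>{-1..1}. \<exists>x\<in>S2. k z = K x) \<and> kd (-1) = 0 \<and> kd 1 = 0 \<and>
    (\<forall>z\<in>{-1<..<1}. (k has_real_derivative kd z / (1 - z\<^sup>2)) (at z))"
proof -
  obtain F F' where F: "C1_near_S2 F F'" "\<And>x. x \<in> S2 \<Longrightarrow> K x = F x"
    using smooth_S2_C1[OF K] by blast
  obtain e where e: "norm e = 1" "e \<bullet> p = 0" using orthogonal_unit_exists by blast
  have ip: "p \<bullet> p = 1" "e \<bullet> e = 1" "p \<bullet> e = 0"
    using p e by (auto simp: dot_square_norm inner_commute)
  have sq: "1 - z\<^sup>2 \<ge> 0" if "z \<in> {-1..1}" for z :: real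
    using that abs_square_le_1[of z] by auto
  define \<gamma> where "\<gamma> = (\<lambda>z. z *\<^sub>R p + sqrt (1 - z\<^sup>2) *\<^sub>R e)"
  define v where "v = (\<lambda>z. (1 - z\<^sup>2) *\<^sub>R p - (z * sqrt (1 - z\<^sup>2)) *\<^sub>R e)"
  have \<gamma>S: "\<gamma> z \<in> S2" if "z \<in> {-1..1}" for z
  proof -
    have "\<gamma> z \<bullet> \<gamma> z = z * z + sqrt (1 - z\<^sup>2) * sqrt (1 - z\<^sup>2)"
      by (simp add: \<gamma>_def inner_add_left inner_add_right ip e inner_commute)
    also have "\<dots> = 1" using sq[OF that] by (simp add: power2_eq_square)
    finally show ?thesis by (simp add: norm_eq_1)
  qed
  have \<gamma>p: "\<gamma> z \<bullet> p = z" for z by (simp add: \<gamma>_def inner_add_left ip e)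
  have \<gamma>c: "continuous_on {-1..1} \<gamma>" unfolding \<gamma>_def by (intro continuous_intros)
  obtain g where g: "\<And>x. x \<in> S2 \<Longrightarrow> K x = g (x \<bullet> p)" using sym unfolding axially_symmetric_def by blast
  define k where "k = (\<lambda>z. F (\<gamma> z))"
  define kd where "kd = (\<lambda>z. F' (\<gamma> z) (v z))"
  have "continuous_on {-1..1} k"
    unfolding k_def by (rule continuous_on_compose2[OF C1_near_S2_cont[OF F(1)] \<gamma>c]) (use \<gamma>S in blast)
  moreover have "continuous_on {-1..1} kd"
  proof (rule continuous_on_eq)
    show "continuous_on {-1..1} (\<lambda>z. \<Sum>b\<in>Basis. F' (\<gamma> z) b * (v z \<bullet> b))"
    proof (intro continuous_on_sum continuous_on_mult)
      show "continuous_on {-1..1} (\<lambda>z. F' (\<gamma> z) b)" for b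
        by (rule continuous_on_compose2[OF _ \<gamma>c, where t=S2])
          (use \<gamma>S F(1) in \<open>auto simp: C1_near_S2_def\<close>)
      show "continuous_on {-1..1} (\<lambda>z. v z \<bullet> b)" for b
        unfolding v_def by (intro continuous_intros)
    qed
    show "(\<Sum>b\<in>Basis. F' (\<gamma> z) b * (v z \<bullet> b)) = kd z" if "z \<in> {-1..1}" for z
      unfolding kd_def by (rule linear_eq_inner_sum[OF C1_near_S2_linear[OF F(1) \<gamma>S[OF that]]])
  qed
  moreover have "K x = k (x \<bullet> p)" if x: "x \<in> S2" for x
  proof -
    have b: "x \<bullet> p \<in> {-1..1}" by (rule inner_S2_bound[OF x p])
    have "K x = g (\<gamma> (x \<bullet> p) \<bullet> p)" using g[OF x] \<gamma>p by simp
    also have "\<dots> = k (x \<bullet> p)" using g[OF \<gamma>S[OF b]] F(2)[OF \<gamma>S[OF b]] by (simp add: k_def)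
    finally show ?thesis .
  qed
  moreover have "\<exists>x\<in>S2. k z = K x" if "z \<in> {-1..1}" for z
    by (rule bexI[OF _ \<gamma>S[OF that]]) (simp add: k_def F(2)[OF \<gamma>S[OF that]])
  moreover have "kd (-1) = 0" "kd 1 = 0"
  proof -
    have "v (-1) = 0" "v 1 = 0" by (simp_all add: v_def)
    moreover have "F' (\<gamma> z) 0 = 0" if "z \<in> {-1..1}" for z
      by (rule linear_0[OF C1_near_S2_linear[OF F(1) \<gamma>S[OF that]]])
    ultimately show "kd (-1) = 0" "kd 1 = 0" by (simp_all add: kd_def)
  qed
  moreover have "(k has_real_derivative kd z / (1 - z\<^sup>2)) (at z)" if z: "z \<in> {-1<..<1}" for z
  proof -
    have z': "z \<in> {-1..1}" using z by auto
    have pos: "1 - z\<^sup>2 > 0" using z abs_square_less_1[of z] by (simp add: abs_less_iff)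
    have ds: "((\<lambda>z. sqrt (1 - z\<^sup>2)) has_real_derivative - z / sqrt (1 - z\<^sup>2)) (at z)"
      using pos by (auto intro!: derivative_eq_intros simp: divide_simps)
    have "(\<gamma> has_vector_derivative (z *\<^sub>R 0 + 1 *\<^sub>R p) + (sqrt (1 - z\<^sup>2) *\<^sub>R 0 + (- z / sqrt (1 - z\<^sup>2)) *\<^sub>R e)) (at z)"
      unfolding \<gamma>_def
      by (intro has_vector_derivative_add has_vector_derivative_scaleR ds DERIV_ident has_vector_derivative_const)
    then have "(\<gamma> has_vector_derivative p + (- z / sqrt (1 - z\<^sup>2)) *\<^sub>R e) (at z)" by simp
    moreover have "p + (- z / sqrt (1 - z\<^sup>2)) *\<^sub>R e = (1 / (1 - z\<^sup>2)) *\<^sub>R v z"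
    proof -
      have "sqrt (1 - z\<^sup>2) * sqrt (1 - z\<^sup>2) = 1 - z\<^sup>2" using pos by simp
      then have "z * sqrt (1 - z\<^sup>2) / (1 - z\<^sup>2) = z / sqrt (1 - z\<^sup>2)"
        using pos by (metis less_irrefl mult_divide_mult_cancel_right real_sqrt_eq_zero_cancel_iff)
      then show ?thesis using pos by (simp add: v_def scaleR_diff_right)
    qed
    ultimately have "(\<gamma> has_vector_derivative (1 / (1 - z\<^sup>2)) *\<^sub>R v z) (at z)" by simp
    from vector_derivative_diff_chain_within[OF this has_derivative_at_withinI[OF C1_near_S2_deriv[OF F(1) \<gamma>S[OF z']]]]
    have "(k has_vector_derivative F' (\<gamma> z) ((1 / (1 - z\<^sup>2)) *\<^sub>R v z)) (at z)"
      by (simp add: k_def o_def)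
    then show ?thesis
      using linear_scale[OF C1_near_S2_linear[OF F(1) \<gamma>S[OF z']]]
      by (simp add: kd_def has_real_derivative_iff_has_vector_derivative)
  qed
  ultimately show ?thesis by blast
qed

lemma zonal_in_H1:
  fixes U r :: "real \<Rightarrow> real"
  assumes U: "continuous_on {-1..1} U" and r: "continuous_on {-1..1} r"
    and U': "\<And>z. z \<in> {-1<..<1} \<Longrightarrow> (U has_real_derivative r z) (at z)" and p: "p \<in> S2"
  shows "has_weak_grad_S2 (\<lambda>x. U (x \<bullet> p)) (\<lambda>x. r (x \<bullet> p) *\<^sub>R meridional p x)"
    and "(\<lambda>x. U (x \<bullet> p)) \<in> H1_S2"
proof -
  have c: "continuous_on S2 (\<lambda>x. r (x \<bullet> p) *\<^sub>R meridional p x)"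
    by (intro continuous_intros continuous_on_zonal r p continuous_on_meridional)
  show wg: "has_weak_grad_S2 (\<lambda>x. U (x \<bullet> p)) (\<lambda>x. r (x \<bullet> p) *\<^sub>R meridional p x)"
    unfolding has_weak_grad_S2_def
  proof (intro conjI allI impI)
    show "(\<lambda>x. r (x \<bullet> p) *\<^sub>R meridional p x) \<in> borel_measurable area_S2"
      by (rule continuous_on_measurable_S2[OF c])
    show "AE x in area_S2. (r (x \<bullet> p) *\<^sub>R meridional p x) \<bullet> x = 0"
      by (rule AE_S2_I) (simp add: meridional_tangent)
    show "integrable area_S2 (\<lambda>x. (norm (r (x \<bullet> p) *\<^sub>R meridional p x))\<^sup>2)"
      by (intro continuous_on_integrable_S2 continuous_intros c)
    fix X :: "real^3 \<Rightarrow> real^3" assume X: "smooth_S2 X \<and> (\<forall>x\<in>S2. X x \<bullet> x = 0)"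
    then obtain F F' where F: "C1_near_S2 F F'" "\<And>x. x \<in> S2 \<Longrightarrow> X x = F x"
      using smooth_S2_C1 by blast
    have tan: "F x \<bullet> x = 0" if "x \<in> S2" for x using X F(2) that by metis
    have "(\<integral>x. U (x \<bullet> p) * div_S2 X x \<partial>area_S2) = (\<integral>x. U (x \<bullet> p) * div_S2 F x \<partial>area_S2)"
      by (rule integral_cong_S2) (simp only: div_S2_cong_C1[OF F])
    also have "\<dots> = - (\<integral>x. r (x \<bullet> p) * (F x \<bullet> p) \<partial>area_S2)"
      by (rule zonal_weak_gradient[OF U r U' F(1) tan p])
    \<comment> \<open>A tangent field pairs with p only through the tangential part of p, which is
      the meridional field.\<close>
    also have "(\<integral>x. r (x \<bullet> p) * (F x \<bullet> p) \<partial>area_S2) = (\<integral>x. (r (x \<bullet> p) *\<^sub>R meridional p x) \<bullet> X x \<partial>area_S2)"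
    proof (rule integral_cong_S2)
      fix x assume x: "x \<in> S2"
      have "x \<bullet> F x = 0" using tan[OF x] by (simp add: inner_commute)
      then show "r (x \<bullet> p) * (F x \<bullet> p) = (r (x \<bullet> p) *\<^sub>R meridional p x) \<bullet> X x"
        using F(2)[OF x] by (simp add: meridional_def inner_diff_left inner_commute[of p])
    qed
    finally show "(\<integral>x. U (x \<bullet> p) * div_S2 X x \<partial>area_S2) =
        - (\<integral>x. (r (x \<bullet> p) *\<^sub>R meridional p x) \<bullet> X x \<partial>area_S2)" .
  qed
  have "continuous_on S2 (\<lambda>x. U (x \<bullet> p))" by (rule continuous_on_zonal[OF U p])
  then show "(\<lambda>x. U (x \<bullet> p)) \<in> H1_S2"
    unfolding H1_S2_def using wg
    by (auto intro!: continuous_on_measurable_S2 continuous_on_integrable_S2 continuous_intros)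
qed

text \<open>The values of h at the poles involve G at coinciding arguments, where nothing is
  prescribed. As \<open>area_S2\<close> lives on Borel sets, almost everywhere equality alone would
  not yield measurability of h e^u; equality off two points does.\<close>

lemma measurable_S2_except_two_points:
  fixes f g :: "real^3 \<Rightarrow> real"
  assumes g: "g \<in> borel_measurable area_S2" and eq: "\<And>x. x \<in> S2 \<Longrightarrow> x \<noteq> p \<Longrightarrow> x \<noteq> q \<Longrightarrow> f x = g x"
  shows "f \<in> borel_measurable area_S2"
proof -
  have m: "{x \<in> space area_S2. x = a} \<in> sets area_S2" for a
  proof -
    have "{x \<in> space area_S2. x = a} = S2 \<inter> {a}" by auto
    then show ?thesis unfolding sets_area_S2 by (simp add: sets_restrict_space)
  qed
  have "(\<lambda>x. if x = p then f p else if x = q then f q else g x) \<in> borel_measurable area_S2"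
    by (intro measurable_If g m borel_measurable_const)
  then show ?thesis
    by (rule measurable_cong[THEN iffD1, rotated]) (use eq in auto)
qed

theorem theorem1p2:
  fixes p1 p2 :: "real^3" and \<alpha>1 \<alpha>2 \<rho> :: real
    and K h :: "real^3 \<Rightarrow> real" and G :: "real^3 \<Rightarrow> real^3 \<Rightarrow> real"
  assumes "p1 \<in> S2" and "p2 \<in> S2" and "p1 = - p2"
    and "min \<alpha>1 \<alpha>2 = \<alpha>1" and "\<alpha>1 > 0"
    and "smooth_S2 K" and "\<And>x. x \<in> S2 \<Longrightarrow> K x > 0" and "axially_symmetric p1 K"
    and "is_green_S2 G"
    and "\<And>x. x \<in> S2 \<Longrightarrow> h x = K x * exp (- 4 * pi * \<alpha>1 * G x p1 - 4 * pi * \<alpha>2 * G x p2)"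
    and "\<rho> \<in> {0<..<8 * pi * (1 + \<alpha>1)}"
  shows "\<exists>u. liouville_weak_solution h \<rho> u \<and> axially_symmetric_AE p1 u"
proof -
  note p1 = assms(1) and p2 = assms(2)
  have p12: "p2 = - p1" using assms(3) by simp
  \<comment> \<open>The factor 2 pi of \<open>integral_zonal\<close> turns the mass 2 a in the
    height coordinate into \<rho> on the sphere.\<close>
  define a where "a = \<rho> / (4 * pi)"
  have \<rho>a: "\<rho> = 4 * pi * a" by (simp add: a_def)
  have a: "a > 0" "a < 2 * (1 + \<alpha>1)"
    using assms(11) by (auto simp: a_def field_simps)
  obtain k kd where k: "continuous_on {-1..1} k" "continuous_on {-1..1} kd"
    and Kk: "\<And>x. x \<in> S2 \<Longrightarrow> K x = k (x \<bullet> p1)" and kK: "\<And>z. z \<in> {-1..1} \<Longrightarrow> \<exists>x\<in>S2. k z = K x"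
    and kd: "kd (-1) = 0" "kd 1 = 0"
    and k': "\<And>z. z \<in> {-1<..<1} \<Longrightarrow> (k has_real_derivative kd z / (1 - z\<^sup>2)) (at z)"
    using axially_symmetric_profile[OF p1 assms(6,8)] by blast
  interpret shooting k kd \<alpha>1 \<alpha>2 a
  proof
    show "k z > 0" if "z \<in> {-1..1}" for z using kK[OF that] assms(7) by auto
  qed (use k kd k' a assms(4,5) in \<open>auto simp: min_def split: if_splits\<close>)
  obtain U where U: "continuous_on {-1..1} U" and tot: "integral {-1..1} (\<lambda>s. N s * exp (U s)) = 2 * a"
    and U0: "\<And>z. z \<in> {-1<..<1} \<Longrightarrow> (U has_real_derivative integral {-1..z} (\<lambda>s. a - N s * exp (U s)) / (1 - z\<^sup>2)) (at z)"
    using solution_exists by blast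
  \<comment> \<open>The total mass 2 a is what gives f mean zero. Hence U' on the open interval
    extends to a function r that is continuous up to both poles.\<close>
  define f where "f = (\<lambda>s. a - N s * exp (U s))"
  have NU: "continuous_on {-1..1} (\<lambda>s. N s * exp (U s))" by (intro continuous_intros N_cont U)
  have f: "continuous_on {-1..1} f" unfolding f_def by (intro continuous_intros NU)
  have "integral {-1..1} f = 0"
    unfolding f_def Henstock_Kurzweil_Integration.integral_diff[OF integrable_const_ivl integrable_continuous_real[OF NU]]
    by (simp add: tot)
  from legendre_quotient_exists[OF f this] obtain r where
    r: "continuous_on {-1..1} r" and req: "\<And>z. z \<in> {-1..1} \<Longrightarrow> (1 - z\<^sup>2) * r z = integral {-1..z} f" by blast
  have U': "(U has_real_derivative r z) (at z)" if z: "z \<in> {-1<..<1}" for z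
  proof -
    have "integral {-1..z} f / (1 - z\<^sup>2) = r z"
      using req[of z] z one_minus_square_pos[OF z] by (auto simp: divide_eq_eq mult.commute)
    then show ?thesis using U0[OF z] by (simp add: f_def)
  qed
  define u where "u = (\<lambda>x. U (x \<bullet> p1))"
  define V where "V = (\<lambda>x. r (x \<bullet> p1) *\<^sub>R meridional p1 x)"
  define n where "n = (\<lambda>x. N (x \<bullet> p1) * exp (U (x \<bullet> p1)))"
  have nc: "continuous_on S2 n" unfolding n_def by (rule continuous_on_zonal[OF NU p1])
  have n_int: "(\<integral>x. n x \<partial>area_S2) = \<rho>"
    unfolding n_def integral_zonal[OF NU p1] tot \<rho>a by simp
  \<comment> \<open>The constants in h: the values of G at antipodal points, and the powers of 2
    from (1 - z) / 2 and (1 + z) / 2. The equation does not change when h is scaled, so C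
    cancels.\<close>
  define C where "C = exp (- 4 * pi * \<alpha>1 * G (- p1) p1 - 4 * pi * \<alpha>2 * G (- p2) p2) * exp (- (\<alpha>1 + \<alpha>2) * ln 2)"
  have C: "C > 0" by (simp add: C_def)
  have hC: "h x * exp (u x) = C * n x" if x: "x \<in> S2" "x \<noteq> p1" "x \<noteq> p2" for x
  proof -
    define z where "z = x \<bullet> p1"
    have z: "z \<in> {-1<..<1}"
    proof -
      have "(dist x p1)\<^sup>2 = 2 - 2 * z" "(dist x p2)\<^sup>2 = 2 + 2 * z"
        using dist_S2[OF x(1) p1] dist_S2[OF x(1) p2] by (simp_all add: z_def p12)
      moreover have "(dist x p1)\<^sup>2 > 0" "(dist x p2)\<^sup>2 > 0" using x by simp_all
      ultimately show ?thesis by simp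
    qed
    have ln: "ln ((1 - z) / 2) = ln (1 - z) - ln 2" "ln ((1 + z) / 2) = ln (1 + z) - ln 2"
      using z by (simp_all add: ln_div)
    have "G x p1 = G (- p1) p1 - 1 / (4 * pi) * ln ((1 - z) / 2)"
      unfolding z_def by (rule green_explicit[OF assms(9) x(1) p1 x(2)])
    moreover have "G x p2 = G (- p2) p2 - 1 / (4 * pi) * ln ((1 + z) / 2)"
      using green_explicit[OF assms(9) x(1) p2 x(3)] by (simp add: z_def p12)
    moreover have "- 4 * pi * \<alpha> * (g - 1 / (4 * pi) * L) = - 4 * pi * \<alpha> * g + \<alpha> * L" for \<alpha> g L :: real
      by (simp add: field_simps)
    moreover have "A - 4 * pi * \<alpha>2 * g = A + (- 4 * pi * \<alpha>2 * g)" for A g :: real by simp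
    ultimately have "- 4 * pi * \<alpha>1 * G x p1 - 4 * pi * \<alpha>2 * G x p2 =
        (- 4 * pi * \<alpha>1 * G (- p1) p1 - 4 * pi * \<alpha>2 * G (- p2) p2) + - (\<alpha>1 + \<alpha>2) * ln 2
          + \<alpha>1 * ln (1 - z) + \<alpha>2 * ln (1 + z)"
      unfolding ln by (simp only:) (simp add: algebra_simps)
    then have "exp (- 4 * pi * \<alpha>1 * G x p1 - 4 * pi * \<alpha>2 * G x p2) = C * exp (\<alpha>1 * ln (1 - z)) * exp (\<alpha>2 * ln (1 + z))"
      unfolding C_def by (simp only: exp_add)
    then have "h x = C * N z"
      using assms(10)[OF x(1)] Kk[OF x(1)] z by (simp add: N_def powr_def z_def mult_ac)
    then show ?thesis by (simp add: n_def u_def z_def)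
  qed
  have AE_hC: "AE x in area_S2. h x * exp (u x) = C * n x"
    using AE_S2_neq[of p1] AE_S2_neq[of p2] AE_space
    by eventually_elim (use hC in auto)
  have Cn_m: "(\<lambda>x. C * n x) \<in> borel_measurable area_S2"
    by (intro continuous_on_measurable_S2 continuous_intros nc)
  have h_m: "(\<lambda>x. h x * exp (u x)) \<in> borel_measurable area_S2"
    by (rule measurable_S2_except_two_points[OF Cn_m hC])
  have Cn_i: "integrable area_S2 (\<lambda>x. C * n x)"
    by (intro continuous_on_integrable_S2 continuous_intros nc)
  have h_i: "integrable area_S2 (\<lambda>x. h x * exp (u x))"
    using integrable_cong_AE[OF h_m Cn_m AE_hC] Cn_i by simp
  have h_int: "(\<integral>x. h x * exp (u x) \<partial>area_S2) = C * \<rho>"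
    using integral_cong_AE[OF h_m Cn_m AE_hC] n_int by simp
  have "liouville_weak_solution h \<rho> u"
    unfolding liouville_weak_solution_def
  proof (intro conjI exI[of _ V] allI impI)
    show "u \<in> H1_S2" "has_weak_grad_S2 u V"
      unfolding u_def V_def using zonal_in_H1[OF U r U' p1] by blast+
    show "integrable area_S2 (\<lambda>x. h x * exp (u x))" by (rule h_i)
    fix \<phi> :: "real^3 \<Rightarrow> real" assume "smooth_S2 \<phi>"
    then obtain F F' where F: "C1_near_S2 F F'" "\<And>x. x \<in> S2 \<Longrightarrow> \<phi> x = F x"
      using smooth_S2_C1 by blast
    have \<phi>c: "continuous_on S2 \<phi>"
      by (rule continuous_on_eq[OF C1_near_S2_cont[OF F(1)]]) (simp add: F(2))
    have "(\<integral>x. V x \<bullet> grad_S2 \<phi> x \<partial>area_S2) = (\<integral>x. r (x \<bullet> p1) * F' x (meridional p1 x) \<partial>area_S2)"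
    proof (rule integral_cong_S2)
      fix x assume x: "x \<in> S2"
      have "grad_S2 \<phi> x \<bullet> meridional p1 x = F' x (meridional p1 x)"
        by (rule grad_S2_inner[OF F x meridional_tangent[OF x]])
      then show "V x \<bullet> grad_S2 \<phi> x = r (x \<bullet> p1) * F' x (meridional p1 x)"
        by (simp add: V_def inner_commute)
    qed
    also have "\<dots> = - (\<integral>x. f (x \<bullet> p1) * F x \<partial>area_S2)"
      by (rule zonal_weak_identity[OF f r req F(1) p1])
    also have "\<dots> = (\<integral>x. - (f (x \<bullet> p1) * F x) \<partial>area_S2)" by simp
    also have "\<dots> = (\<integral>x. (n x - a) * \<phi> x \<partial>area_S2)"
      by (rule integral_cong_S2) (simp add: f_def n_def F(2) algebra_simps)
    \<comment> \<open>C \<rho> is the normalising integral of h e^u, and \<rho> / (4 pi) = a, so the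
      right-hand side of the equation is n - a.\<close>
    also have "\<dots> = (\<integral>x. \<rho> * ((C * n x / (C * \<rho>) - 1 / (4 * pi)) * \<phi> x) \<partial>area_S2)"
    proof (rule integral_cong_S2)
      fix x
      have "\<rho> > 0" using assms(11) by simp
      then have "\<rho> * (C * n x / (C * \<rho>) - 1 / (4 * pi)) = n x - a"
        using C by (simp add: right_diff_distrib a_def)
      then show "(n x - a) * \<phi> x = \<rho> * ((C * n x / (C * \<rho>) - 1 / (4 * pi)) * \<phi> x)"
        by (simp only: mult.assoc[symmetric])
    qed
    also have "\<dots> = \<rho> * (\<integral>x. (C * n x / (C * \<rho>) - 1 / (4 * pi)) * \<phi> x \<partial>area_S2)" by simp
    also have "(\<integral>x. (C * n x / (C * \<rho>) - 1 / (4 * pi)) * \<phi> x \<partial>area_S2) =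
        (\<integral>x. (h x * exp (u x) / (C * \<rho>) - 1 / (4 * pi)) * \<phi> x \<partial>area_S2)"
    proof (rule integral_cong_AE)
      have \<phi>m: "\<phi> \<in> borel_measurable area_S2" by (rule continuous_on_measurable_S2[OF \<phi>c])
      show "(\<lambda>x. (C * n x / (C * \<rho>) - 1 / (4 * pi)) * \<phi> x) \<in> borel_measurable area_S2"
        "(\<lambda>x. (h x * exp (u x) / (C * \<rho>) - 1 / (4 * pi)) * \<phi> x) \<in> borel_measurable area_S2"
        by (intro Cn_m h_m \<phi>m borel_measurable_times borel_measurable_diff borel_measurable_divide borel_measurable_const)+
      show "AE x in area_S2. (C * n x / (C * \<rho>) - 1 / (4 * pi)) * \<phi> x =
          (h x * exp (u x) / (C * \<rho>) - 1 / (4 * pi)) * \<phi> x"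
        using AE_hC by eventually_elim simp
    qed
    finally show "(\<integral>x. V x \<bullet> grad_S2 \<phi> x \<partial>area_S2) =
        \<rho> * (\<integral>x. (h x * exp (u x) / (\<integral>y. h y * exp (u y) \<partial>area_S2) - 1 / (4 * pi)) * \<phi> x \<partial>area_S2)"
      unfolding h_int .
  qed
  moreover have "axially_symmetric_AE p1 u"
    unfolding axially_symmetric_AE_def u_def by (intro exI[of _ U] AE_S2_I) simp
  ultimately show ?thesis by blast
qed

end
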